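(* Let $n\ge 3$. For $a\ne0$, the restriction $\mathcal{P}|_{\mathcal{C}_a}$ of the perimeter function to the space $\mathcal{C}_a$ of $n$-gons of oriented area $a$ is a perfect Morse function. Moreover: (1) If $a>0$, the critical points of $\mathcal{P}|_{\mathcal{C}_a}$ are exactly the regular stars (in $\mathcal{C}_a$) with positive winding numbers. For each critical point $P$, its Morse index $m(P)$ satisfies $m(P)+M(P)=2n-4$. (2) If $a<0$, the critical points of $\mathcal{P}|_{\mathcal{C}_a}$ are exactly the regular stars (in $\mathcal{C}_a$) with negative winding numbers. For each critical point $P$, its Morse index $m(P)$ satisfies $m(P)=M(P)$. Here $M(P)$ is the Morse index of $P$ as a critical point of $\mathcal{A}$ restricted to the space of $n$-gons with the same perimeter as $P$; namely $M(P)=-2w(P)-2$ if $w(P)<0$ and $M(P)=2n-2w(P)-2$ if $w(P)>0$, where $w(P)$ is the winding number of $P$.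
   Context: An $n$-gon is an $n$-tuple of points $(p_1,\dots,p_n)\in(\mathbb{R}^2)^n$, not all equal (but some may coincide), modulo the diagonal action of orientation-preserving isometries of the plane; $\mathcal{C}$ is the space of all $n$-gons. Perimeter: $\mathcal{P}(p_1,\dots,p_n)=|p_1p_2|+|p_2p_3|+\dots+|p_np_1|>0$. Oriented area: $2\mathcal{A}(p_1,\dots,p_n)=x_1y_2-x_2y_1+\dots+x_ny_1-x_1y_n$, $p_i=(x_i,y_i)$. $\mathcal{C}_a=\{\mathcal{A}=a\}\subset\mathcal{C}$. Let $\sigma(p_1,\dots,p_n)=(p_2,\dots,p_n,p_1)$. A regular star is an equilateral $n$-gon $P$ with $\sigma(P)=P$ in $\mathcal{C}$. A complete fold is a regular star with $p_i=p_{i+2}$ for all $i$; it exists only for even $n$ and has zero area. For a regular star that is not a complete fold, $w(P)$ denotes its winding number about its center; it determines $P$ up to dilation. At polygons with $p_i=p_{i+1}$ for some $i$, where $\mathcal{P}$ is not differentiable, criticality is understood in the sense of Clarke: $p$ is a critical point of $\mathcal{P}|_{\mathcal{C}_a}$ iff $\mu\nabla\mathcal{A}(p)\in\partial\mathcal{P}(p)$ for some $\mu\in\mathbb{R}$, $\partial\mathcal{P}$ being the Clarke subdifferential on $(\mathbb{R}^2)^n$. "Perfect Morse function" means that all critical points are nondegenerate and, for every $k$, the number of critical points of index $k$ equals the rank of $H_k$ of the domain. *)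

theory Defs
  imports "HOL-Homology.Homology" "HOL-Complex_Analysis.Complex_Analysis"
begin

section \<open>Tuples of points in the plane\<close>

text \<open>
  The plane is \<^typ>\<open>complex\<close>, and a tuple of \<^term>\<open>CARD('n)\<close> points is an element of the
  Euclidean space \<^typ>\<open>complex ^ 'n\<close>. The type \<^typ>\<open>'n\<close> carries no cyclic structure of its own, so
  its elements are numbered \<open>0, \<dots>, n - 1\<close> by the library enumeration of \<^term>\<open>UNIV :: 'n set\<close>;
  \<open>vertex p k\<close> is the \<open>k\<close>-th point, with \<open>k\<close> read modulo \<open>n\<close>.
\<close>

definition vertex :: "complex ^ 'n \<Rightarrow> nat \<Rightarrow> complex" where
  "vertex p k = p $ from_nat_into (UNIV :: 'n set) (k mod CARD('n))"

definition shift :: "complex ^ 'n \<Rightarrow> complex ^ 'n" where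
  "shift p = (\<chi> i. vertex p (to_nat_on (UNIV :: 'n set) i + 1))"

definition perimeter :: "complex ^ 'n \<Rightarrow> real" where
  "perimeter p = (\<Sum>k<CARD('n). dist (vertex p k) (vertex p (k + 1)))"

definition area :: "complex ^ 'n \<Rightarrow> real" where
  "area p = (\<Sum>k<CARD('n). Re (vertex p k) * Im (vertex p (k + 1))
                         - Re (vertex p (k + 1)) * Im (vertex p k)) / 2"


section \<open>The space of polygons\<close>

text \<open>The orientation-preserving isometries of the plane are the maps \<open>z \<mapsto> u z + b\<close>, \<open>\<bar>u\<bar> = 1\<close>.\<close>

definition move :: "complex \<Rightarrow> complex \<Rightarrow> complex ^ 'n \<Rightarrow> complex ^ 'n" where
  "move u b p = (\<chi> i. u * p $ i + b)"

definition orbit :: "complex ^ 'n \<Rightarrow> (complex ^ 'n) set" where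
  "orbit p = {move u b p | u b. norm u = 1}"

definition nonconst_tuples :: "(complex ^ 'n) set" where
  "nonconst_tuples = {p. \<exists>i j. p $ i \<noteq> p $ j}"

text \<open>A polygon is an orbit of non-constant tuples; the space of polygons has the quotient topology.\<close>

definition polygons :: "(complex ^ 'n) set set" where
  "polygons = orbit ` nonconst_tuples"

definition polygon_space :: "(complex ^ 'n) set topology" where
  "polygon_space = topology (\<lambda>U. U \<subseteq> polygons \<and>
     openin (top_of_set nonconst_tuples) {p \<in> nonconst_tuples. orbit p \<in> U})"

lemma istopology_polygon_space:
  "istopology (\<lambda>U. U \<subseteq> (polygons :: (complex ^ 'n) set set) \<and>
     openin (top_of_set nonconst_tuples) {p \<in> nonconst_tuples. orbit p \<in> U})"
  unfolding istopology_def
proof (intro conjI allI impI)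
  fix S T :: "(complex ^ 'n) set set"
  assume S: "S \<subseteq> polygons \<and> openin (top_of_set nonconst_tuples) {p \<in> nonconst_tuples. orbit p \<in> S}"
    and T: "T \<subseteq> polygons \<and> openin (top_of_set nonconst_tuples) {p \<in> nonconst_tuples. orbit p \<in> T}"
  show "S \<inter> T \<subseteq> polygons" using S by (meson le_infI1)
  have "{p \<in> nonconst_tuples. orbit p \<in> S \<inter> T} =
      {p \<in> nonconst_tuples. orbit p \<in> S} \<inter> {p \<in> nonconst_tuples. orbit p \<in> T}" by auto
  then show "openin (top_of_set nonconst_tuples) {p \<in> nonconst_tuples. orbit p \<in> S \<inter> T}"
    using openin_Int[OF conjunct2[OF S] conjunct2[OF T]] by simp
next
  fix K :: "(complex ^ 'n) set set set"
  assume K: "\<forall>U\<in>K. U \<subseteq> polygons \<and>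
    openin (top_of_set nonconst_tuples) {p \<in> nonconst_tuples. orbit p \<in> U}"
  show "\<Union>K \<subseteq> polygons" using K by (simp add: Sup_le_iff)
  have "{p \<in> nonconst_tuples. orbit p \<in> \<Union>K} =
      \<Union>((\<lambda>U. {p \<in> nonconst_tuples. orbit p \<in> U}) ` K)" by auto
  moreover have "openin (top_of_set nonconst_tuples)
      (\<Union>((\<lambda>U. {p \<in> nonconst_tuples. orbit p \<in> U}) ` K))"
    by (rule openin_Union) (use K in auto)
  ultimately show "openin (top_of_set nonconst_tuples) {p \<in> nonconst_tuples. orbit p \<in> \<Union>K}"
    by simp
qed

lemma openin_polygon_space:
  fixes U :: "(complex ^ 'n) set set"
  shows "openin polygon_space U \<longleftrightarrow> U \<subseteq> polygons \<and>
     openin (top_of_set nonconst_tuples) {p \<in> nonconst_tuples. orbit p \<in> U}"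
  unfolding polygon_space_def topology_inverse'[OF istopology_polygon_space] by (rule refl)

lemma quotient_map_orbit:
  "quotient_map (top_of_set nonconst_tuples) polygon_space
     (orbit :: complex ^ 'n \<Rightarrow> (complex ^ 'n) set)"
proof -
  have "{p \<in> nonconst_tuples. orbit p \<in> polygons} = (nonconst_tuples :: (complex ^ 'n) set)"
    by (auto simp: polygons_def)
  then have "openin polygon_space (polygons :: (complex ^ 'n) set set)"
    by (simp add: openin_polygon_space)
  then have "topspace polygon_space = (polygons :: (complex ^ 'n) set set)"
    using openin_subset openin_polygon_space openin_topspace by (intro equalityI) blast+
  then show ?thesis
    unfolding quotient_map_def by (simp add: openin_polygon_space polygons_def)
qed

text \<open>
  All notions below that are stated for tuples and applied to a polygon \<open>P\<close> are invariant under
  \<^const>\<open>move\<close> with \<^term>\<open>norm u = 1\<close>, so they are evaluated at an arbitrary representative.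
\<close>

definition rep :: "(complex ^ 'n) set \<Rightarrow> complex ^ 'n" where
  "rep P = (SOME p. p \<in> P)"

definition level_polygons :: "real \<Rightarrow> (complex ^ 'n) set set" where
  "level_polygons a = {P \<in> polygons. area (rep P) = a}"

definition level_space :: "real \<Rightarrow> (complex ^ 'n) set topology" where
  "level_space a = subtopology polygon_space (level_polygons a)"


section \<open>Regular stars\<close>

definition equilateral :: "complex ^ 'n \<Rightarrow> bool" where
  "equilateral p \<longleftrightarrow>
     (\<forall>k l. dist (vertex p k) (vertex p (k + 1)) = dist (vertex p l) (vertex p (l + 1)))"

definition regular_star :: "(complex ^ 'n) set \<Rightarrow> bool" where
  "regular_star P \<longleftrightarrow> P \<in> polygons \<and> equilateral (rep P) \<and> orbit (shift (rep P)) = P"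

definition complete_fold :: "(complex ^ 'n) set \<Rightarrow> bool" where
  "complete_fold P \<longleftrightarrow> regular_star P \<and> (\<forall>k. vertex (rep P) k = vertex (rep P) (k + 2))"

fun polygonal_path :: "complex list \<Rightarrow> real \<Rightarrow> complex" where
  "polygonal_path [] = linepath 0 0"
| "polygonal_path [a] = linepath a a"
| "polygonal_path [a, b] = linepath a b"
| "polygonal_path (a # b # c # zs) = linepath a b +++ polygonal_path (b # c # zs)"

definition boundary_path :: "complex ^ 'n \<Rightarrow> real \<Rightarrow> complex" where
  "boundary_path p = polygonal_path (map (vertex p) [0..<CARD('n) + 1])"

definition center :: "complex ^ 'n \<Rightarrow> complex" where
  "center p = (\<Sum>k<CARD('n). vertex p k) / of_nat CARD('n)"

text \<open>
  The library's winding number is complex-valued; around a closed path avoiding the point it is an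
  integer. A complete fold passes through its center and has no winding number.
\<close>

definition winding :: "(complex ^ 'n) set \<Rightarrow> int" where
  "winding P = (THE w. winding_number (boundary_path (rep P)) (center (rep P)) = of_int w)"


section \<open>Clarke critical points\<close>

definition clarke_derivative :: "('a :: real_normed_vector \<Rightarrow> real) \<Rightarrow> 'a \<Rightarrow> 'a \<Rightarrow> ereal" where
  "clarke_derivative f x v =
     Limsup (nhds x \<times>\<^sub>F at_right 0) (\<lambda>(y, t). ereal ((f (y + t *\<^sub>R v) - f y) / t))"

definition clarke_subdifferential :: "('a :: real_inner \<Rightarrow> real) \<Rightarrow> 'a \<Rightarrow> 'a set" where
  "clarke_subdifferential f x = {\<xi>. \<forall>v. ereal (\<xi> \<bullet> v) \<le> clarke_derivative f x v}"

definition critical :: "(complex ^ 'n) set \<Rightarrow> bool" where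
  "critical P \<longleftrightarrow> (\<exists>\<mu> g. (GDERIV area (rep P) :> g) \<and>
     \<mu> *\<^sub>R g \<in> clarke_subdifferential perimeter (rep P))"

definition critical_polygons :: "real \<Rightarrow> (complex ^ 'n) set set" where
  "critical_polygons a = {P \<in> level_polygons a. critical P}"


section \<open>Nondegeneracy and Morse index\<close>

definition C2_near :: "('a :: real_normed_vector \<Rightarrow> 'b :: real_normed_vector) \<Rightarrow> 'a \<Rightarrow> bool" where
  "C2_near f x \<longleftrightarrow> (\<exists>U f' f''. open U \<and> x \<in> U \<and>
     (\<forall>y\<in>U. (f has_derivative blinfun_apply (f' y)) (at y) \<and>
            (f' has_derivative blinfun_apply (f'' y)) (at y)) \<and>
     continuous_on U f'')"

text \<open>The tangent space at \<open>p\<close> of the orbit of \<open>p\<close>.\<close>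

definition orbit_tangent :: "complex ^ 'n \<Rightarrow> (complex ^ 'n) set" where
  "orbit_tangent p = {(\<chi> i. \<i> * of_real t * p $ i + b) | t b. True}"

text \<open>
  Local coordinates at the orbit of \<open>p\<close> on the quotient of the hypersurface \<open>{F = F p}\<close> by the
  isometries, for an invariant \<open>F\<close> that is regular at \<open>p\<close>. The quotient has dimension
  \<open>2n - 1 - 3 = 2n - 4\<close>, and the coordinate domain is a neighbourhood of \<open>0\<close> in a linear space \<open>V\<close> of
  that dimension, which without loss of generality is a subspace of \<^typ>\<open>complex ^ 'n\<close>. The map
  \<open>\<phi>\<close> lifts the parametrization \<open>v \<mapsto> orbit (\<phi> v)\<close>. Its last condition says that this
  parametrization is an immersion at \<open>0\<close>, hence, the dimensions being equal, a local diffeomorphism.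
  Only the values of \<open>\<phi>\<close> on \<open>V\<close> matter; defining it on a neighbourhood of \<open>0\<close> in the whole space
  makes its derivatives unique.
\<close>

definition local_chart ::
  "(complex ^ 'n \<Rightarrow> real) \<Rightarrow> complex ^ 'n \<Rightarrow> (complex ^ 'n) set \<Rightarrow> (complex ^ 'n \<Rightarrow> complex ^ 'n) \<Rightarrow> bool"
  where
  "local_chart F p V \<phi> \<longleftrightarrow>
     subspace V \<and> dim V = 2 * CARD('n) - 4 \<and>
     C2_near \<phi> 0 \<and> \<phi> 0 = p \<and>
     (\<forall>\<^sub>F v in nhds 0. v \<in> V \<longrightarrow> F (\<phi> v) = F p) \<and>
     (\<forall>v\<in>V. frechet_derivative \<phi> (at 0) v \<in> orbit_tangent p \<longrightarrow> v = 0)"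

text \<open>
  \<open>f\<close> has gradient \<open>g\<close> near \<open>x\<close>, and \<open>H\<close> is the derivative of the gradient at \<open>x\<close>; the Hessian form
  is \<open>(v, w) \<mapsto> v \<bullet> H w\<close>.
\<close>

definition has_grad_hessian ::
  "('a :: real_inner \<Rightarrow> real) \<Rightarrow> 'a \<Rightarrow> 'a \<Rightarrow> ('a \<Rightarrow> 'a) \<Rightarrow> bool" where
  "has_grad_hessian f x g0 H \<longleftrightarrow>
     (\<exists>g. (\<forall>\<^sub>F y in nhds x. GDERIV f y :> g y) \<and> g x = g0 \<and> (g has_derivative H) (at x))"

text \<open>
  The orbit of \<open>p\<close> is a critical point of \<open>f\<close> restricted to the quotient of \<open>{F = F p}\<close>, and \<open>H\<close>,
  restricted to \<open>V\<close>, is the Hessian at that point in some local coordinates with domain in \<open>V\<close>.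
\<close>

definition restricted_hessian ::
  "(complex ^ 'n \<Rightarrow> real) \<Rightarrow> (complex ^ 'n \<Rightarrow> real) \<Rightarrow> complex ^ 'n \<Rightarrow>
   (complex ^ 'n) set \<Rightarrow> (complex ^ 'n \<Rightarrow> complex ^ 'n) \<Rightarrow> bool" where
  "restricted_hessian F f p V H \<longleftrightarrow>
     (\<exists>\<phi> g0. local_chart F p V \<phi> \<and> has_grad_hessian (f \<circ> \<phi>) 0 g0 H \<and> (\<forall>v\<in>V. g0 \<bullet> v = 0))"

definition nondegenerate_critical ::
  "(complex ^ 'n \<Rightarrow> real) \<Rightarrow> (complex ^ 'n \<Rightarrow> real) \<Rightarrow> (complex ^ 'n) set \<Rightarrow> bool" where
  "nondegenerate_critical F f P \<longleftrightarrow>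
     (\<exists>V H. restricted_hessian F f (rep P) V H \<and> (\<forall>v\<in>V. (\<forall>w\<in>V. w \<bullet> H v = 0) \<longrightarrow> v = 0))"

definition negative_index :: "'a :: euclidean_space set \<Rightarrow> ('a \<Rightarrow> 'a) \<Rightarrow> nat" where
  "negative_index V H =
     Max {dim W | W. subspace W \<and> W \<subseteq> V \<and> (\<forall>w\<in>W. w \<noteq> 0 \<longrightarrow> w \<bullet> H w < 0)}"

text \<open>
  The Morse index at \<open>P\<close> of \<open>f\<close> restricted to the quotient of \<open>{F = F (rep P)}\<close>. It is well defined
  because the Hessian form at a critical point transforms linearly under change of coordinates.
  Thus \<open>morse_index area perimeter\<close> concerns polygons of fixed area and
  \<open>morse_index perimeter area\<close> polygons of fixed perimeter.
\<close>

definition morse_index ::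
  "(complex ^ 'n \<Rightarrow> real) \<Rightarrow> (complex ^ 'n \<Rightarrow> real) \<Rightarrow> (complex ^ 'n) set \<Rightarrow> nat" where
  "morse_index F f P =
     (THE m. \<exists>V H. restricted_hessian F f (rep P) V H \<and> m = negative_index V H)"


section \<open>Perfect Morse functions\<close>

text \<open>
  The rank of an abelian group: the supremum of the sizes of its finite subsets that are linearly
  independent over the integers.
\<close>

definition int_independent :: "('a, 'b) monoid_scheme \<Rightarrow> 'a set \<Rightarrow> bool" where
  "int_independent G B \<longleftrightarrow> finite B \<and> B \<subseteq> carrier G \<and>
     (\<forall>c :: 'a \<Rightarrow> int. finprod G (\<lambda>x. x [^]\<^bsub>G\<^esub> c x) B = \<one>\<^bsub>G\<^esub> \<longrightarrow> (\<forall>x\<in>B. c x = 0))"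

definition group_rank :: "('a, 'b) monoid_scheme \<Rightarrow> enat" where
  "group_rank G = (SUP B \<in> {B. int_independent G B}. enat (card B))"

definition index_polygons :: "real \<Rightarrow> nat \<Rightarrow> (complex ^ 'n) set set" where
  "index_polygons a k = {P \<in> critical_polygons a. morse_index area perimeter P = k}"

text \<open>The perimeter on the space of polygons of area \<open>a\<close>; the type argument fixes the number of vertices.\<close>

definition perimeter_perfect_Morse :: "'n :: finite itself \<Rightarrow> real \<Rightarrow> bool" where
  "perimeter_perfect_Morse _ a \<longleftrightarrow>
     (\<forall>P \<in> (critical_polygons a :: (complex ^ 'n) set set).
        nondegenerate_critical area perimeter P) \<and>
     (\<forall>k. finite (index_polygons a k :: (complex ^ 'n) set set) \<and>
        enat (card (index_polygons a k :: (complex ^ 'n) set set)) =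
          group_rank (homology_group (int k) (level_space a :: (complex ^ 'n) set topology)))"

end

(*
  Homology. The discrete Fourier transform diagonalizes the area: the area of p is the sum of
  sin (2 pi j / n) |z_j|^2 / (2 n), and translations only change z_0. A polygon modulo isometries is
  thus the Gram matrix z z^* of a vector z with z_0 = 0. Damping the modes whose weight does not
  have the sign of the area a deforms the level set {area = a} onto the Gram matrices supported on
  the floor((n - 1) / 2) modes of the right sign, a complex projective space, whose homology follows
  by attaching one even cell at a time.

  Critical points. At a critical polygon a zero edge next to a nonzero one is impossible, because
  moving its first vertex alone would decrease perimeter - mu * area; so all edges are nonzero and
  the Lagrange equation makes consecutive edges differ by a constant rotation.

  Indices. In coordinates x_k + i y_k rotating with a star of winding number w, with
  s = sin (pi w / n) and c = cos (pi w / n), the Hessian of perimeter - mu * area is a positive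
  multiple of the sum of
    s^2 (y_{k+1} - y_k + (s / c) (x_k + x_{k+1}))^2 + ((x_{k+1} - x_k)^2 - 4 s^2 x_k^2) / c^2.
  Its sign on the mode x = cos (2 pi j k / n) + sin (2 pi j k / n), with y solving the first square,
  is that of sin (pi j / n)^2 - s^2, so there are 2 |w| - 2 negative directions. For fixed perimeter
  the Hessian of the area is -1/mu times the same form, and mu has the sign of w.
*)
theory Submission
  imports Defs
begin

text \<open>Perfectness is not deduced from Morse inequalities: the homology and the number of
  critical polygons of each index are computed independently and compared. Each w with the sign of a
  and 2 |w| < n gives exactly one critical polygon, of index 2 |w| - 2, and there are as many such w
  as Fourier modes of the right sign. Two obstacles shape the rest. The space of polygons is an
  abstract quotient; Gram matrices embed it in a Euclidean space, where homotopies are formulas free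
  of choices. The Morse index refers to arbitrary charts; it is computed from the Hessian of a
  Lagrangian on the tangent space of the hypersurface of tuples, of dimension 2 n - 1. The three
  orbit directions lie in the radical there, and exhibiting 2 |w| - 2 negative and 2 n - 2 - 2 |w|
  positive directions exhausts the dimension. This yields the index in every chart together with
  nondegeneracy. The sum of squares quoted for the Hessian holds up to a difference that telescopes
  around the polygon. Mode 0 is ruled out by the area constraint; the modes |w| and n - |w| are the
  translations.\<close>

no_notation fps_nth (infixl "$" 75)

section \<open>The homology of complex projective space\<close>

definition gram :: "complex ^ 'n \<Rightarrow> complex ^ 'n ^ 'n" where
  "gram z = (\<chi> i j. z $ i * cnj (z $ j))"

text \<open>On \<open>gram z\<close> this is the diagonal quadratic form in z with coefficients c.
  Written as a real linear function of the matrix, it can be brought to any value of the same sign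
  by rescaling the matrix.\<close>

definition trace_form :: "('n :: finite \<Rightarrow> real) \<Rightarrow> complex ^ 'n ^ 'n \<Rightarrow> real" where
  "trace_form c M = (\<Sum>i\<in>UNIV. c i * Re (M $ i $ i))"

definition coord_space :: "'n set \<Rightarrow> (complex ^ 'n) set" where
  "coord_space K = {z. \<forall>i. i \<notin> K \<longrightarrow> z $ i = 0}"

text \<open>Two instances matter: with the Fourier weights of the area it models the polygons of
  area a, and with c = 1 and a = 1 it is complex projective space as the set of projections onto
  lines.\<close>

definition gram_level :: "('n :: finite \<Rightarrow> real) \<Rightarrow> real \<Rightarrow> 'n set \<Rightarrow> (complex ^ 'n ^ 'n) set" where
  "gram_level c a K = gram ` {z \<in> coord_space K. trace_form c (gram z) = a}"

abbreviation proj_space :: "'n :: finite set \<Rightarrow> (complex ^ 'n ^ 'n) set" where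
  "proj_space \<equiv> gram_level (\<lambda>_. 1) 1"

definition weight :: "'n set \<Rightarrow> real \<Rightarrow> 'n \<Rightarrow> real" where
  "weight R t i = (if i \<in> R then 1 else t)"

definition damp :: "'n set \<Rightarrow> real \<Rightarrow> complex ^ 'n \<Rightarrow> complex ^ 'n" where
  "damp R t z = (\<chi> i. weight R t i *\<^sub>R z $ i)"

text \<open>Damping expressed on matrices, so that the homotopies are continuous in M without any
  continuous choice of z.\<close>

definition gram_damp :: "'n set \<Rightarrow> real \<Rightarrow> complex ^ 'n ^ 'n \<Rightarrow> complex ^ 'n ^ 'n" where
  "gram_damp R t M = (\<chi> i j. (weight R t i * weight R t j) *\<^sub>R M $ i $ j)"

lemma gram_nth [simp]: "gram z $ i $ j = z $ i * cnj (z $ j)"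
  by (simp add: gram_def)

lemma gram_diagonal: "Re (gram z $ i $ i) = (cmod (z $ i))\<^sup>2"
  by (metis Re_complex_of_real complex_norm_square gram_nth)

lemma gram_diagonal_of_real: "gram z $ i $ i = of_real ((cmod (z $ i))\<^sup>2)"
  using complex_norm_square[of "z $ i"] by simp

lemma gram_scaleR: "gram (s *\<^sub>R z) = s\<^sup>2 *\<^sub>R gram z"
  by (simp add: vec_eq_iff power2_eq_square)

lemma gram_damp_gram: "gram_damp R t (gram z) = gram (damp R t z)"
  by (simp add: vec_eq_iff gram_damp_def damp_def)

lemma trace_form_scaleR: "trace_form c (s *\<^sub>R M) = s * trace_form c M"
  by (simp add: trace_form_def sum_distrib_left mult_ac)

lemma trace_form_gram: "trace_form c (gram z) = (\<Sum>i\<in>UNIV. c i * (cmod (z $ i))\<^sup>2)"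
  unfolding trace_form_def gram_diagonal ..

lemma trace_form_damp:
  "trace_form c (gram (damp R t z)) = (\<Sum>i\<in>UNIV. c i * (weight R t i)\<^sup>2 * (cmod (z $ i))\<^sup>2)"
  by (simp add: trace_form_gram damp_def power_mult_distrib mult_ac)

lemma continuous_on_trace_form [continuous_intros]:
  "continuous_on A f \<Longrightarrow> continuous_on A (\<lambda>x. trace_form c (f x))"
  unfolding trace_form_def by (intro continuous_intros)

lemma continuous_on_gram [continuous_intros]:
  "continuous_on A f \<Longrightarrow> continuous_on A (\<lambda>x. gram (f x))"
  unfolding gram_def by (intro continuous_intros)

lemma continuous_on_weight [continuous_intros]:
  "continuous_on A f \<Longrightarrow> continuous_on A (\<lambda>x. weight R (f x) i)"
  unfolding weight_def by (cases "i \<in> R") (auto intro: continuous_intros)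

lemma continuous_on_gram_damp [continuous_intros]:
  "continuous_on A f \<Longrightarrow> continuous_on A g \<Longrightarrow> continuous_on A (\<lambda>x. gram_damp R (f x) (g x))"
  unfolding gram_damp_def by (intro continuous_intros)

text \<open>The sign condition makes the factor positive, hence the square of a real number by which
  z can be scaled.\<close>

lemma gram_level_normalize:
  assumes "z \<in> coord_space K" "0 < a * trace_form c (gram z)"
  shows "(a / trace_form c (gram z)) *\<^sub>R gram z \<in> gram_level c a K"
proof -
  define w where "w = trace_form c (gram z)"
  have w: "0 < a / w" "w \<noteq> 0" using assms(2) by (auto simp: w_def zero_less_mult_iff zero_less_divide_iff)
  have "(a / w) *\<^sub>R gram z = gram (sqrt (a / w) *\<^sub>R z)"
    using w by (simp add: gram_scaleR)
  moreover have "trace_form c ((a / w) *\<^sub>R gram z) = a"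
    using w by (simp add: trace_form_scaleR w_def)
  moreover have "sqrt (a / w) *\<^sub>R z \<in> coord_space K"
    using assms(1) by (simp add: coord_space_def)
  ultimately show ?thesis by (auto simp: gram_level_def w_def)
qed

lemma coord_space_damp:
  "z \<in> coord_space K \<Longrightarrow> damp R t z \<in> coord_space K"
  "z \<in> coord_space K \<Longrightarrow> damp R 0 z \<in> coord_space R"
  "z \<in> coord_space R \<Longrightarrow> damp R t z = z"
  "damp R 1 z = z"
  by (auto simp: coord_space_def damp_def weight_def vec_eq_iff)

text \<open>Damp the coordinates outside R from t = 1 down to t = 0 and renormalize to the level a
  throughout; this fixes the matrices supported on R. The set X is kept general because the argument
  serves twice: for a whole level of the area form and for projective space minus a point.\<close>

lemma gram_level_deformation:
  assumes "R \<subseteq> K" and X: "X \<subseteq> gram_level c a K" and RX: "gram_level c a R \<subseteq> X" and "a \<noteq> 0"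
    and pos: "\<And>z t. gram z \<in> X \<Longrightarrow> z \<in> coord_space K \<Longrightarrow> 0 \<le> t \<Longrightarrow> t \<le> 1 \<Longrightarrow>
      0 < a * trace_form c (gram (damp R t z))"
    and stay: "\<And>z t. gram z \<in> X \<Longrightarrow> z \<in> coord_space K \<Longrightarrow> 0 \<le> t \<Longrightarrow> t \<le> 1 \<Longrightarrow>
      (a / trace_form c (gram (damp R t z))) *\<^sub>R gram (damp R t z) \<in> X"
  shows "X homotopy_eqv gram_level c a R"
proof -
  define h where "h = (\<lambda>(t, M). (a / trace_form c (gram_damp R t M)) *\<^sub>R gram_damp R t M)"
  have rep: "\<exists>z \<in> coord_space K. M = gram z \<and> trace_form c (gram z) = a" if "M \<in> X" for M
    using X that by (auto simp: gram_level_def)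
  have nz: "trace_form c (gram_damp R t M) \<noteq> 0" if "M \<in> X" "0 \<le> t" "t \<le> 1" for t M
    using rep[OF that(1)] pos that by (force simp: gram_damp_gram)
  have cont: "continuous_on ({0..1} \<times> X) h"
    unfolding h_def case_prod_unfold by (intro continuous_intros) (auto simp: nz)
  have into: "h (t, M) \<in> X" if "M \<in> X" "0 \<le> t" "t \<le> 1" for t M
    using rep[OF that(1)] stay that by (force simp: h_def gram_damp_gram)
  have h1: "h (1, M) = M" if "M \<in> X" for M
    using rep[OF that] \<open>a \<noteq> 0\<close> by (auto simp: h_def gram_damp_gram coord_space_damp)
  have h0: "h (0, M) \<in> gram_level c a R" if "M \<in> X" for M
  proof -
    obtain z where z: "z \<in> coord_space K" "M = gram z" using rep[OF \<open>M \<in> X\<close>] by auto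
    show ?thesis
      using gram_level_normalize[OF coord_space_damp(2)[OF z(1)] pos[of z 0]] z that
      by (simp add: h_def gram_damp_gram)
  qed
  have fix0: "h (0, M) = M" if "M \<in> gram_level c a R" for M
    using that \<open>a \<noteq> 0\<close> by (auto simp: gram_level_def h_def gram_damp_gram coord_space_damp)
  have "homotopic_with_canon (\<lambda>_. True) X X (\<lambda>M. h (0, M)) id"
    by (subst homotopic_with, simp, rule exI[of _ h])
       (auto simp: into h1 intro!: continuous_on_subset[OF cont])
  moreover have "retraction X (gram_level c a R) (\<lambda>M. h (0, M))"
    unfolding retraction_def using RX h0 fix0
    by (auto intro!: continuous_on_compose2[OF cont] continuous_intros)
  ultimately show ?thesis
    by (intro deformation_retract_imp_homotopy_eqv) (auto simp: homotopic_with_sym)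
qed

text \<open>The modes of K outside R contribute nonpositive terms to a times the form. Damping
  multiplies these by t^2 <= 1, so the product can only grow and stays positive.\<close>

lemma gram_level_eqv_positive:
  assumes "R \<subseteq> K" "a \<noteq> 0" and R: "\<And>i. i \<in> R \<Longrightarrow> 0 < a * c i"
    and KR: "\<And>i. i \<in> K \<Longrightarrow> i \<notin> R \<Longrightarrow> a * c i \<le> 0"
  shows "gram_level c a K homotopy_eqv gram_level c a R"
proof (rule gram_level_deformation[OF \<open>R \<subseteq> K\<close> order_refl])
  show "gram_level c a R \<subseteq> gram_level c a K"
    using \<open>R \<subseteq> K\<close> by (auto simp: gram_level_def coord_space_def)
  show pos: "0 < a * trace_form c (gram (damp R t z))"
    if "gram z \<in> gram_level c a K" "z \<in> coord_space K" "0 \<le> t" "t \<le> 1" for z t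
  proof -
    have "trace_form c (gram z) = a" using that(1) by (auto simp: gram_level_def)
    then have "0 < a * trace_form c (gram z)" using \<open>a \<noteq> 0\<close> by (auto simp: zero_less_mult_iff)
    also have "\<dots> = (\<Sum>i\<in>UNIV. a * c i * (cmod (z $ i))\<^sup>2)"
      by (simp add: trace_form_gram sum_distrib_left mult_ac)
    also have "\<dots> \<le> (\<Sum>i\<in>UNIV. (weight R t i)\<^sup>2 * (a * c i * (cmod (z $ i))\<^sup>2))"
    proof (rule sum_mono)
      fix i
      show "a * c i * (cmod (z $ i))\<^sup>2 \<le> (weight R t i)\<^sup>2 * (a * c i * (cmod (z $ i))\<^sup>2)"
      proof (cases "i \<in> R \<or> i \<notin> K")
        case True
        then show ?thesis using that(2) by (auto simp: weight_def coord_space_def)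
      next
        case False
        then have "a * c i * (cmod (z $ i))\<^sup>2 \<le> 0" using KR by (simp add: mult_nonpos_nonneg)
        moreover have "t\<^sup>2 \<le> 1" using that by (simp add: power_le_one)
        ultimately show ?thesis using False
          by (simp add: weight_def) (metis mult_right_mono_neg mult_1)
      qed
    qed
    also have "\<dots> = a * trace_form c (gram (damp R t z))"
      by (simp add: trace_form_damp sum_distrib_left mult_ac)
    finally show ?thesis .
  qed
  show "(a / trace_form c (gram (damp R t z))) *\<^sub>R gram (damp R t z) \<in> gram_level c a K"
    if "gram z \<in> gram_level c a K" "z \<in> coord_space K" "0 \<le> t" "t \<le> 1" for z t
    by (rule gram_level_normalize[OF coord_space_damp(1)[OF that(2)] pos[OF that]])
qed fact

lemma gram_level_trace_form_pos:
  assumes M: "M \<in> gram_level c a R" and "a \<noteq> 0" and d: "\<And>i. i \<in> R \<Longrightarrow> 0 < b * d i"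
  shows "0 < b * trace_form d M"
proof -
  obtain z where z: "z \<in> coord_space R" "M = gram z" "trace_form c (gram z) = a"
    using M by (auto simp: gram_level_def)
  have "\<exists>i. z $ i \<noteq> 0"
  proof (rule ccontr)
    assume "\<nexists>i. z $ i \<noteq> 0"
    then have "trace_form c (gram z) = 0" by (simp add: trace_form_gram)
    then show False using z(3) \<open>a \<noteq> 0\<close> by simp
  qed
  then obtain i where i: "z $ i \<noteq> 0" "i \<in> R"
    using z(1) by (auto simp: coord_space_def)
  have "0 \<le> b * d j * (cmod (z $ j))\<^sup>2" for j
    using d[of j] z(1) by (cases "j \<in> R") (auto simp: coord_space_def)
  then have "0 < (\<Sum>i\<in>UNIV. b * d i * (cmod (z $ i))\<^sup>2)"
    using i d by (intro sum_pos2[where i = i]) auto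
  then show ?thesis by (simp add: z trace_form_gram sum_distrib_left mult_ac)
qed

lemma gram_level_rescale_map:
  assumes "a \<noteq> 0" "b \<noteq> 0" and d: "\<And>i. i \<in> R \<Longrightarrow> 0 < b * d i"
  shows "M \<in> gram_level c a R \<Longrightarrow> (b / trace_form d M) *\<^sub>R M \<in> gram_level d b R"
    and "M \<in> gram_level c a R \<Longrightarrow>
      (a / trace_form c ((b / trace_form d M) *\<^sub>R M)) *\<^sub>R (b / trace_form d M) *\<^sub>R M = M"
    and "continuous_on (gram_level c a R) (\<lambda>M. (b / trace_form d M) *\<^sub>R M)"
proof -
  have pos: "0 < b * trace_form d M" if "M \<in> gram_level c a R" for M
    using gram_level_trace_form_pos[OF that \<open>a \<noteq> 0\<close>, of b d] d by blast
  show "(b / trace_form d M) *\<^sub>R M \<in> gram_level d b R" if M: "M \<in> gram_level c a R"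
  proof -
    obtain z where z: "z \<in> coord_space R" "M = gram z" using M by (auto simp: gram_level_def)
    show ?thesis using gram_level_normalize[of z R b d] pos[OF M] z by simp
  qed
  show "(a / trace_form c ((b / trace_form d M) *\<^sub>R M)) *\<^sub>R (b / trace_form d M) *\<^sub>R M = M"
    if M: "M \<in> gram_level c a R"
  proof -
    have "trace_form c M = a" using M by (auto simp: gram_level_def)
    moreover have "trace_form d M \<noteq> 0" using pos[OF M] by force
    ultimately show ?thesis using assms by (simp add: trace_form_scaleR)
  qed
  show "continuous_on (gram_level c a R) (\<lambda>M. (b / trace_form d M) *\<^sub>R M)"
  proof (intro continuous_intros ballI)
    show "trace_form d M \<noteq> 0" if "M \<in> gram_level c a R" for M using pos[OF that] by force
  qed
qed

text \<open>Both levels meet every ray of Gram matrices of nonzero vectors supported on R exactly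
  once; the homeomorphism slides along the rays.\<close>

lemma gram_level_rescale:
  assumes c: "\<And>i. i \<in> R \<Longrightarrow> 0 < a * c i" and d: "\<And>i. i \<in> R \<Longrightarrow> 0 < b * d i" and "a \<noteq> 0" "b \<noteq> 0"
  shows "gram_level c a R homeomorphic gram_level d b R"
  unfolding homeomorphic_minimal
proof (intro exI conjI ballI)
  fix M assume M: "M \<in> gram_level c a R"
  show "(b / trace_form d M) *\<^sub>R M \<in> gram_level d b R"
    by (rule gram_level_rescale_map(1)) (use M assms in auto)
  show "(a / trace_form c ((b / trace_form d M) *\<^sub>R M)) *\<^sub>R (b / trace_form d M) *\<^sub>R M = M"
    by (rule gram_level_rescale_map(2)) (use M assms in auto)
next
  fix M assume M: "M \<in> gram_level d b R"
  show "(a / trace_form c M) *\<^sub>R M \<in> gram_level c a R"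
    by (rule gram_level_rescale_map(1)) (use M assms in auto)
  show "(b / trace_form d ((a / trace_form c M) *\<^sub>R M)) *\<^sub>R (a / trace_form c M) *\<^sub>R M = M"
    by (rule gram_level_rescale_map(2)) (use M assms in auto)
next
  show "continuous_on (gram_level c a R) (\<lambda>M. (b / trace_form d M) *\<^sub>R M)"
    by (rule gram_level_rescale_map(3)) (use assms in auto)
  show "continuous_on (gram_level d b R) (\<lambda>M. (a / trace_form c M) *\<^sub>R M)"
    by (rule gram_level_rescale_map(3)) (use assms in auto)
qed

text \<open>The entry \<open>M $ s $ s\<close> equals 1 only at the coordinate line of s. At any
  other point some other coordinate is nonzero, so damping coordinate s never reaches the zero
  vector and retracts onto the hyperplane where this coordinate vanishes.\<close>

lemma proj_space_puncture:
  assumes "s \<in> S"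
  shows "{M \<in> proj_space S. M $ s $ s \<noteq> 1} homotopy_eqv proj_space (S - {s})"
proof (rule gram_level_deformation[of _ S])
  have split: "trace_form (\<lambda>_. 1) (gram z) = (\<Sum>i\<in>UNIV-{s}. (cmod (z $ i))\<^sup>2) + (cmod (z $ s))\<^sup>2" for z
    by (simp add: trace_form_gram sum.remove[of UNIV s])
  have damp: "(\<Sum>i\<in>UNIV-{s}. (cmod (damp (S - {s}) t z $ i))\<^sup>2) = (\<Sum>i\<in>UNIV-{s}. (cmod (z $ i))\<^sup>2)"
    if "z \<in> coord_space S" for t z
    using that by (intro sum.cong) (auto simp: damp_def weight_def coord_space_def)
  have rest: "0 < (\<Sum>i\<in>UNIV-{s}. (cmod (z $ i))\<^sup>2)"
    if "gram z \<in> {M \<in> proj_space S. M $ s $ s \<noteq> 1}" for z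
  proof -
    have tr: "trace_form (\<lambda>_. 1) (gram z) = 1"
      using that by (auto simp: gram_level_def)
    have "(cmod (z $ s))\<^sup>2 \<noteq> 1" using that gram_diagonal_of_real[of z s]
      by (metis (mono_tags, lifting) mem_Collect_eq of_real_1)
    then have "(\<Sum>i\<in>UNIV-{s}. (cmod (z $ i))\<^sup>2) \<noteq> 0" using tr split[of z] by linarith
    moreover have "(\<Sum>i\<in>UNIV-{s}. (cmod (z $ i))\<^sup>2) \<ge> 0" by (intro sum_nonneg) auto
    ultimately show ?thesis by linarith
  qed
  show pos: "0 < 1 * trace_form (\<lambda>_. 1) (gram (damp (S - {s}) t z))"
    if "gram z \<in> {M \<in> proj_space S. M $ s $ s \<noteq> 1}" "z \<in> coord_space S" "0 \<le> t" "t \<le> 1" for z t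
    using rest[OF that(1)] by (simp add: split damp[OF that(2)] add_pos_nonneg)
  show "(1 / trace_form (\<lambda>_. 1) (gram (damp (S - {s}) t z))) *\<^sub>R gram (damp (S - {s}) t z)
      \<in> {M \<in> proj_space S. M $ s $ s \<noteq> 1}"
    if z: "gram z \<in> {M \<in> proj_space S. M $ s $ s \<noteq> 1}" "z \<in> coord_space S" "0 \<le> t" "t \<le> 1" for z t
  proof -
    define y where "y = damp (S - {s}) t z"
    define T where "T = trace_form (\<lambda>_. 1) (gram y)"
    have "T > (cmod (y $ s))\<^sup>2" "T > 0"
      unfolding T_def y_def using rest[OF z(1)] pos[OF z] by (auto simp: split damp[OF that(2)])
    then have "Re (((1 / T) *\<^sub>R gram y) $ s $ s) \<noteq> 1"
      using gram_diagonal[of y s] by (simp del: gram_nth)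
    moreover have "(1 / T) *\<^sub>R gram y \<in> proj_space S"
      unfolding T_def y_def by (rule gram_level_normalize[OF coord_space_damp(1)[OF z(2)] pos[OF z]])
    ultimately show ?thesis by (auto simp: T_def y_def simp del: gram_nth vector_scaleR_component)
  qed
  show "proj_space (S - {s}) \<subseteq> {M \<in> proj_space S. M $ s $ s \<noteq> 1}"
    by (auto simp: gram_level_def coord_space_def)
qed auto

section \<open>Homology of complex projective space\<close>

definition even_homology :: "nat \<Rightarrow> 'a topology \<Rightarrow> bool" where
  "even_homology m X \<longleftrightarrow> (\<forall>p. if even p \<and> 0 \<le> p \<and> p < 2 * int m
     then homology_group p X \<cong> integer_group else trivial_group (homology_group p X))"

lemma exact_seq_trivial_middle:
  assumes "exact_seq ([C, B, A], [g, f])" "trivial_group A" "trivial_group C"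
  shows "trivial_group B"
proof -
  have h: "group_hom A B f" "group_hom B C g" and eq: "f ` carrier A = kernel B C g"
    using assms(1) by (auto simp: group_hom_def group_hom_axioms_def)
  have "kernel B C g = carrier B"
    using h(2) assms(3) by (simp add: group_hom.kernel_to_trivial_group)
  moreover have "f ` carrier A = {\<one>\<^bsub>B\<^esub>}"
    using h(1) assms(2) by (simp add: group_hom.image_from_trivial_group)
  ultimately show ?thesis
    using eq h(2) by (simp add: trivial_group_def group_hom_def)
qed

text \<open>Long exact sequence of the pair. In degree 2 m the new class cannot be killed by the
  boundary map, because its target, the homology of A in degree 2 m - 1, vanishes by parity; nor
  does A contribute in degree 2 m itself. In degree 2 m - 1 both neighbours vanish, and in all
  remaining degrees the relative groups do, so X inherits the homology of A.\<close>

lemma even_homology_attach_cell: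
  assumes A: "even_homology m (subtopology X A)"
    and rel: "relative_homology_group (2 * int m) X A \<cong> integer_group"
    and triv: "\<And>p. p \<noteq> 2 * int m \<Longrightarrow> trivial_group (relative_homology_group p X A)"
  shows "even_homology (Suc m) X"
  unfolding even_homology_def
proof
  fix p :: int
  have A0: "trivial_group (homology_group q (subtopology X A))" if "\<not> (even q \<and> 0 \<le> q \<and> q < 2 * int m)" for q
    using A that unfolding even_homology_def by metis
  have A1: "homology_group q (subtopology X A) \<cong> integer_group" if "even q \<and> 0 \<le> q \<and> q < 2 * int m" for q
    using A that unfolding even_homology_def by metis
  consider "p = 2 * int m" | "p + 1 = 2 * int m" | "p \<noteq> 2 * int m" "p + 1 \<noteq> 2 * int m" by blast
  then show "if even p \<and> 0 \<le> p \<and> p < 2 * int (Suc m)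
     then homology_group p X \<cong> integer_group else trivial_group (homology_group p X)"
  proof cases
    case 1
    have "hom_induced p X {} X A id \<in> iso (homology_group p X) (relative_homology_group p X A)"
    proof (rule very_short_exact_sequence)
      show "exact_seq ([homology_group (p - 1) (subtopology X A), relative_homology_group p X A,
          homology_group p X, homology_group p (subtopology X A)],
          [hom_boundary p X A, hom_induced p X {} X A id, hom_induced p (subtopology X A) {} X {} id])"
        using homology_exactness_axiom_1[of p X A] homology_exactness_axiom_3[of p X A] by simp
    qed (use 1 in \<open>auto intro!: A0\<close>)
    then have "homology_group p X \<cong> relative_homology_group p X A" by (rule is_isoI)
    then have "homology_group p X \<cong> integer_group" using rel 1 iso_trans by blast
    then show ?thesis using 1 by simp
  next
    case 2
    have "trivial_group (homology_group p X)"
      by (rule exact_seq_trivial_middle[OF homology_exactness_axiom_3])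
         (use 2 in \<open>presburger | auto intro!: A0 triv\<close>)+
    moreover have "odd p" using 2 by presburger
    ultimately show ?thesis by simp
  next
    case 3
    have "hom_induced p (subtopology X A) {} X {} id \<in> iso (homology_group p (subtopology X A)) (homology_group p X)"
    proof (rule very_short_exact_sequence)
      show "exact_seq ([relative_homology_group p X A, homology_group p X,
          homology_group p (subtopology X A), relative_homology_group (p + 1) X A],
          [hom_induced p X {} X A id, hom_induced p (subtopology X A) {} X {} id, hom_boundary (p + 1) X A])"
        using homology_exactness_axiom_2[of "p + 1" X A] homology_exactness_axiom_3[of p X A] by simp
    qed (use 3 in \<open>auto intro!: triv\<close>)
    then have iso: "homology_group p (subtopology X A) \<cong> homology_group p X" by (rule is_isoI)
    have eq: "(even p \<and> 0 \<le> p \<and> p < 2 * int (Suc m)) = (even p \<and> 0 \<le> p \<and> p < 2 * int m)"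
      using 3 by presburger
    show ?thesis
    proof (cases "even p \<and> 0 \<le> p \<and> p < 2 * int m")
      case True
      then have "homology_group p X \<cong> integer_group"
        using A1 iso by (meson group.iso_sym group_relative_homology_group iso_trans)
      then show ?thesis using True eq by simp
    next
      case False
      then have "trivial_group (homology_group p X)"
        using A0 iso isomorphic_group_triviality1[OF iso] by simp
      then show ?thesis using False eq by presburger
    qed
  qed
qed

lemma even_homology_homotopy_equivalent:
  assumes "X homotopy_equivalent_space Y" "even_homology m Y"
  shows "even_homology m X"
  unfolding even_homology_def
proof
  fix p :: int
  have iso: "homology_group p X \<cong> homology_group p Y"
    using assms(1) by (rule homotopy_equivalent_space_imp_isomorphic_homology_groups)
  show "if even p \<and> 0 \<le> p \<and> p < 2 * int m
     then homology_group p X \<cong> integer_group else trivial_group (homology_group p X)"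
  proof (cases "even p \<and> 0 \<le> p \<and> p < 2 * int m")
    case True
    then have "homology_group p Y \<cong> integer_group" using assms(2) unfolding even_homology_def by metis
    then show ?thesis using True iso iso_trans by metis
  next
    case False
    then have "trivial_group (homology_group p Y)" using assms(2) unfolding even_homology_def by metis
    then show ?thesis using False iso isomorphic_group_triviality by (metis group_relative_homology_group)
  qed
qed

lemma subspace_coord_space: "subspace (coord_space K)"
  by (auto simp: subspace_def coord_space_def)

text \<open>The real basis of the vectors \<open>axis i 1\<close> and \<open>axis i \<i>\<close>. It
  serves to identify the unit sphere of \<open>coord_space K\<close> with the standard sphere of
  dimension \<open>2 * card K - 1\<close>.\<close>

lemma coord_space_orthonormal_basis:
  fixes K :: "'n :: finite set"
  obtains B :: "(complex ^ 'n) set"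
  where "independent B" "pairwise orthogonal B" "card B = 2 * card K" "\<And>u. u \<in> B \<Longrightarrow> norm u = 1"
    "span B = coord_space K"
proof
  define b :: "'n \<times> complex \<Rightarrow> complex ^ 'n" where "b = (\<lambda>(i, c). axis i c)"
  define B where "B = b ` (K \<times> {1, \<i>})"
  show orth: "pairwise orthogonal B"
    unfolding B_def b_def
    by (auto simp: pairwise_def orthogonal_def inner_axis_axis)
  show norm1: "norm u = 1" if "u \<in> B" for u
    using that by (auto simp: B_def b_def)
  show "independent B"
    using orth norm1 by (intro pairwise_orthogonal_independent) force+
  have "inj_on b (K \<times> {1, \<i>})"
    by (auto simp: inj_on_def b_def axis_eq_axis)
  then show "card B = 2 * card K"
    by (simp add: B_def card_image card_cartesian_product)
  show "span B = coord_space K"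
  proof
    show "span B \<subseteq> coord_space K"
      by (rule span_minimal[OF _ subspace_coord_space]) (auto simp: B_def b_def coord_space_def axis_def)
    show "coord_space K \<subseteq> span B"
    proof
      fix z :: "complex ^ 'n" assume z: "z \<in> coord_space K"
      have "z = (\<Sum>i\<in>K. Re (z $ i) *\<^sub>R axis i 1 + Im (z $ i) *\<^sub>R axis i \<i>)"
      proof (simp add: vec_eq_iff, intro allI)
        fix j
        have "(\<Sum>i\<in>K. Re (z $ i) *\<^sub>R axis i 1 $ j + Im (z $ i) *\<^sub>R axis i \<i> $ j) =
            (\<Sum>i\<in>K. if i = j then z $ j else 0)"
          by (rule sum.cong) (auto simp: axis_def complex_eq_iff)
        also have "\<dots> = z $ j" using z by (simp add: coord_space_def)
        finally show "z $ j = (\<Sum>i\<in>K. Re (z $ i) *\<^sub>R axis i 1 $ j + Im (z $ i) *\<^sub>R axis i \<i> $ j)" ..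
      qed
      also have "\<dots> \<in> span B"
        by (intro span_sum span_add span_scale span_base) (auto simp: B_def b_def)
      finally show "z \<in> span B" .
    qed
  qed
qed

lemma punctured_subspace_eqv_sphere:
  fixes W :: "'a :: euclidean_space set"
  assumes "subspace W"
  shows "(W - {0}) homotopy_eqv (sphere 0 1 \<inter> W)"
proof (rule deformation_retract_imp_homotopy_eqv)
  define r :: "'a \<Rightarrow> 'a" where "r x = (1 / norm x) *\<^sub>R x" for x
  have cont: "continuous_on (W - {0}) r"
    unfolding r_def by (intro continuous_intros) simp
  show "retraction (W - {0}) (sphere 0 1 \<inter> W) r"
    using assms cont by (auto simp: retraction_def subspace_scale) (auto simp: r_def subspace_scale)
  show "homotopic_with_canon (\<lambda>_. True) (W - {0}) (W - {0}) id r"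
  proof (rule homotopic_with_linear)
    show "closed_segment (id x) (r x) \<subseteq> W - {0}" if x: "x \<in> W - {0}" for x
    proof
      fix y assume "y \<in> closed_segment (id x) (r x)"
      then obtain t where t: "0 \<le> t" "t \<le> 1" "y = (1 - t) *\<^sub>R x + t *\<^sub>R r x"
        by (auto simp: in_segment)
      then have y: "y = ((1 - t) + t / norm x) *\<^sub>R x"
        by (simp add: r_def algebra_simps)
      have "(1 - t) + t / norm x > 0"
        using t x by (cases "t = 1") (auto intro: add_pos_nonneg)
      then show "y \<in> W - {0}" using y x assms by (auto simp: subspace_scale)
    qed
  qed (auto simp: cont)
qed

text \<open>On \<open>gram z\<close> the quotient of the two entries of column s is
  \<open>z $ i / z $ s\<close>: these are the affine coordinates on the part of projective space
  where coordinate s does not vanish.\<close>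

definition affine_chart :: "'n \<Rightarrow> complex ^ 'n ^ 'n \<Rightarrow> complex ^ 'n" where
  "affine_chart s M = (\<chi> i. if i = s then 0 else M $ i $ s / M $ s $ s)"

lemma affine_chart_gram:
  "z $ s \<noteq> 0 \<Longrightarrow> affine_chart s (gram z) = (\<chi> i. if i = s then 0 else z $ i / z $ s)"
  by (simp add: affine_chart_def vec_eq_iff)

lemma affine_chart_scaleR: "r \<noteq> 0 \<Longrightarrow> affine_chart s (r *\<^sub>R M) = affine_chart s M"
  by (simp add: affine_chart_def vec_eq_iff scaleR_conv_of_real[where 'a = complex])

lemma affine_chart_homeomorphic_map:
  assumes "s \<in> S"
  shows "homeomorphic_map (top_of_set {M \<in> proj_space S. M $ s $ s \<noteq> 0}) (top_of_set (coord_space (S - {s})))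
    (affine_chart s)"
proof -
  \<comment> \<open>The inverse chart puts 1 at place s and then normalizes the trace.\<close>
  define e :: "complex ^ 'a \<Rightarrow> complex ^ 'a" where "e z = (\<chi> i. if i = s then 1 else z $ i)" for z
  define g where "g z = (1 / trace_form (\<lambda>_. 1) (gram (e z))) *\<^sub>R gram (e z)" for z
  have pos: "0 < trace_form (\<lambda>_. 1) (gram (e z))" for z
    unfolding trace_form_gram by (intro sum_pos2[where i = s]) (auto simp: e_def)
  have e: "e z \<in> coord_space S" if "z \<in> coord_space (S - {s})" for z
    using that \<open>s \<in> S\<close> by (auto simp: e_def coord_space_def)
  have inv1: "g (affine_chart s M) = M" if M: "M \<in> proj_space S" "M $ s $ s \<noteq> 0" for M
  proof -
    obtain z where z: "M = gram z" "trace_form (\<lambda>_. 1) (gram z) = 1" using M(1) by (auto simp: gram_level_def)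
    have s: "z $ s \<noteq> 0" using M(2) z by auto
    have "gram (e (affine_chart s M)) = (1 / (cmod (z $ s))\<^sup>2) *\<^sub>R gram z"
    proof -
      have "e (affine_chart s M) $ i = z $ i / z $ s" for i
        using s by (simp add: e_def z affine_chart_gram)
      then show ?thesis
        using s complex_norm_square[of "z $ s"] by (simp add: vec_eq_iff scaleR_conv_of_real[where 'a = complex])
    qed
    then show ?thesis
      using z s by (simp add: g_def trace_form_scaleR)
  qed
  have inv2: "affine_chart s (g z) = z" if z: "z \<in> coord_space (S - {s})" for z
  proof -
    have "affine_chart s (g z) = affine_chart s (gram (e z))"
      unfolding g_def using pos[of z] by (intro affine_chart_scaleR) auto
    also have "\<dots> = z" using z by (auto simp: affine_chart_gram e_def vec_eq_iff coord_space_def)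
    finally show ?thesis .
  qed
  have "homeomorphic_maps (top_of_set {M \<in> proj_space S. M $ s $ s \<noteq> 0})
      (top_of_set (coord_space (S - {s}))) (affine_chart s) g"
    unfolding homeomorphic_maps_def
  proof (intro conjI)
    have "continuous_on {M \<in> proj_space S. M $ s $ s \<noteq> 0} (affine_chart s)"
      unfolding affine_chart_def
    proof (intro continuous_on_vec_lambda)
      fix i show "continuous_on {M \<in> proj_space S. M $ s $ s \<noteq> 0} (\<lambda>M. if i = s then 0 else M $ i $ s / M $ s $ s)"
        by (cases "i = s") (auto intro!: continuous_intros)
    qed
    moreover have "affine_chart s M \<in> coord_space (S - {s})" if M: "M \<in> proj_space S" for M
      using M by (auto simp: affine_chart_def coord_space_def gram_level_def)
    ultimately show "continuous_map (top_of_set {M \<in> proj_space S. M $ s $ s \<noteq> 0})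
        (top_of_set (coord_space (S - {s}))) (affine_chart s)"
      by (auto simp: continuous_map_subtopology_eu)
    have "continuous_on (coord_space (S - {s})) e"
      unfolding e_def
    proof (intro continuous_on_vec_lambda)
      fix i show "continuous_on (coord_space (S - {s})) (\<lambda>z. if i = s then 1 else z $ i)"
        by (cases "i = s") (auto intro!: continuous_intros)
    qed
    then have "continuous_on (coord_space (S - {s})) g"
      unfolding g_def
    proof (intro continuous_intros ballI)
      fix z show "trace_form (\<lambda>_. 1) (gram (e z)) \<noteq> 0" using pos[of z] by simp
    qed
    moreover have "g z \<in> proj_space S" if "z \<in> coord_space (S - {s})" for z
      unfolding g_def using gram_level_normalize[OF e[OF that], of 1] pos[of z] by simp
    moreover have "g z $ s $ s \<noteq> 0" for z
      using pos[of z] by (simp add: g_def e_def)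
    ultimately show "continuous_map (top_of_set (coord_space (S - {s})))
        (top_of_set {M \<in> proj_space S. M $ s $ s \<noteq> 0}) g"
      by (auto simp: continuous_map_subtopology_eu)
  qed (auto simp: inv1 inv2)
  then show ?thesis unfolding homeomorphic_map_maps by blast
qed

text \<open>The linear space is contractible, so its homology relative to the complement of the
  origin is the reduced homology of that complement one degree lower, and the complement is a sphere
  up to homotopy.\<close>

lemma relative_homology_punctured_subspace:
  fixes K :: "'n :: finite set"
  assumes K: "K \<noteq> {}"
  defines "W \<equiv> coord_space K"
  shows "relative_homology_group p (top_of_set W) (W - {0}) \<cong> reduced_homology_group (p - 1) (nsphere (2 * card K - 1))"
proof -
  obtain B :: "(complex ^ 'n) set" where B: "independent B" "pairwise orthogonal B" "card B = 2 * card K"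
      "\<And>u. u \<in> B \<Longrightarrow> norm u = 1" "span B = W"
    using coord_space_orthonormal_basis[of K] unfolding W_def by metis
  have n: "2 * card K \<noteq> 0" using K by simp
  obtain f :: "(nat \<Rightarrow> real) \<Rightarrow> complex ^ 'n" and g where
      "homeomorphic_maps (nsphere (2 * card K - 1)) (top_of_set (sphere 0 1 \<inter> span B)) f g"
    using homeomorphic_maps_nsphere_euclidean_sphere[OF B(1-3) n B(4)] by blast
  then have "nsphere (2 * card K - 1) homeomorphic_space top_of_set (sphere 0 1 \<inter> W)"
    using B(5) homeomorphic_space_def by blast
  moreover have "(W - {0}) homotopy_eqv (sphere 0 1 \<inter> W)"
    unfolding W_def by (intro punctured_subspace_eqv_sphere subspace_coord_space)
  ultimately have eqv: "top_of_set (W - {0}) homotopy_equivalent_space nsphere (2 * card K - 1)"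
    by (meson homeomorphic_imp_homotopy_equivalent_space homotopy_equivalent_space_sym homotopy_eqv_trans)
  have "W \<noteq> {0}" 
    using B(3,5) n by (metis card_0_eq card.empty independent_empty dim_eq_card dim_span dim_singleton B(1) dim_eq_0 subset_refl)
  moreover have "0 \<in> W" by (simp add: W_def subspace_0 subspace_coord_space)
  ultimately have ne: "topspace (top_of_set W) \<inter> (W - {0}) \<noteq> {}" by auto
  have "contractible_space (top_of_set W)"
    unfolding W_def using convex_imp_contractible[OF subspace_imp_convex[OF subspace_coord_space]] by simp
  then have "relative_homology_group p (top_of_set W) (W - {0}) \<cong>
      reduced_homology_group (p - 1) (subtopology (top_of_set W) (W - {0}))"
    by (rule isomorphic_group_relative_homology_of_contractible[OF _ ne])
  moreover have "subtopology (top_of_set W) (W - {0}) = top_of_set (W - {0})"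
    by (simp add: subtopology_subtopology) (metis Diff_subset inf.absorb2)
  ultimately show ?thesis
    using homotopy_equivalent_space_imp_isomorphic_reduced_homology_groups[OF eqv, of "p - 1"]
    by (auto intro: iso_trans)
qed

text \<open>Excising the hyperplane \<open>M $ s $ s = 0\<close> leaves the affine chart around the
  coordinate line of s. The chart sends this line to the origin, so the pair becomes a linear space
  and its complement of the origin.\<close>

lemma relative_homology_proj_space:
  assumes s: "s \<in> S" "S \<noteq> {s}"
  shows "relative_homology_group p (top_of_set (proj_space S)) {M \<in> proj_space S. M $ s $ s \<noteq> 1} \<cong>
    reduced_homology_group (p - 1) (nsphere (2 * card (S - {s}) - 1))"
proof -
  let ?X = "top_of_set (proj_space S)"
  let ?U = "{M \<in> proj_space S. M $ s $ s \<noteq> 0}"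
  let ?W = "coord_space (S - {s})"
  define A where "A = {M \<in> proj_space S. M $ s $ s \<noteq> 1}"
  define Z where "Z = {M \<in> proj_space S. M $ s $ s = 0}"
  have cont: "continuous_on (proj_space S) (\<lambda>M. M $ s $ s)" by (intro continuous_intros)
  have "closedin ?X Z"
    using continuous_closedin_preimage_constant[OF cont, of 0] by (simp add: Z_def)
  moreover have "openin ?X A"
  proof -
    have "openin ?X (proj_space S \<inter> (\<lambda>M. M $ s $ s) -` (- {1}))"
      by (rule continuous_openin_preimage_gen[OF cont]) auto
    moreover have "proj_space S \<inter> (\<lambda>M. M $ s $ s) -` (- {1}) = A" by (auto simp: A_def)
    ultimately show ?thesis by simp
  qed
  moreover have "Z \<subseteq> A" by (auto simp: A_def Z_def)
  ultimately have "?X closure_of Z \<subseteq> ?X interior_of A"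
    by (simp add: closure_of_closedin interior_of_openin)
  moreover have "A \<subseteq> proj_space S" by (auto simp: A_def)
  ultimately have "relative_homology_group p (subtopology ?X (proj_space S - Z)) (A - Z) \<cong>
      relative_homology_group p (subtopology ?X (proj_space S)) A"
    using is_isoI[OF homology_excision_axiom] by blast
  moreover have "subtopology ?X (proj_space S) = ?X" by (simp add: subtopology_subtopology)
  moreover have "subtopology ?X (proj_space S - Z) = top_of_set ?U"
    by (simp add: subtopology_subtopology) (rule arg_cong[where f = "top_of_set"], auto simp: Z_def)
  ultimately have "relative_homology_group p (top_of_set ?U) (A - Z) \<cong> relative_homology_group p ?X A"
    by simp
  then have 1: "relative_homology_group p ?X A \<cong> relative_homology_group p (top_of_set ?U) (A - Z)"
    by (rule group.iso_sym[rotated]) simp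
  have "affine_chart s ` (A - Z) = ?W - {0}"
  proof -
    have img: "affine_chart s ` ?U = ?W"
      using homeomorphic_imp_surjective_map[OF affine_chart_homeomorphic_map[OF s(1)]] by simp
    have zero: "affine_chart s M = 0 \<longleftrightarrow> M $ s $ s = 1" if M: "M \<in> ?U" for M
    proof -
      obtain z where z: "M = gram z" "trace_form (\<lambda>_. 1) (gram z) = 1" using M by (auto simp: gram_level_def)
      have zs: "z $ s \<noteq> 0" using M z by auto
      have eq: "(\<Sum>i\<in>UNIV-{s}. (cmod (z $ i))\<^sup>2) + (cmod (z $ s))\<^sup>2 = 1"
        using z(2) by (simp add: trace_form_gram sum.remove[of UNIV s])
      have "affine_chart s M = 0 \<longleftrightarrow> (\<forall>i\<in>UNIV-{s}. (cmod (z $ i))\<^sup>2 = 0)"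
        using zs by (auto simp: z affine_chart_gram vec_eq_iff)
      also have "\<dots> \<longleftrightarrow> (\<Sum>i\<in>UNIV-{s}. (cmod (z $ i))\<^sup>2) = 0"
        by (subst sum_nonneg_eq_0_iff) auto
      also have "\<dots> \<longleftrightarrow> (cmod (z $ s))\<^sup>2 = 1" using eq by linarith
      also have "\<dots> \<longleftrightarrow> M $ s $ s = 1"
        unfolding z(1) gram_diagonal_of_real by (metis of_real_1 of_real_eq_iff)
      finally show ?thesis .
    qed
    have "A - Z = {M \<in> ?U. affine_chart s M \<noteq> 0}" using zero by (auto simp: A_def Z_def)
    then show ?thesis using img by auto
  qed
  then have "relative_homology_group p (top_of_set ?U) (A - Z) \<cong>
      relative_homology_group p (top_of_set ?W) (?W - {0})"
    by (intro is_isoI[OF homeomorphic_map_relative_homology_iso[OF affine_chart_homeomorphic_map[OF s(1)]]])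
       (auto simp: A_def Z_def)
  moreover have "S - {s} \<noteq> {}" using s by auto
  ultimately show ?thesis
    using 1 relative_homology_punctured_subspace[of "S - {s}" p] unfolding A_def by (blast intro: iso_trans)
qed

theorem even_homology_proj_space:
  fixes S :: "'n :: finite set"
  assumes "S \<noteq> {}"
  shows "even_homology (card S) (top_of_set (proj_space S))"
  using finite[of S] assms
proof (induction rule: finite_ne_induct)
  case (singleton s)
  have "proj_space {s} = {gram (axis s 1)}"
  proof -
    have "gram z = gram (axis s 1)" if "z \<in> coord_space {s}" "trace_form (\<lambda>_. 1) (gram z) = 1" for z
    proof -
      have z0: "z $ i = 0" if "i \<noteq> s" for i using \<open>z \<in> coord_space {s}\<close> that by (auto simp: coord_space_def)
      then have "trace_form (\<lambda>_. 1) (gram z) = (cmod (z $ s))\<^sup>2"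
        by (simp add: trace_form_gram sum.remove[of UNIV s])
      then have "z $ s * cnj (z $ s) = 1" using that(2) complex_norm_square[of "z $ s"] by simp
      then have "gram z $ i $ j = gram (axis s 1) $ i $ j" for i j
        using z0 by (cases "i = s"; cases "j = s") (auto simp: axis_def)
      then show ?thesis unfolding vec_eq_iff by blast
    qed
    moreover have "axis s 1 \<in> coord_space {s}" "trace_form (\<lambda>_. 1) (gram (axis s 1 :: complex ^ 'n)) = 1"
    proof -
      have "trace_form (\<lambda>_. 1) (gram (axis s 1 :: complex ^ 'n)) = (\<Sum>i\<in>UNIV. if i = s then 1 else 0)"
        unfolding trace_form_gram by (rule sum.cong) (auto simp: axis_def)
      then show "trace_form (\<lambda>_. 1) (gram (axis s 1 :: complex ^ 'n)) = 1" by simp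
    qed (simp add: coord_space_def axis_def)
    ultimately show ?thesis unfolding gram_level_def by (intro equalityI subsetI) blast+
  qed
  then have top: "topspace (top_of_set (proj_space {s})) = {gram (axis s 1)}" by simp
  show ?case
    unfolding even_homology_def
  proof
    fix p :: int
    show "if even p \<and> 0 \<le> p \<and> p < 2 * int (card {s})
      then homology_group p (top_of_set (proj_space {s})) \<cong> integer_group
      else trivial_group (homology_group p (top_of_set (proj_space {s})))"
    proof (cases "p = 0")
      case True
      then show ?thesis using homology_coefficients[OF top] by simp
    next
      case False
      then have "\<not> (even p \<and> 0 \<le> p \<and> p < 2 * int (card {s}))" by simp presburger
      then show ?thesis using homology_dimension_axiom[OF top False] by presburger
    qed
  qed
next
  case (insert s S)
  let ?S = "insert s S"
  define A where "A = {M \<in> proj_space ?S. M $ s $ s \<noteq> 1}"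
  have S: "?S - {s} = S" "?S \<noteq> {s}" using insert by auto
  have m: "card S > 0" using insert by (simp add: card_gt_0_iff)
  have rel: "relative_homology_group p (top_of_set (proj_space ?S)) A \<cong>
      reduced_homology_group (p - 1) (nsphere (2 * card S - 1))" for p
    using relative_homology_proj_space[of s ?S p] S unfolding A_def by simp
  have "even_homology (Suc (card S)) (top_of_set (proj_space ?S))"
  proof (rule even_homology_attach_cell[where A = A])
    have "A homotopy_eqv proj_space S"
      using proj_space_puncture[of s ?S] S unfolding A_def by simp
    moreover have "subtopology (top_of_set (proj_space ?S)) A = top_of_set A"
      by (simp add: subtopology_subtopology) (rule arg_cong[where f = "top_of_set"], auto simp: A_def)
    ultimately show "even_homology (card S) (subtopology (top_of_set (proj_space ?S)) A)"
      using even_homology_homotopy_equivalent insert.IH by metis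
    have "2 * int (card S) - 1 = int (2 * card S - 1)" using m by simp
    then have "reduced_homology_group (2 * int (card S) - 1) (nsphere (2 * card S - 1)) \<cong> integer_group"
      by (metis reduced_homology_group_nsphere(1))
    then show "relative_homology_group (2 * int (card S)) (top_of_set (proj_space ?S)) A \<cong> integer_group"
      using rel iso_trans by blast
    show "trivial_group (relative_homology_group p (top_of_set (proj_space ?S)) A)"
      if "p \<noteq> 2 * int (card S)" for p
    proof -
      have "p - 1 \<noteq> int (2 * card S - 1)" using that m by simp
      then have "trivial_group (reduced_homology_group (p - 1) (nsphere (2 * card S - 1)))"
        by (simp add: trivial_reduced_homology_group_nsphere)
      then show ?thesis
        using isomorphic_group_triviality[OF rel[of p]] by simp
    qed
  qed
  then show ?case using insert by simp
qed

section \<open>Ranks of the homology groups\<close>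

lemma group_rank_trivial:
  assumes "trivial_group G"
  shows "group_rank G = 0"
proof -
  have G: "group G" "carrier G = {\<one>\<^bsub>G\<^esub>}" using assms by (auto simp: trivial_group_def)
  have "B = {}" if "int_independent G B" for B
  proof -
    have B: "B \<subseteq> {\<one>\<^bsub>G\<^esub>}" using that G(2) by (auto simp: int_independent_def)
    have "comm_group G"
      by (rule group.group_comm_groupI[OF G(1)]) (use G in auto)
    then interpret comm_group G .
    have "\<one>\<^bsub>G\<^esub> [^]\<^bsub>G\<^esub> (1::int) = \<one>\<^bsub>G\<^esub>" by simp
    then have "finprod G (\<lambda>x. x [^]\<^bsub>G\<^esub> (1::int)) B = \<one>\<^bsub>G\<^esub>"
      using B by (intro finprod_one_eqI) auto
    moreover have "\<And>c :: _ \<Rightarrow> int. finprod G (\<lambda>x. x [^]\<^bsub>G\<^esub> c x) B = \<one>\<^bsub>G\<^esub> \<Longrightarrow> \<forall>x\<in>B. c x = 0"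
      using that unfolding int_independent_def by blast
    \<comment> \<open>Taking every exponent to be 1 is a nontrivial relation as soon as B has an
      element; even the singleton of the unit is dependent.\<close>
    ultimately have "\<forall>x\<in>B. (1::int) = 0" by fast
    then show ?thesis by auto
  qed
  then have "{B. int_independent G B} \<subseteq> {{}}" by auto
  then have "(SUP B \<in> {B. int_independent G B}. enat (card B)) \<le> (SUP B \<in> {{}}. enat (card (B :: 'a set)))"
    by (rule SUP_subset_mono) simp
  then show ?thesis by (simp add: group_rank_def enat_0)
qed

lemma group_rank_integer:
  assumes "comm_group G" and "G \<cong> integer_group"
  shows "group_rank G = 1"
proof -
  interpret comm_group G by fact
  obtain \<phi> where \<phi>: "\<phi> \<in> iso G integer_group" using assms(2) by (auto simp: is_iso_def)
  then have bij: "bij_betw \<phi> (carrier G) UNIV" by (auto simp: iso_def)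
  interpret group_hom G integer_group \<phi>
    using \<phi> is_group by (simp add: group_hom_def group_hom_axioms_def iso_def)
  have mult: "\<phi> (x \<otimes>\<^bsub>G\<^esub> y) = \<phi> x + \<phi> y" if "x \<in> carrier G" "y \<in> carrier G" for x y
    using hom_mult[OF that] by simp
  have one: "\<phi> \<one>\<^bsub>G\<^esub> = 0" using hom_one by simp
  have pow: "\<phi> (x [^]\<^bsub>G\<^esub> (k::int)) = k * \<phi> x" if "x \<in> carrier G" for x k
    using hom_int_pow[OF that, of k] by simp
  have inj: "x = y" if "\<phi> x = \<phi> y" "x \<in> carrier G" "y \<in> carrier G" for x y
    using bij that by (auto simp: bij_betw_def inj_on_def)
  have upper: "card B \<le> 1" if B: "int_independent G B" for B
  proof (rule ccontr)
    assume "\<not> card B \<le> 1"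
    then obtain x y where xy: "x \<in> B" "y \<in> B" "x \<noteq> y"
      using B by (auto simp: int_independent_def card_le_Suc0_iff_eq)
    have car: "x \<in> carrier G" "y \<in> carrier G" "finite B" "B \<subseteq> carrier G"
      using xy B by (auto simp: int_independent_def)
    \<comment> \<open>Crossed exponents: the images \<open>\<phi> y * \<phi> x\<close> and
      \<open>- \<phi> x * \<phi> y\<close> cancel. Independence would make both
      \<open>\<phi> x\<close> and \<open>\<phi> y\<close> zero, hence equal.\<close>
    define c where "c z = (if z = x then \<phi> y else if z = y then - \<phi> x else 0)" for z
    have "finprod G (\<lambda>z. z [^]\<^bsub>G\<^esub> c z) B = finprod G (\<lambda>z. z [^]\<^bsub>G\<^esub> c z) {x, y}"
      using car xy by (intro finprod_mono_neutral_cong_right) (auto simp: c_def)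
    also have "\<dots> = x [^]\<^bsub>G\<^esub> \<phi> y \<otimes>\<^bsub>G\<^esub> y [^]\<^bsub>G\<^esub> (- \<phi> x)"
      using car xy by (auto simp: c_def)
    also have "\<dots> = \<one>\<^bsub>G\<^esub>"
    proof (rule inj)
      have "x [^]\<^bsub>G\<^esub> \<phi> y \<in> carrier G" "y [^]\<^bsub>G\<^esub> (- \<phi> x) \<in> carrier G"
        using car by (auto intro: int_pow_closed)
      then show "\<phi> (x [^]\<^bsub>G\<^esub> \<phi> y \<otimes>\<^bsub>G\<^esub> y [^]\<^bsub>G\<^esub> (- \<phi> x)) = \<phi> \<one>\<^bsub>G\<^esub>"
        by (simp only: mult pow[OF car(1)] pow[OF car(2)] one) simp
    qed (use car in \<open>auto intro: int_pow_closed\<close>)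
    finally have "\<forall>z\<in>B. c z = 0" using B unfolding int_independent_def by blast
    then have "c x = 0" "c y = 0" using xy by blast+
    then have "\<phi> x = \<phi> y" using xy(3) by (simp add: c_def)
    then show False using inj car xy(3) by blast
  qed
  obtain x where x: "x \<in> carrier G" "\<phi> x = 1"
    using bij by (metis UNIV_I bij_betw_imp_surj_on imageE)
  have "int_independent G {x}"
    unfolding int_independent_def
  proof (intro conjI allI impI)
    fix c :: "_ \<Rightarrow> int" assume "finprod G (\<lambda>x. x [^]\<^bsub>G\<^esub> c x) {x} = \<one>\<^bsub>G\<^esub>"
    then have "x [^]\<^bsub>G\<^esub> c x = \<one>\<^bsub>G\<^esub>" using x by simp
    then have "c x * \<phi> x = 0" using pow[OF x(1), of "c x"] one by simp
    then show "\<forall>y\<in>{x}. c y = 0" using x by simp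
  qed (use x in auto)
  then have "enat (card {x}) \<le> group_rank G"
    unfolding group_rank_def by (intro SUP_upper) simp
  moreover have "group_rank G \<le> 1"
    unfolding group_rank_def by (intro SUP_least) (use upper in \<open>auto simp: one_enat_def\<close>)
  ultimately show ?thesis by (intro antisym) (simp_all add: one_enat_def)
qed

lemma group_rank_even_homology:
  assumes "even_homology m X"
  shows "group_rank (homology_group (int k) X) = (if even k \<and> k < 2 * m then 1 else 0)"
proof (cases "even k \<and> k < 2 * m")
  case True
  then have "homology_group (int k) X \<cong> integer_group"
    using assms unfolding even_homology_def by (elim allE[of _ "int k"]) auto
  then show ?thesis using True group_rank_integer[OF abelian_homology_group] by simp
next
  case False
  then have "\<not> (even (int k) \<and> 0 \<le> int k \<and> int k < 2 * int m)" by auto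
  then have "trivial_group (homology_group (int k) X)"
    using assms unfolding even_homology_def by metis
  then have "group_rank (homology_group (int k) X) = 0" by (rule group_rank_trivial)
  then show ?thesis using False by presburger
qed

section \<open>Tuples, orbits and the discrete Fourier transform\<close>

abbreviation num :: "'n :: finite \<Rightarrow> nat" where
  "num \<equiv> to_nat_on UNIV"

definition tuple :: "(nat \<Rightarrow> complex) \<Rightarrow> complex ^ 'n :: finite" where
  "tuple f = (\<chi> i. f (num i))"

lemma num_less [simp]: "num (i :: 'n :: finite) < CARD('n)"
  using to_nat_on_finite[OF finite[of "UNIV :: 'n set"]] by (auto simp: bij_betw_def)

lemma bij_betw_num: "bij_betw (num :: 'n :: finite \<Rightarrow> nat) UNIV {..<CARD('n)}"
  by (rule to_nat_on_finite) simp

lemma num_eq_iff [simp]: "num i = num j \<longleftrightarrow> i = j"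
  using bij_betw_num by (auto simp: bij_betw_def inj_on_def)

lemma vertex_num [simp]: "vertex p (num i) = p $ i"
  by (simp add: vertex_def countable_finite)

lemma num_from_nat_into: "k < CARD('n) \<Longrightarrow> num (from_nat_into (UNIV :: 'n :: finite set) k) = k"
  using bij_betw_num[where 'n = 'n]
  by (intro to_nat_on_from_nat_into) (auto simp: bij_betw_def)

lemma ex_num: "k < CARD('n) \<Longrightarrow> \<exists>i :: 'n :: finite. k = num i"
  using num_from_nat_into by metis

lemma vertex_tuple: "vertex (tuple f :: complex ^ 'n :: finite) k = f (k mod CARD('n))"
  by (simp add: vertex_def tuple_def num_from_nat_into)

lemma vertex_tuple_periodic:
  assumes "\<And>k. f (k + CARD('n)) = f k"
  shows "vertex (tuple f :: complex ^ 'n :: finite) k = f k"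
proof -
  have "f (r + m * CARD('n)) = f r" for r m
  proof (induction m)
    case (Suc m)
    then show ?case using assms[of "r + m * CARD('n)"] by (simp add: add_ac)
  qed simp
  from this[of "k mod CARD('n)" "k div CARD('n)"] show ?thesis
    by (simp add: vertex_tuple)
qed

lemma vertex_mod [simp]: "vertex (p :: complex ^ 'n :: finite) (k mod CARD('n)) = vertex p k"
  by (simp add: vertex_def)

lemma vertex_add_card [simp]:
  "vertex (p :: complex ^ 'n :: finite) (k + CARD('n)) = vertex p k"
  "vertex (p :: complex ^ 'n :: finite) (CARD('n) + k) = vertex p k"
  by (simp_all add: vertex_def)

lemma tuple_eqI:
  fixes p q :: "complex ^ 'n :: finite"
  assumes "\<And>k. k < CARD('n) \<Longrightarrow> vertex p k = vertex q k"
  shows "p = q"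
  using assms[OF num_less] by (simp add: vec_eq_iff)

lemma vertex_linear [simp]:
  "vertex (p + q) k = vertex p k + vertex q k" "vertex (p - q) k = vertex p k - vertex q k"
  "vertex (r *\<^sub>R p) k = r *\<^sub>R vertex p k" "vertex 0 k = 0" "vertex (- p) k = - vertex p k"
  by (simp_all add: vertex_def)

lemma vertex_move [simp]: "vertex (move u b p) k = u * vertex p k + b"
  by (simp add: vertex_def move_def)

lemma vertex_shift [simp]: "vertex (shift (p :: complex ^ 'n :: finite)) k = vertex p (k + 1)"
proof -
  have "vertex (shift p) k = vertex p (k mod CARD('n) + 1)"
    using vertex_tuple[of "\<lambda>k. vertex p (k + 1)" k, where 'n = 'n] by (simp add: shift_def tuple_def)
  also have "\<dots> = vertex p (k + 1)" by (metis mod_add_left_eq vertex_mod)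
  finally show ?thesis .
qed

lemma sum_vertex:
  fixes p :: "complex ^ 'n :: finite"
  shows "(\<Sum>i\<in>UNIV. f (num i) (p $ i)) = (\<Sum>k<CARD('n). f k (vertex p k))"
  using sum.reindex_bij_betw[OF bij_betw_num[where 'n = 'n], of "\<lambda>k. f k (vertex p k)"] by simp

lemma cyclic_sum_shift:
  fixes f :: "nat \<Rightarrow> 'a :: ab_group_add"
  assumes "f n = f 0"
  shows "(\<Sum>k<n. f (k + 1)) = (\<Sum>k<n. f k)"
  using sum.lessThan_Suc_shift[of f n] sum.lessThan_Suc[of f n] assms by (auto simp: algebra_simps)

section \<open>Roots of unity and the discrete Fourier transform\<close>

definition unity :: "nat \<Rightarrow> int \<Rightarrow> complex" where
  "unity n k = cis (2 * pi * of_int k / of_nat n)"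

lemma unity_0 [simp]: "unity n 0 = 1"
  by (simp add: unity_def)

lemma unity_add: "unity n (j + k) = unity n j * unity n k"
  by (simp add: unity_def cis_mult ring_distribs add_divide_distrib)

lemma unity_uminus: "unity n (- k) = cnj (unity n k)"
  by (simp add: unity_def cis_cnj)

lemma norm_unity [simp]: "norm (unity n k) = 1"
  by (simp add: unity_def)

lemma unity_mult_cnj [simp]: "unity n k * cnj (unity n k) = 1" "cnj (unity n k) * unity n k = 1"
  by (metis unity_0 unity_add unity_uminus add.right_inverse, metis unity_0 unity_add unity_uminus add.left_inverse)

lemma unity_power: "unity n k ^ j = unity n (k * int j)"
  by (induction j) (simp_all add: unity_add[symmetric] algebra_simps)

lemma unity_card [simp]: "n > 0 \<Longrightarrow> unity n (int n * k) = 1"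
  using cis_multiple_2pi[of "of_int k"] by (simp add: unity_def mult_ac)

lemma unity_card_right [simp]: "n > 0 \<Longrightarrow> unity n (k * int n) = 1"
  using unity_card[of n k] by (simp add: mult.commute)

lemma unity_eq_1_iff:
  assumes "n > 0"
  shows "unity n k = 1 \<longleftrightarrow> int n dvd k"
proof
  assume "unity n k = 1"
  then have "cos (2 * pi * of_int k / of_nat n) = 1" by (simp add: unity_def complex_eq_iff)
  then obtain m :: int where "2 * pi * of_int k / of_nat n = of_int m * 2 * pi"
    by (auto simp: cos_one_2pi_int)
  then have "of_int k = (of_int (m * int n) :: real)" using assms by (simp add: field_simps)
  then show "int n dvd k" using of_int_eq_iff by (metis dvd_triv_right)
next
  assume "int n dvd k"
  then show "unity n k = 1" using assms by (auto simp: dvd_def)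
qed

lemma sum_unity:
  assumes "n > 0"
  shows "(\<Sum>k<n. unity n (j * int k)) = (if int n dvd j then of_nat n else 0)"
proof (cases "int n dvd j")
  case True
  then have "unity n (j * int k) = 1" for k using unity_eq_1_iff[OF assms] by simp
  then show ?thesis using True by simp
next
  case False
  then have "unity n j \<noteq> 1" using unity_eq_1_iff[OF assms] by simp
  moreover have "unity n j ^ n = 1" using assms unity_card[OF assms, of j] by (simp add: unity_power mult.commute)
  ultimately have "(\<Sum>k<n. unity n j ^ k) = 0" by (simp add: geometric_sum)
  then show ?thesis using False by (simp add: unity_power)
qed

lemma dvd_diff_less_iff:
  assumes "j < n" "l < n"
  shows "int n dvd int j - int l \<longleftrightarrow> j = l"
proof
  assume "int n dvd int j - int l"
  then have "int j mod int n = int l mod int n" by (simp add: mod_eq_dvd_iff)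
  then show "j = l" using assms by simp
qed simp

definition dft :: "complex ^ 'n \<Rightarrow> complex ^ 'n :: finite" where
  "dft p = tuple (\<lambda>j. \<Sum>k<CARD('n). unity CARD('n) (- (int j * int k)) * vertex p k)"

definition idft :: "complex ^ 'n \<Rightarrow> complex ^ 'n :: finite" where
  "idft z = tuple (\<lambda>k. (\<Sum>j<CARD('n). unity CARD('n) (int j * int k) * vertex z j) / of_nat CARD('n))"

lemma vertex_dft: "j < CARD('n) \<Longrightarrow>
    vertex (dft (p :: complex ^ 'n :: finite)) j = (\<Sum>k<CARD('n). unity CARD('n) (- (int j * int k)) * vertex p k)"
  by (simp add: dft_def vertex_tuple)

lemma vertex_idft:
    "vertex (idft (z :: complex ^ 'n :: finite)) k =
      (\<Sum>j<CARD('n). unity CARD('n) (int j * int k) * vertex z j) / of_nat CARD('n)"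
  unfolding idft_def
  by (subst vertex_tuple_periodic)
     (simp_all add: distrib_left unity_add)

lemma idft_dft [simp]: "idft (dft (p :: complex ^ 'n :: finite)) = p"
proof (rule tuple_eqI)
  fix l assume l: "l < CARD('n)"
  let ?n = "CARD('n)"
  have "(\<Sum>j<?n. unity ?n (int j * int l) * vertex (dft p) j) =
      (\<Sum>j<?n. \<Sum>k<?n. unity ?n ((int l - int k) * int j) * vertex p k)"
  proof (intro sum.cong refl)
    fix j assume j: "j \<in> {..<?n}"
    have e: "(int l - int k) * int j = int j * int l + - (int j * int k)" for k by (simp add: algebra_simps)
    show "unity ?n (int j * int l) * vertex (dft p) j = (\<Sum>k<?n. unity ?n ((int l - int k) * int j) * vertex p k)"
      using j by (simp only: e unity_add vertex_dft lessThan_iff sum_distrib_left mult.assoc)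
  qed
  also have "\<dots> = (\<Sum>k<?n. (\<Sum>j<?n. unity ?n ((int l - int k) * int j)) * vertex p k)"
    by (subst sum.swap) (simp add: sum_distrib_right)
  also have "\<dots> = (\<Sum>k<?n. if k = l then of_nat ?n * vertex p l else 0)"
    by (intro sum.cong) (use l in \<open>auto simp: sum_unity dvd_diff_less_iff\<close>)
  also have "\<dots> = of_nat ?n * vertex p l" using l by simp
  finally show "vertex (idft (dft p)) l = vertex p l" by (simp add: vertex_idft)
qed

lemma dft_idft [simp]: "dft (idft (z :: complex ^ 'n :: finite)) = z"
proof (rule tuple_eqI)
  fix l assume l: "l < CARD('n)"
  let ?n = "CARD('n)"
  have "vertex (dft (idft z)) l =
      (\<Sum>k<?n. \<Sum>j<?n. unity ?n ((int j - int l) * int k) * vertex z j) / of_nat ?n"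
    unfolding vertex_dft[OF l] vertex_idft sum_divide_distrib sum_distrib_left
  proof (intro sum.cong refl)
    fix k j
    have e: "(int j - int l) * int k = - (int l * int k) + int j * int k" by (simp add: algebra_simps)
    show "unity ?n (- (int l * int k)) * (unity ?n (int j * int k) * vertex z j / of_nat ?n) =
        unity ?n ((int j - int l) * int k) * vertex z j / of_nat ?n"
      by (simp only: e unity_add mult.assoc times_divide_eq_right)
  qed
  also have "(\<Sum>k<?n. \<Sum>j<?n. unity ?n ((int j - int l) * int k) * vertex z j) =
      (\<Sum>j<?n. (\<Sum>k<?n. unity ?n ((int j - int l) * int k)) * vertex z j)"
    by (subst sum.swap) (simp add: sum_distrib_right)
  also have "\<dots> = (\<Sum>j<?n. if j = l then of_nat ?n * vertex z l else 0)"
    by (intro sum.cong) (use l in \<open>auto simp: sum_unity dvd_diff_less_iff\<close>)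
  also have "\<dots> = of_nat ?n * vertex z l" using l by simp
  finally show "vertex (dft (idft z)) l = vertex z l" by simp
qed

lemma area_eq_Im: "area (p :: complex ^ 'n :: finite) = (\<Sum>k<CARD('n). Im (cnj (vertex p k) * vertex p (k + 1))) / 2"
  by (simp add: area_def algebra_simps)

text \<open>The area is half the imaginary part of the Hermitian product of p with its cyclic shift.
  The shift multiplies mode j by \<open>unity n j\<close>, and Parseval's identity contributes the
  factor 1 / n.\<close>

lemma area_dft:
  "area (p :: complex ^ 'n :: finite) =
    (\<Sum>j<CARD('n). sin (2 * pi * real j / real CARD('n)) / (2 * real CARD('n)) * (cmod (vertex (dft p) j))\<^sup>2)"
proof -
  let ?n = "CARD('n)"
  let ?z = "dft p"
  have step: "vertex p (k + 1) = (\<Sum>j<?n. unity ?n (int j) * (unity ?n (int j * int k) * vertex ?z j)) / of_nat ?n" for k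
    using vertex_idft[of ?z "k + 1"]
    by (simp add: distrib_left unity_add mult_ac)
  have "(\<Sum>k<?n. cnj (vertex p k) * vertex p (k + 1)) =
     (\<Sum>k<?n. \<Sum>j<?n. unity ?n (int j) * vertex ?z j * cnj (unity ?n (- (int j * int k)) * vertex p k)) / of_nat ?n"
    unfolding step unity_uminus sum_divide_distrib sum_distrib_left by (intro sum.cong) (auto simp: mult_ac)
  also have "\<dots> = (\<Sum>j<?n. unity ?n (int j) * vertex ?z j * cnj (vertex ?z j)) / of_nat ?n"
    by (subst sum.swap) (simp add: vertex_dft sum_distrib_left)
  also have "\<dots> = (\<Sum>j<?n. unity ?n (int j) * of_real ((cmod (vertex ?z j))\<^sup>2 / real ?n))"
    unfolding sum_divide_distrib
    by (intro sum.cong) (auto simp: mult.assoc complex_norm_square[symmetric])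
  finally have "Im (\<Sum>k<?n. cnj (vertex p k) * vertex p (k + 1)) =
      (\<Sum>j<?n. sin (2 * pi * real j / real ?n) * ((cmod (vertex ?z j))\<^sup>2 / real ?n))"
    by (simp add: unity_def)
  then show ?thesis
    unfolding area_eq_Im by (simp add: sum_divide_distrib field_simps)
qed

section \<open>Orbits and their representatives\<close>

lemma move_move: "move u b (move v c p) = move (u * v) (u * c + b) p"
  by (simp add: move_def vec_eq_iff algebra_simps)

lemma move_id [simp]: "move 1 0 p = p"
  by (simp add: move_def vec_eq_iff)

lemma orbit_refl [simp]: "p \<in> orbit p"
  using move_id[of p] unfolding orbit_def by (metis (mono_tags, lifting) mem_Collect_eq norm_one)

lemma orbit_move [simp]:
  assumes "norm u = 1"
  shows "orbit (move u b p) = orbit p"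
proof -
  have sub: "orbit (move v c q) \<subseteq> orbit q" if "norm v = 1" for v c and q :: "complex ^ 'a"
    using that by (auto simp: orbit_def move_move) (metis mult_1 norm_mult)
  have "u \<noteq> 0" using assms by auto
  then have "move (inverse u) (- inverse u * b) (move u b p) = p"
    by (simp add: move_move algebra_simps)
  then have "orbit p \<subseteq> orbit (move u b p)"
    using sub[of "inverse u" "- inverse u * b" "move u b p"] assms by (simp add: norm_inverse)
  then show ?thesis using sub[OF assms] by blast
qed

lemma orbit_eq_iff: "orbit p = orbit q \<longleftrightarrow> (\<exists>u b. norm u = 1 \<and> p = move u b q)"
proof
  assume "orbit p = orbit q"
  then have "p \<in> orbit q" using orbit_refl[of p] by simp
  then show "\<exists>u b. norm u = 1 \<and> p = move u b q" by (auto simp: orbit_def)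
qed auto

lemma orbit_rep: "P \<in> polygons \<Longrightarrow> orbit (rep P) = P"
proof -
  assume "P \<in> polygons"
  then obtain p where p: "P = orbit p" by (auto simp: polygons_def)
  then have "rep P \<in> orbit p" unfolding rep_def by (metis orbit_refl someI)
  then obtain u b where "norm u = 1" "rep P = move u b p" by (auto simp: orbit_def)
  then show ?thesis using p by simp
qed

lemma nonconst_move: "u \<noteq> 0 \<Longrightarrow> move u b p \<in> nonconst_tuples \<longleftrightarrow> p \<in> nonconst_tuples"
  by (simp add: nonconst_tuples_def move_def)

lemma rep_nonconst: "P \<in> polygons \<Longrightarrow> rep P \<in> nonconst_tuples"
proof -
  assume P: "P \<in> polygons"
  then obtain p where p: "P = orbit p" "p \<in> nonconst_tuples" by (auto simp: polygons_def)
  then obtain u b where u: "norm u = 1" "rep P = move u b p" using orbit_rep[OF P] by (auto simp: orbit_eq_iff)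
  then have "u \<noteq> 0" by auto
  then show ?thesis using u p nonconst_move by metis
qed

lemma rep_orbit:
  assumes "p \<in> nonconst_tuples"
  obtains u b where "norm u = 1" "rep (orbit p) = move u b p"
  using orbit_rep[of "orbit p"] assms by (auto simp: polygons_def orbit_eq_iff)

lemma continuous_on_vertex [continuous_intros]:
  "continuous_on A f \<Longrightarrow> continuous_on A (\<lambda>x. vertex (f x) k)"
  unfolding vertex_def by (intro continuous_intros)

section \<open>The homology of the space of polygons of given area\<close>

definition nonzero_modes :: "'n :: finite set" where
  "nonzero_modes = {i. num i \<noteq> 0}"

definition centered_dft :: "complex ^ 'n \<Rightarrow> complex ^ 'n :: finite" where
  "centered_dft p = (\<chi> i. if num i = 0 then 0 else dft p $ i)"

lemma dft_linear: "dft (p + q) = dft p + dft (q :: complex ^ 'n :: finite)"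
  by (rule tuple_eqI) (simp add: vertex_dft distrib_left sum.distrib)

lemma dft_mult: "dft (\<chi> i. u * p $ i) = (\<chi> i. u * dft p $ (i :: 'n :: finite))"
proof (rule tuple_eqI)
  have v: "vertex (\<chi> i. u * q $ i) k = u * vertex q k" for q :: "complex ^ 'n" and k
    by (simp add: vertex_def)
  fix j assume "j < CARD('n)"
  then show "vertex (dft (\<chi> i. u * p $ i)) j = vertex (\<chi> i. u * dft p $ i) j"
    by (simp add: v vertex_dft sum_distrib_left mult_ac)
qed

lemma vertex_const [simp]: "vertex (\<chi> i. b) k = b"
  by (simp add: vertex_def)

lemma dft_const:
  fixes i :: "'n :: finite"
  assumes "num i \<noteq> 0"
  shows "dft ((\<chi> i. b) :: complex ^ 'n) $ i = 0"
proof -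
  have "\<not> int CARD('n) dvd - int (num i)"
    using assms nat_dvd_not_less[of "num i" "CARD('n)"] by simp
  then have "(\<Sum>k<CARD('n). unity CARD('n) (- int (num i) * int k)) = 0"
    by (simp only: sum_unity zero_less_card_finite if_False)
  then have "(\<Sum>k<CARD('n). unity CARD('n) (- (int (num i) * int k)) * b) = 0"
    by (simp add: sum_distrib_right[symmetric])
  then have "vertex (dft ((\<chi> i. b) :: complex ^ 'n)) (num i) = 0"
    by (simp only: vertex_dft num_less vertex_const)
  then show ?thesis by simp
qed

lemma centered_dft_move: "centered_dft (move u b p) = (\<chi> i. u * centered_dft p $ (i :: 'n :: finite))"
proof -
  have eq: "move u b p = (\<chi> i. u * p $ i) + (\<chi> i. b)" by (simp add: move_def vec_eq_iff)
  show ?thesis unfolding eq by (auto simp: centered_dft_def vec_eq_iff dft_linear dft_mult dft_const)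
qed

lemma centered_dft_coord: "centered_dft p \<in> coord_space nonzero_modes"
  by (simp add: centered_dft_def coord_space_def nonzero_modes_def)

lemma centered_dft_idft:
  assumes "z \<in> coord_space nonzero_modes"
  shows "centered_dft (idft z) = z"
  using assms by (auto simp: centered_dft_def coord_space_def nonzero_modes_def vec_eq_iff)

lemma idft_centered_dft: "\<exists>b. idft (centered_dft p) = move 1 b (p :: complex ^ 'n :: finite)"
proof -
  \<comment> \<open>Mode 0 is the sum of the vertices, so b is minus the centroid.\<close>
  define b where "b = - vertex (dft p) 0 / of_nat CARD('n)"
  have "idft (centered_dft p) = move 1 b p"
  proof (rule tuple_eqI)
    fix k assume "k < CARD('n)"
    have "(\<Sum>j<CARD('n). unity CARD('n) (int j * int k) * vertex (centered_dft p) j) =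
        (\<Sum>j<CARD('n). unity CARD('n) (int j * int k) * vertex (dft p) j - (if j = 0 then vertex (dft p) 0 else 0))"
    proof (rule sum.cong)
      fix j assume "j \<in> {..<CARD('n)}"
      then obtain i :: 'n where "j = num i" using ex_num by auto
      then show "unity CARD('n) (int j * int k) * vertex (centered_dft p) j =
          unity CARD('n) (int j * int k) * vertex (dft p) j - (if j = 0 then vertex (dft p) 0 else 0)"
        by (auto simp: centered_dft_def) (metis vertex_num)
    qed simp
    also have "\<dots> = (\<Sum>j<CARD('n). unity CARD('n) (int j * int k) * vertex (dft p) j) - vertex (dft p) 0"
      by (simp add: sum_subtractf)
    finally have "vertex (idft (centered_dft p)) k = vertex (idft (dft p)) k + b"
      unfolding vertex_idft b_def by (simp add: diff_divide_distrib)
    then show "vertex (idft (centered_dft p)) k = vertex (move 1 b p) k" by simp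
  qed
  then show ?thesis ..
qed

lemma centered_dft_eq_0_iff: "centered_dft p = 0 \<longleftrightarrow> (p :: complex ^ 'n :: finite) \<notin> nonconst_tuples"
proof
  assume 0: "centered_dft p = 0"
  obtain b where "idft (centered_dft p) = move 1 b p" using idft_centered_dft by blast
  then have "move 1 b p = 0" using 0 by (simp add: idft_def tuple_def vec_eq_iff)
  then show "p \<notin> nonconst_tuples"
    by (auto simp: move_def vec_eq_iff nonconst_tuples_def) (metis add_right_cancel)
next
  assume "p \<notin> nonconst_tuples"
  then obtain b where b: "p = (\<chi> i. b)" by (auto simp: nonconst_tuples_def vec_eq_iff)
  show "centered_dft p = 0" unfolding b by (simp add: centered_dft_def vec_eq_iff dft_const)
qed

lemma gram_mult: "norm u = 1 \<Longrightarrow> gram (\<chi> i. u * z $ i) = gram z"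
proof -
  assume "norm u = 1"
  then have "u * cnj u = 1" by (metis complex_norm_square of_real_1 one_power2)
  then show ?thesis by (simp add: vec_eq_iff mult.left_commute[of _ "cnj u"] mult.assoc[symmetric])
qed

text \<open>A coordinate k with \<open>y $ k\<close> nonzero fixes the phase: comparing column k of
  the two matrices gives the same ratio of z to y in every coordinate, and comparing the diagonal
  entries gives it modulus 1.\<close>

lemma gram_eq_imp:
  assumes "gram z = gram y" "y \<noteq> 0"
  obtains u where "norm u = 1" "z = (\<chi> i. u * y $ i)"
proof -
  obtain k where k: "y $ k \<noteq> 0" using assms(2) by (auto simp: vec_eq_iff)
  have eq: "z $ i * cnj (z $ j) = y $ i * cnj (y $ j)" for i j
    using assms(1) by (metis gram_nth)
  have "(cmod (z $ k))\<^sup>2 = (cmod (y $ k))\<^sup>2" using assms(1) by (metis gram_diagonal)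
  then have n: "cmod (z $ k) = cmod (y $ k)" by simp
  then have zk: "z $ k \<noteq> 0" using k by auto
  show ?thesis
  proof
    show "norm (cnj (y $ k) / cnj (z $ k)) = 1" using n zk k by (simp add: norm_divide)
    show "z = (\<chi> i. cnj (y $ k) / cnj (z $ k) * y $ i)"
      using zk eq[of _ k] by (simp add: vec_eq_iff field_simps)
  qed
qed

definition polygon_gram :: "(complex ^ 'n) set \<Rightarrow> complex ^ 'n ^ 'n :: finite" where
  "polygon_gram P = gram (centered_dft (rep P))"

definition gram_polygon :: "complex ^ 'n ^ 'n \<Rightarrow> (complex ^ 'n :: finite) set" where
  "gram_polygon M = orbit (idft (SOME z. z \<in> coord_space nonzero_modes \<and> gram z = M))"

text \<open>A continuous local section of \<open>gram\<close>: where \<open>z $ k\<close> is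
  nonzero, the value at \<open>gram z\<close> is z rotated so that coordinate k becomes
  positive.\<close>

definition column_root :: "'n \<Rightarrow> complex ^ 'n ^ 'n \<Rightarrow> complex ^ 'n :: finite" where
  "column_root k M = (\<chi> i. M $ i $ k / of_real (sqrt (Re (M $ k $ k))))"

abbreviation polygon_grams :: "(complex ^ 'n ^ 'n :: finite) set" where
  "polygon_grams \<equiv> gram ` (coord_space nonzero_modes - {0})"

lemma idft_mult: "idft (\<chi> i. u * z $ i) = (\<chi> i. u * idft z $ (i :: 'n :: finite))"
proof -
  have "dft (idft (\<chi> i. u * z $ i)) = dft (\<chi> i. u * idft z $ i)" unfolding dft_mult by simp
  then show ?thesis by (metis idft_dft)
qed

lemma polygon_gram_orbit: "p \<in> nonconst_tuples \<Longrightarrow> polygon_gram (orbit p) = gram (centered_dft p)"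
  by (elim rep_orbit[of p]) (simp add: polygon_gram_def centered_dft_move gram_mult)

lemma gram_polygon_gram:
  assumes "z \<in> coord_space nonzero_modes" "z \<noteq> 0"
  shows "gram_polygon (gram z) = orbit (idft z)"
proof -
  define y where "y = (SOME y. y \<in> coord_space nonzero_modes \<and> gram y = gram z)"
  have "y \<in> coord_space nonzero_modes \<and> gram y = gram z"
    unfolding y_def by (rule someI[of _ z]) (use assms in auto)
  then obtain u where u: "norm u = 1" "y = (\<chi> i. u * z $ i)" using gram_eq_imp assms(2) by blast
  then have "idft y = move u 0 (idft z)" by (simp add: idft_mult move_def)
  then show ?thesis using u(1) by (simp add: gram_polygon_def y_def[symmetric])
qed

lemma idft_nonconst:
  assumes "z \<in> coord_space nonzero_modes" "z \<noteq> 0"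
  shows "idft z \<in> nonconst_tuples"
  using centered_dft_eq_0_iff[of "idft z"] centered_dft_idft[OF assms(1)] assms(2) by simp

lemma topspace_polygon_space: "topspace polygon_space = (polygons :: (complex ^ 'n :: finite) set set)"
  using quotient_imp_surjective_map[OF quotient_map_orbit[where 'n = 'n]] by (simp add: polygons_def)

lemma continuous_on_dft: "continuous_on A (dft :: complex ^ 'n \<Rightarrow> complex ^ 'n :: finite)"
  unfolding dft_def tuple_def by (intro continuous_intros)

lemma continuous_on_idft: "continuous_on A (idft :: complex ^ 'n \<Rightarrow> complex ^ 'n :: finite)"
  unfolding idft_def tuple_def by (intro continuous_intros) simp

lemma continuous_on_centered_dft: "continuous_on A (centered_dft :: complex ^ 'n \<Rightarrow> complex ^ 'n :: finite)"
  unfolding centered_dft_def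
proof (intro continuous_on_vec_lambda)
  fix i :: 'n
  have "continuous_on A (\<lambda>p. dft p $ i)" by (intro continuous_intros continuous_on_dft)
  then show "continuous_on A (\<lambda>p. if num i = 0 then 0 else dft p $ i)" by (cases "num i = 0") auto
qed

text \<open>Continuity of \<open>polygon_gram\<close> is the universal property of the quotient
  topology. Its inverse is defined by choice, but on the open set where the diagonal entry k is
  nonzero it equals the orbit of the continuous map \<open>idft (column_root k M)\<close>. These
  open sets cover, since the Gram matrix of a nonzero vector has a nonzero diagonal entry.\<close>

lemma polygon_gram_homeomorphic_map:
  "homeomorphic_map polygon_space (top_of_set (polygon_grams :: (complex ^ 'n ^ 'n :: finite) set)) polygon_gram"
proof -
  have "continuous_map (top_of_set nonconst_tuples) (top_of_set polygon_grams)
      (polygon_gram \<circ> (orbit :: complex ^ 'n \<Rightarrow> _))"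
  proof (rule continuous_map_eq)
    show "continuous_map (top_of_set nonconst_tuples) (top_of_set polygon_grams)
        (gram \<circ> (centered_dft :: complex ^ 'n \<Rightarrow> _))"
      by (auto simp: continuous_map_subtopology_eu o_def centered_dft_coord centered_dft_eq_0_iff
          intro!: continuous_intros continuous_on_centered_dft imageI)
  qed (simp add: polygon_gram_orbit)
  then have c1: "continuous_map polygon_space (top_of_set polygon_grams) (polygon_gram :: (complex ^ 'n) set \<Rightarrow> _)"
    using continuous_compose_quotient_map_eq[OF quotient_map_orbit[where 'n = 'n]] by blast
  have c2: "continuous_map (top_of_set polygon_grams) polygon_space (gram_polygon :: _ \<Rightarrow> (complex ^ 'n) set)"
    unfolding continuous_map
  proof (intro conjI allI impI)
    show "gram_polygon ` topspace (top_of_set polygon_grams) \<subseteq> topspace (polygon_space :: (complex ^ 'n) set topology)"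
      by (auto simp: topspace_polygon_space polygons_def gram_polygon_gram intro!: idft_nonconst)
    fix V :: "(complex ^ 'n) set set" assume V: "openin polygon_space V"
    define W where "W = {p \<in> nonconst_tuples. orbit p \<in> V}"
    have W: "openin (top_of_set nonconst_tuples) W"
      using V by (simp add: openin_polygon_space W_def)
    define U :: "'n \<Rightarrow> (complex ^ 'n ^ 'n) set" where "U k = {M \<in> polygon_grams. M $ k $ k \<noteq> 0}" for k
    define s where "s k M = idft (column_root k M)" for k :: 'n and M
    have s: "s k M \<in> nonconst_tuples \<and> gram_polygon M = orbit (s k M)" if M: "M \<in> U k" for k M
    proof -
      obtain z where z: "z \<in> coord_space nonzero_modes" "z \<noteq> 0" "M = gram z" "z $ k \<noteq> 0"
        using M unfolding U_def by fastforce
      define u where "u = cnj (z $ k) / of_real (cmod (z $ k))"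
      have u: "norm u = 1" using z(4) by (simp add: u_def norm_divide)
      have "column_root k M = (\<chi> i. u * z $ i)"
        unfolding column_root_def z(3) gram_diagonal by (simp add: u_def vec_eq_iff)
      then have sk: "s k M = move u 0 (idft z)" by (simp add: s_def idft_mult move_def)
      have "u \<noteq> 0" using u by auto
      then show ?thesis using u z by (simp add: sk[unfolded z(3)] gram_polygon_gram idft_nonconst nonconst_move)
    qed
    have Uopen: "openin (top_of_set polygon_grams) (U k)" for k
    proof -
      have "openin (top_of_set polygon_grams) (polygon_grams \<inter> (\<lambda>M. M $ k $ k) -` (- {0 :: complex}))"
        by (rule continuous_openin_preimage_gen) (auto intro!: continuous_intros)
      moreover have "polygon_grams \<inter> (\<lambda>M. M $ k $ k) -` (- {0}) = U k" by (auto simp: U_def)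
      ultimately show ?thesis by simp
    qed
    have "continuous_on (U k) (column_root k)" for k
      unfolding column_root_def
    proof (intro continuous_intros ballI)
      fix M assume "M \<in> U k"
      then obtain z where z: "M = gram z" "z $ k \<noteq> 0" unfolding U_def by fastforce
      show "complex_of_real (sqrt (Re (M $ k $ k))) \<noteq> 0"
        unfolding z(1) gram_diagonal using z(2) by simp
    qed
    then have scont: "continuous_on (U k) (s k)" for k
      unfolding s_def by (intro continuous_on_compose2[OF continuous_on_idft]) auto
    have "openin (top_of_set polygon_grams) (U k \<inter> s k -` W)" for k
    proof -
      have "openin (top_of_set (U k)) (U k \<inter> s k -` W)"
        by (rule continuous_openin_preimage[OF scont _ W]) (use s in auto)
      then show ?thesis using Uopen openin_trans by blast
    qed
    moreover have "{M \<in> topspace (top_of_set polygon_grams). gram_polygon M \<in> V} = (\<Union>k. U k \<inter> s k -` W)"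
    proof (intro equalityI subsetI)
      fix M assume "M \<in> {M \<in> topspace (top_of_set polygon_grams). gram_polygon M \<in> V}"
      then have M: "M \<in> polygon_grams" "gram_polygon M \<in> V" by auto
      then obtain z where z: "M = gram z" "z \<noteq> 0" by auto
      then obtain k where "z $ k \<noteq> 0" by (auto simp: vec_eq_iff)
      then have "M \<in> U k" using M(1) unfolding z(1) U_def by simp
      then show "M \<in> (\<Union>k. U k \<inter> s k -` W)" using s[of M k] M by (auto simp: W_def)
    next
      fix M assume "M \<in> (\<Union>k. U k \<inter> s k -` W)"
      then obtain k where "M \<in> U k" "s k M \<in> W" by auto
      then show "M \<in> {M \<in> topspace (top_of_set polygon_grams). gram_polygon M \<in> V}"
        using s[of M k] by (auto simp: W_def U_def)
    qed
    moreover have "openin (top_of_set polygon_grams) (\<Union>k. U k \<inter> s k -` W)"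
      using calculation(1) by (intro openin_Union) auto
    ultimately show "openin (top_of_set polygon_grams) {M \<in> topspace (top_of_set polygon_grams). gram_polygon M \<in> V}"
      by simp
  qed
  have inv1: "gram_polygon (polygon_gram P) = P" if P: "P \<in> polygons" for P :: "(complex ^ 'n) set"
  proof -
    have "centered_dft (rep P) \<noteq> 0" using rep_nonconst[OF P] centered_dft_eq_0_iff by blast
    then have "gram_polygon (polygon_gram P) = orbit (idft (centered_dft (rep P)))"
      unfolding polygon_gram_def by (intro gram_polygon_gram centered_dft_coord)
    moreover obtain b where "idft (centered_dft (rep P)) = move 1 b (rep P)" using idft_centered_dft by blast
    ultimately show ?thesis using orbit_rep[OF P] by simp
  qed
  have inv2: "polygon_gram (gram_polygon M) = M" if "M \<in> polygon_grams" for M :: "complex ^ 'n ^ 'n"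
  proof -
    obtain z where z: "M = gram z" "z \<in> coord_space nonzero_modes" "z \<noteq> 0" using \<open>M \<in> polygon_grams\<close> by auto
    show ?thesis
      unfolding z(1) gram_polygon_gram[OF z(2,3)] polygon_gram_orbit[OF idft_nonconst[OF z(2,3)]]
        centered_dft_idft[OF z(2)] ..
  qed
  have "homeomorphic_maps polygon_space (top_of_set polygon_grams) polygon_gram (gram_polygon :: _ \<Rightarrow> (complex ^ 'n) set)"
    unfolding homeomorphic_maps_def using c1 c2 inv1 inv2 by (auto simp: topspace_polygon_space)
  then show ?thesis by (auto simp: homeomorphic_map_maps)
qed

definition area_weight :: "'n :: finite \<Rightarrow> real" where
  "area_weight i = sin (2 * pi * real (num i) / real CARD('n)) / (2 * real CARD('n))"

lemma area_centered_dft: "area p = trace_form area_weight (gram (centered_dft (p :: complex ^ 'n :: finite)))"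
proof -
  have "area p = (\<Sum>i\<in>UNIV. area_weight i * (cmod (dft p $ i))\<^sup>2)"
    unfolding area_dft area_weight_def by (rule sum_vertex[symmetric])
  also have "\<dots> = (\<Sum>i\<in>UNIV. area_weight i * (cmod (centered_dft p $ i))\<^sup>2)"
    by (rule sum.cong) (auto simp: area_weight_def centered_dft_def)
  finally show ?thesis by (simp add: trace_form_gram)
qed

text \<open>Since a is nonzero, the level omits the zero vector, the only element of
  \<open>coord_space nonzero_modes\<close> that is not the transform of a polygon; the homeomorphism
  above therefore restricts.\<close>

lemma level_space_homeomorphic:
  assumes "a \<noteq> 0"
  shows "(level_space a :: (complex ^ 'n :: finite) set topology) homeomorphic_space
    top_of_set (gram_level area_weight a (nonzero_modes :: 'n set))"
proof -
  have "polygon_gram ` level_polygons a = (gram_level area_weight a nonzero_modes :: (complex ^ 'n ^ 'n) set)"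
  proof (intro equalityI subsetI)
    fix M :: "complex ^ 'n ^ 'n" assume "M \<in> polygon_gram ` level_polygons a"
    then show "M \<in> gram_level area_weight a nonzero_modes"
      using centered_dft_coord by (auto simp: level_polygons_def polygon_gram_def gram_level_def area_centered_dft)
  next
    fix M :: "complex ^ 'n ^ 'n" assume "M \<in> gram_level area_weight a nonzero_modes"
    then obtain z where z: "z \<in> coord_space nonzero_modes" "M = gram z" "trace_form area_weight (gram z) = a"
      by (auto simp: gram_level_def)
    then have "z \<noteq> 0" using assms by (auto simp: trace_form_gram)
    then have p: "idft z \<in> nonconst_tuples" using z idft_nonconst by blast
    have M: "M = polygon_gram (orbit (idft z))"
      using polygon_gram_orbit[OF p] centered_dft_idft[OF z(1)] z(2) by simp
    then have "area (rep (orbit (idft z))) = a"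
      using z unfolding area_centered_dft polygon_gram_def by simp
    then show "M \<in> polygon_gram ` level_polygons a"
      using M p by (auto simp: level_polygons_def polygons_def)
  qed
  moreover have "gram_level area_weight a nonzero_modes \<subseteq> (polygon_grams :: (complex ^ 'n ^ 'n) set)"
    using assms by (auto simp: gram_level_def trace_form_gram)
  moreover have "level_polygons a \<subseteq> (polygons :: (complex ^ 'n) set set)" by (auto simp: level_polygons_def)
  ultimately have "homeomorphic_map (level_space a) (subtopology (top_of_set polygon_grams)
      (gram_level area_weight a nonzero_modes)) (polygon_gram :: (complex ^ 'n) set \<Rightarrow> _)"
    unfolding level_space_def
    by (intro homeomorphic_map_subtopologies[OF polygon_gram_homeomorphic_map])
       (auto simp: topspace_polygon_space)
  moreover have "subtopology (top_of_set polygon_grams) (gram_level area_weight a nonzero_modes) =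
      top_of_set (gram_level area_weight a nonzero_modes :: (complex ^ 'n ^ 'n) set)"
    using \<open>gram_level area_weight a nonzero_modes \<subseteq> polygon_grams\<close>
    by (simp add: subtopology_subtopology inf.absorb2)
  ultimately have "homeomorphic_map (level_space a) (top_of_set (gram_level area_weight a nonzero_modes))
      (polygon_gram :: (complex ^ 'n) set \<Rightarrow> _)"
    by simp
  then show ?thesis by (rule homeomorphic_map_imp_homeomorphic_space)
qed

lemma sin_2pi_pos_iff:
  assumes "j < n"
  shows "0 < sin (2 * pi * real j / real n) \<longleftrightarrow> 0 < j \<and> 2 * j < n"
    and "sin (2 * pi * real j / real n) < 0 \<longleftrightarrow> n < 2 * j"
proof -
  let ?x = "2 * pi * real j / real n"
  have n: "real n > 0" using assms by simp
  consider "j = 0" | "0 < j" "2 * j < n" | "2 * j = n" | "n < 2 * j" by linarith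
  then have "(0 < sin ?x \<longleftrightarrow> 0 < j \<and> 2 * j < n) \<and> (sin ?x < 0 \<longleftrightarrow> n < 2 * j)"
  proof cases
    case 2
    then have "2 * real j < real n" by linarith
    then have "2 * real j * pi < real n * pi" by simp
    then have "?x < pi" using n by (simp add: field_simps)
    moreover have "0 < ?x" using 2 n by simp
    ultimately show ?thesis using sin_gt_zero[of ?x] 2 by auto
  next
    case 3
    then have "?x = pi" using n by (simp add: field_simps flip: 3)
    then show ?thesis using 3 by simp
  next
    case 4
    then have "real n < 2 * real j" by linarith
    then have "real n * pi < 2 * real j * pi" by simp
    then have "pi < ?x" using n by (simp add: field_simps)
    moreover have "?x < 2 * pi" using assms n by (simp add: field_simps)
    ultimately show ?thesis using sin_lt_zero[of ?x] 4 by auto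
  qed auto
  then show "0 < sin ?x \<longleftrightarrow> 0 < j \<and> 2 * j < n" "sin ?x < 0 \<longleftrightarrow> n < 2 * j" by auto
qed

text \<open>R collects the modes whose weight has the sign of a: 0 < j < n / 2 if a is positive, n /
  2 < j < n if it is negative, the same number in both cases. For even n the mode n / 2 has weight
  zero and is damped away with the others. Rescaling then replaces the weights on R by 1.\<close>

theorem even_homology_level_space:
  assumes "CARD('n :: finite) \<ge> 3" "a \<noteq> 0"
  shows "even_homology ((CARD('n) - 1) div 2) (level_space a :: (complex ^ 'n) set topology)"
proof -
  let ?n = "CARD('n)"
  define R :: "'n set" where "R = {i. 0 < a * area_weight i}"
  have "area_weight i = 0" if "num i = 0" for i :: 'n using that by (simp add: area_weight_def)
  then have R: "R \<subseteq> nonzero_modes" by (force simp: R_def nonzero_modes_def)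
  have "num ` R = (if a > 0 then {0<..(?n - 1) div 2} else {?n - (?n - 1) div 2..<?n})"
  proof -
    have "num ` R = {j. j < ?n \<and> 0 < a * (sin (2 * pi * real j / real ?n) / (2 * real ?n))}"
      by (auto simp: R_def area_weight_def image_iff) (metis ex_num)
    also have "\<dots> = {j. j < ?n \<and> 0 < a * sin (2 * pi * real j / real ?n)}"
      by (simp add: zero_less_divide_iff)
    also have "\<dots> = {j. j < ?n \<and> (if a > 0 then 0 < j \<and> 2 * j < ?n else ?n < 2 * j)}"
      using \<open>a \<noteq> 0\<close> by (auto simp: zero_less_mult_iff sin_2pi_pos_iff)
    also have "\<dots> = (if a > 0 then {0<..(?n - 1) div 2} else {?n - (?n - 1) div 2..<?n})"
      by auto
    finally show ?thesis .
  qed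
  moreover have "card (num ` R) = card R" by (rule card_image) (auto simp: inj_on_def)
  ultimately have card: "card R = (?n - 1) div 2" by (cases "a > 0") auto
  then have "R \<noteq> {}" using assms(1) by auto
  have "(level_space a :: (complex ^ 'n) set topology) homotopy_equivalent_space top_of_set (gram_level area_weight a (nonzero_modes :: 'n set))"
    by (intro homeomorphic_imp_homotopy_equivalent_space level_space_homeomorphic \<open>a \<noteq> 0\<close>)
  moreover have "gram_level area_weight a (nonzero_modes :: 'n set) homotopy_eqv gram_level area_weight a R"
    by (rule gram_level_eqv_positive[OF R \<open>a \<noteq> 0\<close>]) (auto simp: R_def)
  moreover have "gram_level area_weight a R homeomorphic proj_space R"
    by (rule gram_level_rescale) (use \<open>a \<noteq> 0\<close> in \<open>auto simp: R_def\<close>)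
  then have "gram_level area_weight a R homotopy_eqv proj_space R"
    by (rule homeomorphic_imp_homotopy_eqv)
  ultimately have "(level_space a :: (complex ^ 'n) set topology) homotopy_equivalent_space top_of_set (proj_space R)"
    by (blast intro: homotopy_eqv_trans)
  then show ?thesis
    using even_homology_homotopy_equivalent even_homology_proj_space[OF \<open>R \<noteq> {}\<close>] card by metis
qed

section \<open>Regular stars and their winding numbers\<close>

definition star :: "complex \<Rightarrow> complex \<Rightarrow> int \<Rightarrow> complex ^ 'n :: finite" where
  "star c z w = tuple (\<lambda>k. c + z * unity CARD('n) (w * int k))"

lemma vertex_star: "vertex (star c z w :: complex ^ 'n :: finite) k = c + z * unity CARD('n) (w * int k)"
  unfolding star_def by (subst vertex_tuple_periodic) (simp_all add: distrib_left unity_add)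

lemma star_nonconst_iff:
  "(star c z w :: complex ^ 'n :: finite) \<in> nonconst_tuples \<longleftrightarrow> z \<noteq> 0 \<and> \<not> int CARD('n) dvd w"
proof
  assume "(star c z w :: complex ^ 'n) \<in> nonconst_tuples"
  then obtain i j where ij: "(star c z w :: complex ^ 'n) $ i \<noteq> (star c z w :: complex ^ 'n) $ j"
    by (auto simp: nonconst_tuples_def)
  have "unity CARD('n) (w * int k) = 1" if "int CARD('n) dvd w" for k
    using that by (simp add: unity_eq_1_iff)
  then show "z \<noteq> 0 \<and> \<not> int CARD('n) dvd w"
    using ij vertex_star[of c z w "num i", where 'n = 'n] vertex_star[of c z w "num j", where 'n = 'n]
    by auto
next
  assume z: "z \<noteq> 0 \<and> \<not> int CARD('n) dvd w"
  then have "unity CARD('n) w \<noteq> 1" by (simp add: unity_eq_1_iff)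
  then have "vertex (star c z w :: complex ^ 'n) 0 \<noteq> vertex (star c z w :: complex ^ 'n) 1"
    using z by (simp add: vertex_star)
  then show "(star c z w :: complex ^ 'n) \<in> nonconst_tuples"
    unfolding nonconst_tuples_def vertex_def by blast
qed

lemma nonconst_iff_edge:
  "(p :: complex ^ 'n :: finite) \<in> nonconst_tuples \<longleftrightarrow> (\<exists>k. vertex p (k + 1) \<noteq> vertex p k)"
proof
  assume p: "p \<in> nonconst_tuples"
  show "\<exists>k. vertex p (k + 1) \<noteq> vertex p k"
  proof (rule ccontr)
    assume "\<nexists>k. vertex p (k + 1) \<noteq> vertex p k"
    then have "vertex p k = vertex p 0" for k by (induction k) auto
    then have "p $ i = vertex p 0" for i by (metis vertex_num)
    then show False using p by (auto simp: nonconst_tuples_def)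
  qed
next
  assume "\<exists>k. vertex p (k + 1) \<noteq> vertex p k"
  then show "p \<in> nonconst_tuples" unfolding nonconst_tuples_def vertex_def by blast
qed

text \<open>If u were 1, the vertices would move by a constant translation, which closes up only
  when it is zero. Otherwise the recursion has the fixed point b / (1 - u), about which it
  multiplies by u, and closing up after n steps makes u an n-th root of unity.\<close>

lemma similar_shift_imp_star:
  fixes p :: "complex ^ 'n :: finite"
  assumes p: "p \<in> nonconst_tuples" and shift: "\<And>k. vertex p (k + 1) = u * vertex p k + b"
  obtains c z w where "p = star c z w" "z \<noteq> 0" "0 < w" "w < int CARD('n)" "u = unity CARD('n) w"
proof -
  let ?n = "CARD('n)"
  have "u \<noteq> 1"
  proof
    assume u: "u = 1"
    have lin: "vertex p k = vertex p 0 + of_nat k * b" for k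
      by (induction k) (use shift u in \<open>auto simp: algebra_simps\<close>)
    have "vertex p ?n = vertex p 0" using vertex_add_card(1)[of p 0] by simp
    then have "b = 0" using lin[of ?n] by simp
    then show False using p shift u by (simp add: nonconst_iff_edge)
  qed
  define c where "c = b / (1 - u)"
  define z where "z = vertex p 0 - c"
  have "u * c + b = c" using \<open>u \<noteq> 1\<close> by (simp add: c_def field_simps)
  then have pow: "vertex p k = c + z * u ^ k" for k
  proof (induction k)
    case (Suc k)
    have "vertex p (Suc k) = (u * c + b) + z * (u * u ^ k)"
      using shift[of k] Suc by (simp add: algebra_simps)
    then show ?case using \<open>u * c + b = c\<close> by simp
  qed (simp add: z_def)
  have "z \<noteq> 0" using p pow by (auto simp: nonconst_iff_edge)
  moreover have "vertex p ?n = vertex p 0" using vertex_add_card(1)[of p 0] by simp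
  ultimately have "u ^ ?n = 1" by (simp add: pow)
  then obtain j where j: "j < ?n" "u = cis (2 * pi * real j / real ?n)"
    using Complex.bij_betw_roots_unity[of ?n] by (auto simp: bij_betw_def)
  then have u: "u = unity ?n (int j)" by (simp add: unity_def)
  show ?thesis
  proof
    show "p = star c z (int j)"
      by (rule tuple_eqI) (simp add: pow vertex_star u unity_power)
    show "0 < int j" using u \<open>u \<noteq> 1\<close> by (cases j) auto
  qed (use \<open>z \<noteq> 0\<close> j u in auto)
qed

lemma star_add_card: "(star c z (w + int CARD('n)) :: complex ^ 'n :: finite) = star c z w"
  by (rule tuple_eqI) (simp add: vertex_star distrib_right unity_add)

lemma star_diff_card: "(star c z (w - int CARD('n)) :: complex ^ 'n :: finite) = star c z w"
  using star_add_card[of c z "w - int CARD('n)", where 'n = 'n] by simp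

lemma shift_star: "shift (star c z w :: complex ^ 'n :: finite) = move (unity CARD('n) w) (c - unity CARD('n) w * c) (star c z w)"
  by (rule tuple_eqI) (simp add: vertex_star unity_add algebra_simps)

lemma edge_star:
  "vertex (star c z w :: complex ^ 'n :: finite) (k + 1) - vertex (star c z w :: complex ^ 'n) k =
    z * (unity CARD('n) w - 1) * unity CARD('n) (w * int k)"
  unfolding vertex_star by (simp add: unity_add algebra_simps)

lemma equilateral_star: "equilateral (star c z w :: complex ^ 'n :: finite)"
proof -
  have "dist (vertex (star c z w :: complex ^ 'n) k) (vertex (star c z w :: complex ^ 'n) (k + 1)) =
      norm (z * (unity CARD('n) w - 1))" for k
    using arg_cong[OF edge_star[of c z w k, where 'n = 'n], of norm] by (simp add: dist_norm norm_minus_commute norm_mult)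
  then show ?thesis unfolding equilateral_def by simp
qed

lemma regular_star_rep_star:
  assumes "P \<in> polygons" "rep P = star c z w"
  shows "regular_star P"
  using assms orbit_rep[OF assms(1)] by (simp add: regular_star_def equilateral_star shift_star)

text \<open>
  The exponent is normalized to \<open>2 \<bar>w\<bar> < n\<close>, where it is the winding number; \<open>2 w = n\<close> is the
  complete fold.
\<close>

lemma regular_star_imp_star:
  fixes P :: "(complex ^ 'n :: finite) set"
  assumes "regular_star P" "\<not> complete_fold P"
  obtains c z w where "rep P = star c z w" "z \<noteq> 0" "w \<noteq> 0" "2 * \<bar>w\<bar> < int CARD('n)"
proof -
  have P: "P \<in> polygons" and "orbit (shift (rep P)) = orbit (rep P)"
    using assms(1) orbit_rep by (auto simp: regular_star_def)
  then obtain u b where "shift (rep P) = move u b (rep P)" by (auto simp: orbit_eq_iff)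
  then have "vertex (rep P) (k + 1) = u * vertex (rep P) k + b" for k
    by (metis vertex_shift vertex_move)
  then obtain c z w where p: "rep P = star c z w" "z \<noteq> 0" "0 < w" "w < int CARD('n)"
    using similar_shift_imp_star[OF rep_nonconst[OF P]] by metis
  have ne: "2 * w \<noteq> int CARD('n)"
  proof
    assume "2 * w = int CARD('n)"
    then have "unity CARD('n) (w * int (k + 2)) = unity CARD('n) (w * int k)" for k
      using unity_card[of "CARD('n)" 1] by (simp add: distrib_left unity_add mult.commute)
    then have "complete_fold P" using assms(1) unfolding complete_fold_def p(1) vertex_star by simp
    then show False using assms(2) by simp
  qed
  show ?thesis
  proof (cases "2 * w < int CARD('n)")
    case True
    then show ?thesis using that p by auto
  next
    case False
    then show ?thesis
      using that[of c z "w - int CARD('n)"] p ne by (simp add: star_diff_card)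
  qed
qed

section \<open>Winding number and area of a star\<close>

lemma winding_number_polygonal_path:
  assumes "length xs \<ge> 2" "\<And>i. i + 1 < length xs \<Longrightarrow> \<zeta> \<notin> closed_segment (xs ! i) (xs ! (i + 1))"
  shows "path (polygonal_path xs) \<and> pathstart (polygonal_path xs) = hd xs \<and> \<zeta> \<notin> path_image (polygonal_path xs) \<and>
    winding_number (polygonal_path xs) \<zeta> = (\<Sum>i<length xs - 1. winding_number (linepath (xs ! i) (xs ! (i + 1))) \<zeta>)"
  using assms
proof (induction xs rule: polygonal_path.induct)
  case (3 a b)
  then show ?case using "3.prems"(2)[of 0] by simp
next
  case (4 a b c zs)
  have seg: "\<zeta> \<notin> closed_segment a b" using "4.prems"(2)[of 0] by simp
  have "\<zeta> \<notin> closed_segment ((b # c # zs) ! i) ((b # c # zs) ! (i + 1))" if "i + 1 < length (b # c # zs)" for i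
    using "4.prems"(2)[of "i + 1"] that by simp
  then have IH: "path (polygonal_path (b # c # zs))" "pathstart (polygonal_path (b # c # zs)) = b"
      "\<zeta> \<notin> path_image (polygonal_path (b # c # zs))"
      "winding_number (polygonal_path (b # c # zs)) \<zeta> =
        (\<Sum>i<length zs + 1. winding_number (linepath ((b # c # zs) ! i) ((b # c # zs) ! (i + 1))) \<zeta>)"
    using "4.IH" by auto
  have "winding_number (linepath a b +++ polygonal_path (b # c # zs)) \<zeta> =
      winding_number (linepath a b) \<zeta> + winding_number (polygonal_path (b # c # zs)) \<zeta>"
    by (rule winding_number_join) (use seg IH in auto)
  also have "\<dots> = (\<Sum>i<Suc (length zs + 1).
      winding_number (linepath ((a # b # c # zs) ! i) ((a # b # c # zs) ! (i + 1))) \<zeta>)"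
    by (subst sum.lessThan_Suc_shift) (simp add: IH(4))
  finally show ?case
    using seg IH(1-3) by (auto simp: path_image_join)
qed auto

text \<open>For x on the segment, (x - c) / z is a convex combination of 1 and
  \<open>cis \<theta>\<close>, which avoids the nonpositive reals because |\<theta>| < pi. So
  \<open>Ln ((x - c) / z)\<close> is a primitive of 1 / (x - c) along the whole segment, and the
  integral is its increment \<open>\<i> * \<theta>\<close>.\<close>

lemma winding_number_linepath_rotate:
  assumes "z \<noteq> 0" "\<bar>\<theta>\<bar> < pi"
  shows "c \<notin> closed_segment (c + z) (c + z * cis \<theta>)"
    and "winding_number (linepath (c + z) (c + z * cis \<theta>)) c = of_real (\<theta> / (2 * pi))"
proof -
  have slit: "(x - c) / z \<notin> \<real>\<^sub>\<le>\<^sub>0" if x: "x \<in> closed_segment (c + z) (c + z * cis \<theta>)" for x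
  proof
    assume neg: "(x - c) / z \<in> \<real>\<^sub>\<le>\<^sub>0"
    obtain t where t: "0 \<le> t" "t \<le> 1" "x = (1 - t) *\<^sub>R (c + z) + t *\<^sub>R (c + z * cis \<theta>)"
      using x by (auto simp: in_segment)
    have q: "(x - c) / z = (1 - of_real t) + of_real t * cis \<theta>"
      using \<open>z \<noteq> 0\<close> unfolding t(3) scaleR_conv_of_real by (simp add: field_simps)
    have im: "t * sin \<theta> = 0" and re: "1 - t + t * cos \<theta> \<le> 0"
      using neg unfolding q by (auto simp: complex_nonpos_Reals_iff)
    show False
    proof (cases "t = 0")
      case False
      then have "sin \<theta> = 0" using im by simp
      then have "\<theta> = 0" using assms(2) sin_eq_0_pi[of \<theta>] by (simp add: abs_less_iff)
      then show False using re by simp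
    qed (use re in simp)
  qed
  show c: "c \<notin> closed_segment (c + z) (c + z * cis \<theta>)"
    using slit[of c] by auto
  let ?g = "linepath (c + z) (c + z * cis \<theta>)"
  let ?S = "closed_segment (c + z) (c + z * cis \<theta>)"
  have "((\<lambda>x. 1 / (x - c)) has_contour_integral
      Ln ((pathfinish ?g - c) / z) - Ln ((pathstart ?g - c) / z)) ?g"
  proof (rule contour_integral_primitive[where S = ?S])
    fix x assume x: "x \<in> ?S"
    then have "x \<noteq> c" using c by auto
    have "((\<lambda>x. Ln ((x - c) / z)) has_field_derivative (1 / ((x - c) / z)) * (1 / z)) (at x)"
      by (rule derivative_eq_intros refl slit[OF x] | use \<open>z \<noteq> 0\<close> in simp)+
    then show "((\<lambda>x. Ln ((x - c) / z)) has_field_derivative 1 / (x - c)) (at x within ?S)"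
      using \<open>z \<noteq> 0\<close> by (auto intro: has_field_derivative_at_within)
  qed auto
  moreover have "Ln (cis \<theta>) = \<i> * \<theta>"
    unfolding cis_conv_exp using assms(2) by (intro Ln_exp) (auto simp: abs_less_iff)
  ultimately have "contour_integral ?g (\<lambda>x. 1 / (x - c)) = \<i> * \<theta>"
    using \<open>z \<noteq> 0\<close> by (intro contour_integral_unique) simp
  then show "winding_number ?g c = of_real (\<theta> / (2 * pi))"
    using c by (subst winding_number_valid_path) (auto simp: field_simps)
qed

lemma center_star:
  assumes "\<not> int CARD('n) dvd w"
  shows "center (star c z w :: complex ^ 'n :: finite) = c"
  using sum_unity[of "CARD('n)" w] assms
  by (simp add: center_def vertex_star sum.distrib sum_distrib_left[symmetric])

lemma not_dvd_small:
  assumes "w \<noteq> 0" "2 * \<bar>w\<bar> < int n"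
  shows "\<not> int n dvd w"
  using assms zdvd_not_zless[of "\<bar>w\<bar>" "int n"] by auto

text \<open>Each of the n edges subtends the angle 2 pi w / n at the center and so contributes w /
  n. The bound 2 |w| < n is what puts this angle strictly between - pi and pi.\<close>

lemma winding_star:
  fixes P :: "(complex ^ 'n :: finite) set"
  assumes p: "rep P = star c z w" and "z \<noteq> 0" and w: "w \<noteq> 0" "2 * \<bar>w\<bar> < int CARD('n)"
  shows "winding P = w"
proof -
  let ?n = "CARD('n)"
  let ?xs = "map (vertex (rep P)) [0..<?n + 1]"
  define \<theta> where "\<theta> = 2 * pi * of_int w / real ?n"
  have "2 * \<bar>real_of_int w\<bar> < real ?n" using w(2) by (metis (mono_tags, lifting) of_int_abs of_int_less_iff of_int_mult of_int_numeral of_int_of_nat_eq)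
  then have "pi * (2 * \<bar>real_of_int w\<bar>) < pi * real ?n" by simp
  then have \<theta>: "\<bar>\<theta>\<bar> < pi" by (simp add: \<theta>_def abs_mult field_simps)
  have nxt: "vertex (rep P) (k + 1) = c + (z * unity ?n (w * int k)) * cis \<theta>" for k
    unfolding p vertex_star by (simp add: distrib_left unity_add \<theta>_def unity_def[of _ w] mult_ac)
  have cur: "vertex (rep P) k = c + z * unity ?n (w * int k)" for k unfolding p vertex_star ..
  have unz: "z * unity ?n (w * int k) \<noteq> 0" for k using \<open>z \<noteq> 0\<close> by (metis mult_eq_0_iff norm_unity norm_zero zero_neq_one)
  note rot = winding_number_linepath_rotate[OF unz \<theta>, of c]
  have seg: "c \<notin> closed_segment (vertex (rep P) k) (vertex (rep P) (k + 1))" for k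
    unfolding nxt[of k] cur[of k] by (rule rot(1))
  have "winding_number (boundary_path (rep P)) c =
      (\<Sum>i<length ?xs - 1. winding_number (linepath (?xs ! i) (?xs ! (i + 1))) c)"
    unfolding boundary_path_def
    by (rule conjunct2[OF conjunct2[OF conjunct2[OF winding_number_polygonal_path]]])
       (use seg in \<open>auto simp: nth_append simp del: upt_Suc\<close>)
  also have "\<dots> = (\<Sum>i<?n. of_real (\<theta> / (2 * pi)))"
  proof (rule sum.cong)
    fix i assume i: "i \<in> {..<?n}"
    then have "?xs ! i = vertex (rep P) i" "?xs ! (i + 1) = vertex (rep P) (i + 1)"
      by (simp_all add: nth_append del: upt_Suc)
    then show "winding_number (linepath (?xs ! i) (?xs ! (i + 1))) c = of_real (\<theta> / (2 * pi))"
      using rot(2)[of i] by (simp only: cur[of i] nxt[of i])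
  qed simp
  also have "\<dots> = of_int w" by (simp add: \<theta>_def)
  finally have "winding_number (boundary_path (rep P)) (center (rep P)) = of_int w"
    using center_star[OF not_dvd_small[OF w], of c z] p by simp
  then show ?thesis unfolding winding_def by (intro the_equality) auto
qed

text \<open>The terms that mix the center with z are multiples of the sum of all powers of a
  nontrivial root of unity, or of its conjugate, and vanish.\<close>

lemma area_star:
  assumes "\<not> int CARD('n) dvd w"
  shows "area (star c z w :: complex ^ 'n :: finite) =
    real CARD('n) / 2 * (cmod z)\<^sup>2 * sin (2 * pi * of_int w / real CARD('n))"
proof -
  let ?n = "CARD('n)"
  let ?u = "\<lambda>k. unity ?n (w * int k)"
  have u0: "(\<Sum>k<?n. ?u k) = 0" using sum_unity[of ?n w] assms by simp
  have "(\<Sum>k<?n. cnj (c + z * ?u k) * (c + z * ?u (k + 1))) =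
      (\<Sum>k<?n. cnj c * c + (cnj c * z * unity ?n w) * ?u k + (c * cnj z) * cnj (?u k) + (z * cnj z) * unity ?n w)"
  proof (rule sum.cong)
    fix k
    have "cnj (c + z * U) * (c + z * (U * v)) =
        cnj c * c + (cnj c * z * v) * U + (c * cnj z) * cnj U + (z * cnj z) * v" if "U * cnj U = 1" for U v
    proof -
      have "cnj (c + z * U) * (c + z * (U * v)) =
        cnj c * c + (cnj c * z * v) * U + (c * cnj z) * cnj U + (z * cnj z) * v * (U * cnj U)"
        by (simp add: algebra_simps)
      then show ?thesis using that by simp
    qed
    from this[of "?u k" "unity ?n w"]
    show "cnj (c + z * ?u k) * (c + z * ?u (k + 1)) =
        cnj c * c + (cnj c * z * unity ?n w) * ?u k + (c * cnj z) * cnj (?u k) + (z * cnj z) * unity ?n w"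
      by (simp add: distrib_left unity_add add.commute mult.commute)
  qed simp
  also have "\<dots> = of_nat ?n * (cnj c * c) + of_nat ?n * (z * cnj z * unity ?n w)"
    using u0 by (simp add: sum.distrib sum_distrib_left[symmetric] flip: cnj_sum)
  also have "\<dots> = of_real (real ?n * (cmod c)\<^sup>2) + of_real (real ?n * (cmod z)\<^sup>2) * unity ?n w"
    unfolding of_real_mult complex_norm_square by (simp add: mult_ac)
  finally have "Im (\<Sum>k<?n. cnj (c + z * ?u k) * (c + z * ?u (k + 1))) =
      real ?n * (cmod z)\<^sup>2 * sin (2 * pi * of_int w / real ?n)"
    by (simp add: unity_def)
  then show ?thesis unfolding area_eq_Im vertex_star by simp
qed

section \<open>Critical polygons\<close>

definition edge :: "complex ^ 'n \<Rightarrow> nat \<Rightarrow> complex" where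
  "edge p k = vertex p (k + 1) - vertex p k"

lemma edge_linear [simp]:
  "edge (p + q) k = edge p k + edge q k" "edge (p - q) k = edge p k - edge q k"
  "edge (r *\<^sub>R p) k = r *\<^sub>R edge p k" "edge 0 k = 0" "edge (- p) k = - edge p k"
  by (simp_all add: edge_def scaleR_diff_right)

lemma edge_add_card [simp]:
  fixes p :: "complex ^ 'n :: finite"
  shows "edge p (k + CARD('n)) = edge p k"
  using vertex_add_card(1)[of p "k + 1"] by (simp add: edge_def)

lemma perimeter_edge: "perimeter p = (\<Sum>k<CARD('n). norm (edge (p :: complex ^ 'n :: finite) k))"
  by (simp add: perimeter_def edge_def dist_norm norm_minus_commute)

lemma cyclic_sum_shift_add:
  fixes f :: "nat \<Rightarrow> 'a :: ab_group_add"
  assumes "\<And>k. f (k + n) = f k"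
  shows "(\<Sum>k<n. f (k + j)) = (\<Sum>k<n. f k)"
proof (induction j)
  case (Suc j)
  have "(\<Sum>k<n. f (k + 1 + j)) = (\<Sum>k<n. f (k + j))"
    by (rule cyclic_sum_shift[of "\<lambda>k. f (k + j)"]) (metis add.commute assms add_0)
  then show ?case using Suc by simp
qed simp

lemma inner_tuple: "p \<bullet> q = (\<Sum>k<CARD('n). vertex (p :: complex ^ 'n :: finite) k \<bullet> vertex q k)"
  using sum_vertex[of "\<lambda>k z. z \<bullet> vertex q k" p] by (simp add: inner_vec_def)

text \<open>The two edges at vertex k add up to the diagonal from vertex k - 1 to vertex k + 1; the
  gradient there is this diagonal turned by a quarter turn and halved. The index
  \<open>k + CARD('n) - 1\<close> is k - 1 modulo n.\<close>

definition area_grad :: "complex ^ 'n \<Rightarrow> complex ^ 'n :: finite" where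
  "area_grad p = tuple (\<lambda>k. - (\<i> / 2) * (edge p k + edge p (k + CARD('n) - 1)))"

lemma vertex_area_grad:
  fixes p :: "complex ^ 'n :: finite"
  shows "vertex (area_grad p) (k + 1) = - (\<i> / 2) * (edge p (k + 1) + edge p k)"
proof -
  have "edge p (k + CARD('n) + CARD('n) - 1) = edge p (k + CARD('n) - 1)" for k
    using edge_add_card[of p "k + CARD('n) - 1"] zero_less_card_finite[where 'a = 'n]
    by (metis Nat.add_diff_assoc2 One_nat_def Suc_leI add.commute le_add1 le_trans trans_le_add2)
  then have "vertex (area_grad p) (k + 1) =
      - (\<i> / 2) * (edge p (k + 1) + edge p (k + 1 + CARD('n) - 1))"
    unfolding area_grad_def by (subst vertex_tuple_periodic) auto
  then show ?thesis by simp
qed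

lemma area_grad_linear: "area_grad (p + r *\<^sub>R v) = area_grad p + r *\<^sub>R area_grad (v :: complex ^ 'n :: finite)"
  by (simp add: area_grad_def tuple_def vec_eq_iff algebra_simps)

lemma bounded_linear_area_grad: "bounded_linear (area_grad :: complex ^ 'n \<Rightarrow> complex ^ 'n :: finite)"
proof -
  have "linear (area_grad :: complex ^ 'n \<Rightarrow> complex ^ 'n)"
  proof
    show "area_grad (p + q) = area_grad p + area_grad q" for p q :: "complex ^ 'n"
      using area_grad_linear[of p 1 q] by simp
    show "area_grad (r *\<^sub>R q) = r *\<^sub>R area_grad q" for r and q :: "complex ^ 'n"
      using area_grad_linear[of 0 r q] by (simp add: area_grad_def[of 0] tuple_def vec_eq_iff)
  qed
  then show ?thesis by (rule linear_conv_bounded_linear[THEN iffD1])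
qed

lemma inner_area_grad:
  fixes p :: "complex ^ 'n :: finite"
  shows "area_grad p \<bullet> v =
    (\<Sum>k<CARD('n). Im (cnj (vertex p k) * vertex v (k + 1)) + Im (cnj (vertex v k) * vertex p (k + 1))) / 2"
proof -
  let ?n = "CARD('n)"
  let ?f = "\<lambda>k. Im (cnj (vertex v k) * vertex p (k + 1))"
  have "area_grad p \<bullet> v = (\<Sum>k<?n. vertex (area_grad p) (k + 1) \<bullet> vertex v (k + 1))"
    unfolding inner_tuple
    by (rule cyclic_sum_shift_add[symmetric, of "\<lambda>k. vertex (area_grad p) k \<bullet> vertex v k"]) simp
  also have "\<dots> = (\<Sum>k<?n. (?f (k + 1) + Im (cnj (vertex p k) * vertex v (k + 1))) / 2)"
    unfolding vertex_area_grad by (intro sum.cong) (auto simp: edge_def inner_complex_def algebra_simps)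
  also have "\<dots> = ((\<Sum>k<?n. ?f (k + 1)) + (\<Sum>k<?n. Im (cnj (vertex p k) * vertex v (k + 1)))) / 2"
    by (simp add: sum.distrib sum_divide_distrib add_divide_distrib)
  also have "(\<Sum>k<?n. ?f (k + 1)) = (\<Sum>k<?n. ?f k)"
    using vertex_add_card(2)[of p 1] vertex_add_card(2)[of v 0] by (intro cyclic_sum_shift) simp
  finally show ?thesis by (simp add: sum.distrib add.commute)
qed

text \<open>The area is a quadratic form, so its expansion stops here; \<open>area_grad\<close> is
  the associated symmetric linear map, which also explains the next two identities.\<close>

lemma area_add: "area (p + v) = area p + area_grad p \<bullet> v + area (v :: complex ^ 'n :: finite)"
  unfolding inner_area_grad area_eq_Im
  by (simp add: sum.distrib[symmetric] add_divide_distrib[symmetric] algebra_simps)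

lemma area_grad_self: "area_grad v \<bullet> v = 2 * area (v :: complex ^ 'n :: finite)"
  unfolding inner_area_grad area_eq_Im by (simp add: sum_distrib_left sum_divide_distrib)

lemma area_grad_sym: "area_grad v \<bullet> w = area_grad w \<bullet> (v :: complex ^ 'n :: finite)"
  using area_add[of v w] area_add[of w v] by (simp add: add.commute)

lemma GDERIV_area: "GDERIV area p :> area_grad (p :: complex ^ 'n :: finite)"
proof -
  have eq: "area = (\<lambda>p :: complex ^ 'n. (area_grad p \<bullet> p) / 2)" by (simp add: area_grad_self fun_eq_iff)
  have "(area has_derivative (\<lambda>h. (area_grad p \<bullet> h + area_grad h \<bullet> p) / 2)) (at p)"
    unfolding eq
    by (rule derivative_eq_intros bounded_linear.has_derivative[OF bounded_linear_area_grad] refl | simp)+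
  moreover have "(\<lambda>h. (area_grad p \<bullet> h + area_grad h \<bullet> p) / 2) = (\<lambda>h. h \<bullet> area_grad p)"
    using area_grad_sym by (auto simp: fun_eq_iff inner_commute)
  ultimately show ?thesis by (simp add: gderiv_def)
qed

lemma GDERIV_unique_grad: "GDERIV f x :> g \<Longrightarrow> GDERIV f x :> h \<Longrightarrow> g = h"
proof -
  assume "GDERIV f x :> g" "GDERIV f x :> h"
  then have "(\<lambda>v. v \<bullet> g) = (\<lambda>v. v \<bullet> h)" unfolding gderiv_def by (rule has_derivative_unique)
  then have "(g - h) \<bullet> g = (g - h) \<bullet> h" by metis
  then have "(g - h) \<bullet> (g - h) = 0" by (simp add: inner_diff_right)
  then show "g = h" by simp
qed

section \<open>Clarke criticality of the perimeter\<close>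

lemma critical_iff:
  "critical P \<longleftrightarrow> (\<exists>\<mu>. \<forall>v. ereal (\<mu> * (area_grad (rep P) \<bullet> v)) \<le> clarke_derivative perimeter (rep P) v)"
  unfolding critical_def clarke_subdifferential_def
  by (auto intro: GDERIV_area) (use GDERIV_unique_grad[OF GDERIV_area] in \<open>fastforce\<close>)

text \<open>The one-sided directional derivative: an edge that vanishes at p contributes the full
  length of its variation. As the perimeter is convex, this is its Clarke derivative. Proved below
  are the upper bound in general, which gives necessary conditions, and the lower bound when no edge
  vanishes, which makes stars critical.\<close>

definition perimeter_dir :: "complex ^ 'n \<Rightarrow> complex ^ 'n \<Rightarrow> real" where
  "perimeter_dir p v = (\<Sum>k<CARD('n). if edge p k = 0 then norm (edge v k) else (sgn (edge p k)) \<bullet> edge v k)"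

lemma norm_subgradient: "norm (b :: 'a :: real_inner) \<ge> norm a + sgn a \<bullet> (b - a)"
proof (cases "a = 0")
  case False
  have "sgn a \<bullet> b \<le> norm (sgn a) * norm b" by (rule norm_cauchy_schwarz)
  moreover have "sgn a \<bullet> a = norm a" using False by (simp add: sgn_div_norm dot_square_norm power2_eq_square)
  ultimately show ?thesis using False by (simp add: inner_diff_right norm_sgn)
qed simp

lemma tendsto_edge [tendsto_intros]:
  "(f \<longlongrightarrow> p) F \<Longrightarrow> ((\<lambda>x. edge (f x) k) \<longlongrightarrow> edge p k) F"
  unfolding edge_def vertex_def by (intro tendsto_intros)

abbreviation clarke_filter :: "'a :: topological_space \<Rightarrow> ('a \<times> real) filter" where
  "clarke_filter x \<equiv> nhds x \<times>\<^sub>F at_right 0"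

lemma clarke_filter_tendsto:
  "((\<lambda>(y, t). y + t *\<^sub>R (v :: 'a :: real_normed_vector)) \<longlongrightarrow> x) (clarke_filter x)"
  "((\<lambda>(y, t). y) \<longlongrightarrow> x) (clarke_filter x)"
proof -
  have 1: "((\<lambda>z. fst z) \<longlongrightarrow> x) (clarke_filter x)" by (rule filterlim_fst)
  have 2: "((\<lambda>z. snd z) \<longlongrightarrow> 0) (clarke_filter x)"
    by (rule filterlim_compose[OF _ filterlim_snd]) (simp add: tendsto_ident_at)
  show "((\<lambda>(y, t). y) \<longlongrightarrow> x) (clarke_filter x)" using 1 by (simp add: case_prod_unfold)
  have "((\<lambda>z. fst z + snd z *\<^sub>R v) \<longlongrightarrow> x + 0 *\<^sub>R v) (clarke_filter x)" by (intro tendsto_intros 1 2)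
  then show "((\<lambda>(y, t). y + t *\<^sub>R v) \<longlongrightarrow> x) (clarke_filter x)" by (simp add: case_prod_unfold)
qed

lemma clarke_filter_pos: "eventually (\<lambda>(y, t). t > 0) (clarke_filter x)"
  unfolding case_prod_unfold
  by (rule eventually_compose_filterlim[OF eventually_at_right_less filterlim_snd])

lemma clarke_derivative_perimeter_le:
  fixes p v :: "complex ^ 'n :: finite"
  shows "clarke_derivative perimeter p v \<le> ereal (perimeter_dir p v)"
proof -
  \<comment> \<open>Upper bound for the difference quotient: the subgradient at the far end y + t v,
    and the triangle inequality at those edges that vanish at p, where the direction of the edge has
    no limit.\<close>
  define G where "G = (\<lambda>(y, t). \<Sum>k<CARD('n).
    if edge p k = 0 then norm (edge v k) else sgn (edge (y + t *\<^sub>R v) k) \<bullet> edge v k)"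
  have lim: "(G \<longlongrightarrow> perimeter_dir p v) (clarke_filter p)"
    unfolding G_def case_prod_unfold perimeter_dir_def
  proof (intro tendsto_sum)
    fix k
    show "((\<lambda>z. if edge p k = 0 then norm (edge v k) else sgn (edge (fst z + snd z *\<^sub>R v) k) \<bullet> edge v k)
      \<longlongrightarrow> (if edge p k = 0 then norm (edge v k) else sgn (edge p k) \<bullet> edge v k)) (clarke_filter p)"
    proof (cases "edge p k = 0")
      case False
      have "((\<lambda>z. sgn (edge (fst z + snd z *\<^sub>R v) k) \<bullet> edge v k) \<longlongrightarrow> sgn (edge p k) \<bullet> edge v k) (clarke_filter p)"
        using clarke_filter_tendsto(1)[of v p] False unfolding case_prod_unfold by (intro tendsto_intros)
      then show ?thesis using False by simp
    qed simp
  qed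
  have "eventually (\<lambda>z. (case z of (y, t) \<Rightarrow> ereal ((perimeter (y + t *\<^sub>R v) - perimeter y) / t)) \<le> ereal (G z))
      (clarke_filter p)"
    using clarke_filter_pos
  proof (rule eventually_mono, clarify)
    fix y :: "complex ^ 'n" and t :: real assume t: "t > 0"
    have "norm (edge (y + t *\<^sub>R v) k) - norm (edge y k) \<le>
        t * (if edge p k = 0 then norm (edge v k) else sgn (edge (y + t *\<^sub>R v) k) \<bullet> edge v k)" for k
      using norm_triangle_ineq[of "edge y k" "t *\<^sub>R edge v k"] t
        norm_subgradient[of "edge (y + t *\<^sub>R v) k" "edge y k"] by simp
    then have "(\<Sum>k<CARD('n). norm (edge (y + t *\<^sub>R v) k) - norm (edge y k)) \<le> (\<Sum>k<CARD('n).
        t * (if edge p k = 0 then norm (edge v k) else sgn (edge (y + t *\<^sub>R v) k) \<bullet> edge v k))"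
      by (rule sum_mono)
    then have "perimeter (y + t *\<^sub>R v) - perimeter y \<le> t * G (y, t)"
      by (simp only: perimeter_edge sum_subtractf G_def sum_distrib_left case_prod_conv)
    then show "ereal ((perimeter (y + t *\<^sub>R v) - perimeter y) / t) \<le> ereal (G (y, t))"
      using t by (simp add: divide_le_eq mult.commute)
  qed
  then have "clarke_derivative perimeter p v \<le> Limsup (clarke_filter p) (\<lambda>z. ereal (G z))"
    unfolding clarke_derivative_def by (rule Limsup_mono)
  also have "\<dots> = ereal (perimeter_dir p v)"
    using lim by (intro lim_imp_Limsup) (auto simp: prod_filter_eq_bot nhds_neq_bot)
  finally show ?thesis .
qed

lemma clarke_derivative_perimeter_ge:
  fixes p v :: "complex ^ 'n :: finite"
  assumes "\<And>k. edge p k \<noteq> 0"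
  shows "ereal (perimeter_dir p v) \<le> clarke_derivative perimeter p v"
proof -
  \<comment> \<open>The subgradient at the near end y bounds the difference quotient from
    below.\<close>
  define G where "G = (\<lambda>(y :: complex ^ 'n, t :: real). \<Sum>k<CARD('n). sgn (edge y k) \<bullet> edge v k)"
  have "(G \<longlongrightarrow> (\<Sum>k<CARD('n). sgn (edge p k) \<bullet> edge v k)) (clarke_filter p)"
    unfolding G_def case_prod_unfold
    using clarke_filter_tendsto(2)[of p] assms unfolding case_prod_unfold by (intro tendsto_intros)
  then have lim: "(G \<longlongrightarrow> perimeter_dir p v) (clarke_filter p)" using assms by (simp add: perimeter_dir_def)
  have "eventually (\<lambda>z. ereal (G z) \<le> (case z of (y, t) \<Rightarrow> ereal ((perimeter (y + t *\<^sub>R v) - perimeter y) / t)))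
      (clarke_filter p)"
    using clarke_filter_pos
  proof (rule eventually_mono, clarify)
    fix y :: "complex ^ 'n" and t :: real assume t: "t > 0"
    have "t * (sgn (edge y k) \<bullet> edge v k) \<le> norm (edge (y + t *\<^sub>R v) k) - norm (edge y k)" for k
      using norm_subgradient[of "edge y k" "edge (y + t *\<^sub>R v) k"] by simp
    then have "(\<Sum>k<CARD('n). t * (sgn (edge y k) \<bullet> edge v k)) \<le>
        (\<Sum>k<CARD('n). norm (edge (y + t *\<^sub>R v) k) - norm (edge y k))"
      by (rule sum_mono)
    then have "t * G (y, t) \<le> perimeter (y + t *\<^sub>R v) - perimeter y"
      by (simp only: perimeter_edge sum_subtractf G_def sum_distrib_left case_prod_conv)
    then show "ereal (G (y, t)) \<le> ereal ((perimeter (y + t *\<^sub>R v) - perimeter y) / t)"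
      using t by (simp add: le_divide_eq mult.commute)
  qed
  then have "Limsup (clarke_filter p) (\<lambda>z. ereal (G z)) \<le> clarke_derivative perimeter p v"
    unfolding clarke_derivative_def by (rule Limsup_mono)
  moreover have "Limsup (clarke_filter p) (\<lambda>z. ereal (G z)) = ereal (perimeter_dir p v)"
    using lim by (intro lim_imp_Limsup) (auto simp: prod_filter_eq_bot nhds_neq_bot)
  ultimately show ?thesis by simp
qed

text \<open>Variation of the single vertex j. It affects only the two edges meeting there, which is
  why \<open>bump (j + 1) d\<close> is used to compare the edges j and j + 1.\<close>

definition bump :: "nat \<Rightarrow> complex \<Rightarrow> complex ^ 'n :: finite" where
  "bump j d = tuple (\<lambda>k. if k = j mod CARD('n) then d else 0)"

lemma vertex_bump: "vertex (bump j d :: complex ^ 'n :: finite) k = (if k mod CARD('n) = j mod CARD('n) then d else 0)"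
  by (simp add: bump_def vertex_tuple)

lemma inner_bump: "p \<bullet> bump j d = vertex (p :: complex ^ 'n :: finite) j \<bullet> d"
proof -
  have "p \<bullet> bump j d = (\<Sum>k<CARD('n). if k = j mod CARD('n) then vertex p j \<bullet> d else 0)"
    unfolding inner_tuple by (rule sum.cong) (simp_all add: vertex_bump)
  then show ?thesis by simp
qed

lemma edge_bump:
  assumes "CARD('n :: finite) \<ge> 2" "k < CARD('n)"
  shows "edge (bump (j + 1) d :: complex ^ 'n) (k + j) = (if k = 0 then d else if k = 1 then - d else 0)"
proof -
  have eq: "(l + j) mod CARD('n) = (j + 1) mod CARD('n) \<longleftrightarrow> l = 1" if "l \<le> CARD('n)" for l
  proof -
    have "(l + j) mod CARD('n) = (j + 1) mod CARD('n) \<longleftrightarrow>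
        (int l + int j) mod int CARD('n) = (int j + 1) mod int CARD('n)"
      by (metis of_nat_1 of_nat_add of_nat_eq_iff of_nat_mod)
    also have "\<dots> \<longleftrightarrow> int CARD('n) dvd int l - 1"
      by (simp add: mod_eq_dvd_iff)
    also have "\<dots> \<longleftrightarrow> l = 1"
    proof
      assume dvd: "int CARD('n) dvd int l - 1"
      show "l = 1"
      proof (rule ccontr)
        assume "l \<noteq> 1"
        then have "0 < \<bar>int l - 1\<bar>" "\<bar>int l - 1\<bar> < int CARD('n)" using that assms(1) by auto
        then show False using dvd zdvd_not_zless[of "\<bar>int l - 1\<bar>" "int CARD('n)"] by simp
      qed
    qed simp
    finally show ?thesis .
  qed
  have "vertex (bump (j + 1) d :: complex ^ 'n) (k + j) = (if k = 1 then d else 0)"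
    using eq[of k] assms(2) by (simp add: vertex_bump)
  moreover have "vertex (bump (j + 1) d :: complex ^ 'n) (k + j + 1) = (if k = 0 then d else 0)"
    using eq[of "k + 1"] assms(2) by (simp add: vertex_bump)
  ultimately show ?thesis by (simp add: edge_def)
qed

lemma sum_edge_bump:
  fixes F :: "nat \<Rightarrow> complex \<Rightarrow> real"
  assumes "CARD('n :: finite) \<ge> 2" "\<And>k. F (k + CARD('n)) = F k" "\<And>k. F k 0 = 0"
  shows "(\<Sum>k<CARD('n). F k (edge (bump (j + 1) d :: complex ^ 'n) k)) = F j d + F (j + 1) (- d)"
proof -
  let ?v = "bump (j + 1) d :: complex ^ 'n"
  obtain m where m: "CARD('n) = Suc (Suc m)" using assms(1) by (metis add_2_eq_Suc le_Suc_ex)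
  have "(\<Sum>k<CARD('n). F k (edge ?v k)) = (\<Sum>k<CARD('n). F (k + j) (edge ?v (k + j)))"
    by (rule cyclic_sum_shift_add[symmetric]) (simp add: assms(2))
  also have "\<dots> = (\<Sum>k<CARD('n). F (k + j) (if k = 0 then d else if k = 1 then - d else 0))"
    using edge_bump[OF assms(1), of _ j d] by (intro sum.cong) auto
  also have "\<dots> = F j d + F (j + 1) (- d)"
    unfolding m by (simp only: sum.lessThan_Suc_shift) (simp add: assms(3))
  finally show ?thesis .
qed

lemma perimeter_dir_bump:
  fixes p :: "complex ^ 'n :: finite"
  assumes "CARD('n) \<ge> 2"
  shows "perimeter_dir p (bump (j + 1) d) =
    (if edge p j = 0 then norm d else sgn (edge p j) \<bullet> d) +
    (if edge p (j + 1) = 0 then norm d else - (sgn (edge p (j + 1)) \<bullet> d))"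
  unfolding perimeter_dir_def
  by (subst sum_edge_bump[OF assms, of "\<lambda>k x. if edge p k = 0 then norm x else sgn (edge p k) \<bullet> x"]) auto

lemma critical_edges_nonzero:
  fixes p :: "complex ^ 'n :: finite"
  assumes n: "CARD('n) \<ge> 2" and p: "p \<in> nonconst_tuples"
    and crit: "\<And>v. \<mu> * (area_grad p \<bullet> v) \<le> perimeter_dir p v"
  shows "\<mu> \<noteq> 0" and "edge p k \<noteq> 0"
proof -
  obtain k1 where k1: "edge p k1 \<noteq> 0" using p by (auto simp: nonconst_iff_edge edge_def)
  show "\<mu> \<noteq> 0"
  proof
    assume "\<mu> = 0"
    \<comment> \<open>Test with v = - p: shrinking the polygon decreases the perimeter at the rate
      \<open>perimeter p\<close>.\<close>
    then have "0 \<le> perimeter_dir p (- p)" using crit[of "- p"] by simp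
    also have "perimeter_dir p (- p) = - perimeter p"
      unfolding perimeter_dir_def perimeter_edge sum_negf[symmetric]
      by (intro sum.cong) (auto simp: sgn_div_norm dot_square_norm power2_eq_square)
    finally have "perimeter p \<le> 0" by simp
    then have "(\<Sum>k<CARD('n). norm (edge p k)) = 0"
      unfolding perimeter_edge by (intro antisym sum_nonneg) auto
    then have "\<forall>k<CARD('n). edge p k = 0" by (simp add: sum_nonneg_eq_0_iff)
    moreover have "edge p (k1 mod CARD('n)) = edge p k1"
      unfolding edge_def by (metis mod_add_left_eq vertex_mod)
    ultimately show False using k1 by (metis mod_less_divisor zero_less_card_finite)
  qed
  show "edge p k \<noteq> 0"
  proof
    assume 0: "edge p k = 0"
    have "\<exists>j. edge p j \<noteq> 0 \<and> edge p (j + 1) = 0"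
    proof (rule ccontr)
      assume "\<nexists>j. edge p j \<noteq> 0 \<and> edge p (j + 1) = 0"
      then have "edge p (k1 + i) \<noteq> 0" for i by (induction i) (use k1 in auto)
      moreover have "edge p (k + m * CARD('n)) = edge p k" for m
      proof (induction m)
        case (Suc m)
        then show ?case using edge_add_card[of p "k + m * CARD('n)"] by (simp add: add_ac)
      qed simp
      \<comment> \<open>The edge \<open>k + k1 * CARD('n)\<close> is edge k again, at an index not
        before k1, so propagation from k1 reaches it.\<close>
      moreover have "k1 + (k + k1 * CARD('n) - k1) = k + k1 * CARD('n)"
        by (rule le_add_diff_inverse) (simp add: trans_le_add2)
      ultimately show False using 0 by metis
    qed
    then obtain j where j: "edge p j \<noteq> 0" "edge p (j + 1) = 0" by blast
    define e where "e = edge p j"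
    \<comment> \<open>The residual of the Lagrange equation at vertex j + 1, where only the nonzero
      edge e has a direction. Moving along it, criticality forces |d| <= 1. But d is the sum of the
      perpendicular vectors \<open>- sgn e\<close> and a multiple of \<open>\<i> * e\<close>, so
      |d|^2 = 1 + (\<mu> |e| / 2)^2 > 1.\<close>
    define d where "d = - (\<i> * of_real \<mu> / 2) * e - sgn e"
    have "\<mu> * ((- (\<i> / 2) * e) \<bullet> d) \<le> sgn e \<bullet> d + norm d"
      using crit[of "bump (j + 1) d"] j unfolding inner_bump perimeter_dir_bump[OF n] vertex_area_grad e_def by simp
    then have "d \<bullet> d \<le> norm d"
      unfolding d_def by (simp add: inner_complex_def algebra_simps)
    then have "norm d * norm d \<le> norm d" by (simp add: dot_square_norm power2_eq_square)
    then have "norm d \<le> 1" by (cases "norm d = 0") auto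
    moreover have "norm d > 1"
    proof -
      have e: "e = of_real (cmod e) * sgn e" using j by (simp add: e_def sgn_eq)
      have "d = - (Complex 1 (\<mu> * cmod e / 2)) * sgn e"
        unfolding d_def by (subst e) (simp add: complex_eq_iff algebra_simps)
      moreover have "cmod (sgn e) = 1" using j by (simp add: e_def norm_sgn)
      ultimately have "norm d = cmod (Complex 1 (\<mu> * cmod e / 2))" by (simp add: norm_mult)
      also have "\<dots> > 1"
        using \<open>\<mu> \<noteq> 0\<close> j by (simp add: complex_norm e_def real_less_rsqrt)
      finally show ?thesis .
    qed
    ultimately show False by simp
  qed
qed

text \<open>Without zero edges the first-order inequality is linear in the variation and hence an
  equation at every vertex. Sorted by edges it reads sgn e_j (1 + i \<mu> |e_j| / 2) = sgn e_(j+1)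
  (1 - i \<mu> |e_(j+1)| / 2). Moduli show that all lengths agree; then consecutive edges differ by
  the fixed factor (1 + i \<mu> l / 2) / (1 - i \<mu> l / 2).\<close>

lemma critical_imp_shift_similar:
  fixes p :: "complex ^ 'n :: finite"
  assumes n: "CARD('n) \<ge> 2" and p: "p \<in> nonconst_tuples"
    and crit: "\<And>v. \<mu> * (area_grad p \<bullet> v) \<le> perimeter_dir p v"
  obtains u b where "\<And>k. vertex p (k + 1) = u * vertex p k + b"
proof -
  have mu: "\<mu> \<noteq> 0" and nz: "\<And>k. edge p k \<noteq> 0" using critical_edges_nonzero[OF n p crit] by auto
  have rel: "sgn (edge p j) * Complex 1 (\<mu> * cmod (edge p j) / 2) =
      sgn (edge p (j + 1)) * Complex 1 (- (\<mu> * cmod (edge p (j + 1)) / 2))" for j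
  proof -
    have le: "\<mu> * ((- (\<i> / 2) * (edge p (j + 1) + edge p j)) \<bullet> d) \<le> (sgn (edge p j) - sgn (edge p (j + 1))) \<bullet> d" for d
      using crit[of "bump (j + 1) d"] nz
      unfolding inner_bump perimeter_dir_bump[OF n] vertex_area_grad inner_diff_left by simp
    \<comment> \<open>The residual of the Lagrange equation at vertex j + 1. Its product with every
      d is nonpositive; d = x makes it vanish.\<close>
    define x where "x = of_real \<mu> * (- (\<i> / 2) * (edge p (j + 1) + edge p j)) - (sgn (edge p j) - sgn (edge p (j + 1)))"
    have "x \<bullet> d \<le> 0" for d
      using le[of d] unfolding x_def by (simp add: inner_diff_left inner_mult_left)
         (simp add: inner_complex_def algebra_simps)
    from this[of x] have "x \<bullet> x = 0" by (intro antisym) auto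
    then have "x = 0" by simp
    then have eq: "of_real \<mu> * (- (\<i> / 2) * (edge p (j + 1) + edge p j)) = sgn (edge p j) - sgn (edge p (j + 1))"
      by (simp add: x_def)
    have e: "edge p k = of_real (cmod (edge p k)) * sgn (edge p k)" for k using nz[of k] by (simp add: sgn_eq)
    have C: "Complex 1 r = 1 + \<i> * of_real r" for r by (simp add: complex_eq_iff)
    have "of_real \<mu> * (- (\<i> / 2) * (of_real (cmod (edge p (j + 1))) * sgn (edge p (j + 1)) +
        of_real (cmod (edge p j)) * sgn (edge p j))) = sgn (edge p j) - sgn (edge p (j + 1))"
      using eq e[of j] e[of "j + 1"] by metis
    then show ?thesis unfolding C by (simp add: algebra_simps add_divide_distrib)
  qed
  define l where "l = cmod (edge p 0)"
  have step: "cmod (edge p (j + 1)) = cmod (edge p j)" for j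
  proof -
    have "cmod (sgn (edge p j) * Complex 1 (\<mu> * cmod (edge p j) / 2)) =
        cmod (sgn (edge p (j + 1)) * Complex 1 (- (\<mu> * cmod (edge p (j + 1)) / 2)))" by (simp only: rel)
    then have "1 + (\<mu> * cmod (edge p j) / 2)\<^sup>2 = 1 + (\<mu> * cmod (edge p (j + 1)) / 2)\<^sup>2"
      using nz[of j] nz[of "j + 1"] by (simp add: norm_mult norm_sgn complex_norm)
    then have "(cmod (edge p j))\<^sup>2 = (cmod (edge p (j + 1)))\<^sup>2" using mu by (simp add: power_mult_distrib power_divide)
    then show ?thesis by simp
  qed
  have len: "cmod (edge p j) = l" for j by (induction j) (use step in \<open>auto simp: l_def\<close>)
  define u where "u = Complex 1 (\<mu> * l / 2) / Complex 1 (- (\<mu> * l / 2))"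
  have nzC: "Complex 1 r \<noteq> 0" for r by (simp add: complex_eq_iff)
  have "edge p (j + 1) = u * edge p j" for j
  proof -
    have e: "edge p k = of_real l * sgn (edge p k)" for k using nz[of k] len[of k] by (auto simp: sgn_eq)
    have "sgn (edge p (j + 1)) = u * sgn (edge p j)"
      using rel[of j] nzC[of "- (\<mu> * l / 2)"] unfolding len u_def by (simp add: field_simps)
    then show ?thesis by (subst (1 2) e) simp
  qed
  then have "vertex p (j + 2) - u * vertex p (j + 1) = vertex p (j + 1) - u * vertex p j" for j
    by (simp add: edge_def algebra_simps)
  then have "vertex p (j + 1) - u * vertex p j = vertex p 1 - u * vertex p 0" for j
    by (induction j) (simp_all add: numeral_2_eq_2)
  then have "vertex p (j + 1) = u * vertex p j + (vertex p 1 - u * vertex p 0)" for j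
    by (metis add.commute diff_add_cancel)
  then show ?thesis by (rule that)
qed

lemma sum_by_parts_cyclic:
  fixes p v :: "complex ^ 'n :: finite"
  assumes "\<And>k. f (k + CARD('n)) = f k"
  shows "(\<Sum>k<CARD('n). f k \<bullet> edge v k) = (\<Sum>k<CARD('n). (f k - f (k + 1)) \<bullet> vertex v (k + 1))"
proof -
  have "(\<Sum>k<CARD('n). f (k + 1) \<bullet> vertex v (k + 1)) = (\<Sum>k<CARD('n). f k \<bullet> vertex v k)"
    using assms[of 0] vertex_add_card(1)[of v 0] by (intro cyclic_sum_shift) simp
  then show ?thesis by (simp add: edge_def inner_diff_left inner_diff_right sum_subtractf)
qed

section \<open>Twice differentiable functions and the Hessian in a chart\<close>

text \<open>\<open>C2_nearI\<close> and \<open>C2_nearE\<close> below reduce \<open>C2_near\<close>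
  to a derivative that is \<open>C1_near\<close>; each closure rule for twice differentiable
  functions then follows from the rules for one derivative less.\<close>

definition C1_near :: "('a :: real_normed_vector \<Rightarrow> 'b :: real_normed_vector) \<Rightarrow> 'a \<Rightarrow> bool" where
  "C1_near f x \<longleftrightarrow>
     (\<exists>f'. \<forall>\<^sub>F y in nhds x. (f has_derivative blinfun_apply (f' y)) (at y) \<and> isCont f' y)"

lemma C2_nearI:
  assumes "\<forall>\<^sub>F y in nhds x. (f has_derivative blinfun_apply (f' y)) (at y)" "C1_near f' x"
  shows "C2_near f x"
proof -
  obtain f'' where "\<forall>\<^sub>F y in nhds x. (f' has_derivative blinfun_apply (f'' y)) (at y) \<and> isCont f'' y"
    using assms(2) by (auto simp: C1_near_def)
  with assms(1) have "\<forall>\<^sub>F y in nhds x. (f has_derivative blinfun_apply (f' y)) (at y) \<and>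
      (f' has_derivative blinfun_apply (f'' y)) (at y) \<and> isCont f'' y"
    by eventually_elim auto
  then obtain U where U: "open U" "x \<in> U" "\<And>y. y \<in> U \<Longrightarrow> (f has_derivative blinfun_apply (f' y)) (at y) \<and>
      (f' has_derivative blinfun_apply (f'' y)) (at y) \<and> isCont f'' y"
    unfolding eventually_nhds by blast
  then have "continuous_on U f''" by (simp add: continuous_at_imp_continuous_on)
  then show ?thesis unfolding C2_near_def using U by blast
qed

lemma C2_nearE:
  assumes "C2_near f x"
  obtains f' where "\<forall>\<^sub>F y in nhds x. (f has_derivative blinfun_apply (f' y)) (at y)" "C1_near f' x"
proof -
  obtain U f' f'' where U: "open U" "x \<in> U"
    "\<And>y. y \<in> U \<Longrightarrow> (f has_derivative blinfun_apply (f' y)) (at y)"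
    "\<And>y. y \<in> U \<Longrightarrow> (f' has_derivative blinfun_apply (f'' y)) (at y)"
    "continuous_on U f''"
    using assms unfolding C2_near_def by blast
  have ev: "\<forall>\<^sub>F y in nhds x. y \<in> U" by (rule eventually_nhds_in_open[OF U(1,2)])
  have "\<forall>\<^sub>F y in nhds x. (f has_derivative blinfun_apply (f' y)) (at y)"
    using ev by eventually_elim (rule U)
  moreover have "C1_near f' x"
    unfolding C1_near_def
  proof (rule exI[of _ f''], use ev in eventually_elim)
    fix y assume "y \<in> U"
    then show "(f' has_derivative blinfun_apply (f'' y)) (at y) \<and> isCont f'' y"
      using U by (simp add: continuous_on_eq_continuous_at)
  qed
  ultimately show ?thesis by (rule that)
qed

lemma C1_near_imp_isCont: "C1_near f x \<Longrightarrow> \<forall>\<^sub>F y in nhds x. isCont f y"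
  unfolding C1_near_def by (auto elim!: eventually_mono dest: has_derivative_continuous)

lemma C2_near_imp_C1_near: "C2_near f x \<Longrightarrow> C1_near f x"
proof -
  assume "C2_near f x"
  then obtain f' where f': "\<forall>\<^sub>F y in nhds x. (f has_derivative blinfun_apply (f' y)) (at y)" "C1_near f' x"
    by (rule C2_nearE)
  have "\<forall>\<^sub>F y in nhds x. (f has_derivative blinfun_apply (f' y)) (at y) \<and> isCont f' y"
    using f'(1) C1_near_imp_isCont[OF f'(2)] by eventually_elim auto
  then show ?thesis unfolding C1_near_def by blast
qed

lemma C1_near_linear_compose:
  assumes L: "bounded_linear L" and f: "C1_near f x"
  shows "C1_near (\<lambda>y. L (f y)) x"
proof -
  obtain f' where f': "\<forall>\<^sub>F y in nhds x. (f has_derivative blinfun_apply (f' y)) (at y) \<and> isCont f' y"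
    using f by (auto simp: C1_near_def)
  show ?thesis
    unfolding C1_near_def
  proof (rule exI[of _ "\<lambda>y. Blinfun L o\<^sub>L f' y"], use f' in eventually_elim)
    case (elim y)
    have "((\<lambda>y. L (f y)) has_derivative (\<lambda>h. L (f' y h))) (at y)"
      using elim by (intro bounded_linear.has_derivative[OF L]) auto
    moreover have "isCont (\<lambda>y. Blinfun L o\<^sub>L f' y) y"
      using elim by (intro continuous_intros) auto
    moreover have "blinfun_apply (Blinfun L o\<^sub>L f' y) = (\<lambda>h. L (f' y h))"
      by (simp add: fun_eq_iff bounded_linear_Blinfun_apply[OF L])
    ultimately show ?case by simp
  qed
qed

lemma C1_near_const: "C1_near (\<lambda>_. c) x"
  unfolding C1_near_def by (rule exI[of _ "\<lambda>_. 0"]) (auto simp: zero_blinfun.rep_eq)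

lemma C1_near_add:
  assumes "C1_near f x" "C1_near g x"
  shows "C1_near (\<lambda>y. f y + g y) x"
proof -
  obtain f' where f': "\<forall>\<^sub>F y in nhds x. (f has_derivative blinfun_apply (f' y)) (at y) \<and> isCont f' y"
    using assms by (auto simp: C1_near_def)
  obtain g' where g': "\<forall>\<^sub>F y in nhds x. (g has_derivative blinfun_apply (g' y)) (at y) \<and> isCont g' y"
    using assms by (auto simp: C1_near_def)
  show ?thesis
    unfolding C1_near_def
  proof (rule exI[of _ "\<lambda>y. f' y + g' y"], use f' g' in eventually_elim)
    case (elim y)
    have "((\<lambda>y. f y + g y) has_derivative (\<lambda>h. f' y h + g' y h)) (at y)"
      using elim by (intro has_derivative_add) auto
    moreover have "blinfun_apply (f' y + g' y) = (\<lambda>h. f' y h + g' y h)"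
      by (simp add: fun_eq_iff blinfun.add_left)
    ultimately show ?case using elim by (auto intro: continuous_intros)
  qed
qed

lemma bilinear_deriv_blinfun:
  assumes B: "bounded_bilinear B"
  shows "blinfun_apply ((bounded_bilinear.prod_right B a o\<^sub>L G) + (bounded_bilinear.prod_left B b o\<^sub>L F)) =
    (\<lambda>h. B a (G h) + B (F h) b)"
proof -
  interpret bounded_bilinear B by fact
  show ?thesis by (simp add: fun_eq_iff blinfun.add_left prod_right.rep_eq prod_left.rep_eq)
qed

lemma C1_near_bilinear:
  assumes B: "bounded_bilinear B" and f: "C1_near f x" and g: "C1_near g x"
  shows "C1_near (\<lambda>y. B (f y) (g y)) x"
proof -
  interpret bounded_bilinear B by fact
  obtain f' where f': "\<forall>\<^sub>F y in nhds x. (f has_derivative blinfun_apply (f' y)) (at y) \<and> isCont f' y"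
    using f by (auto simp: C1_near_def)
  obtain g' where g': "\<forall>\<^sub>F y in nhds x. (g has_derivative blinfun_apply (g' y)) (at y) \<and> isCont g' y"
    using g by (auto simp: C1_near_def)
  show ?thesis
    unfolding C1_near_def
  proof (rule exI[of _ "\<lambda>y. (prod_right (f y) o\<^sub>L g' y) + (prod_left (g y) o\<^sub>L f' y)"],
      use f' g' C1_near_imp_isCont[OF f] C1_near_imp_isCont[OF g] in eventually_elim)
    case (elim y)
    have "((\<lambda>y. B (f y) (g y)) has_derivative (\<lambda>h. B (f y) (g' y h) + B (f' y h) (g y))) (at y)"
      using elim by (intro FDERIV) auto
    moreover have "isCont (\<lambda>y. (prod_right (f y) o\<^sub>L g' y) + (prod_left (g y) o\<^sub>L f' y)) y"
      using elim
      by (intro continuous_intros bounded_linear.isCont[OF bounded_linear_prod_right]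
          bounded_linear.isCont[OF bounded_linear_prod_left]) auto
    ultimately show ?case by (simp add: bilinear_deriv_blinfun[OF B])
  qed
qed

lemma C2_near_bilinear:
  assumes B: "bounded_bilinear B" and f: "C2_near f x" and g: "C2_near g x"
  shows "C2_near (\<lambda>y. B (f y) (g y)) x"
proof -
  interpret bounded_bilinear B by fact
  obtain f' where f': "\<forall>\<^sub>F y in nhds x. (f has_derivative blinfun_apply (f' y)) (at y)" "C1_near f' x"
    using f by (rule C2_nearE)
  obtain g' where g': "\<forall>\<^sub>F y in nhds x. (g has_derivative blinfun_apply (g' y)) (at y)" "C1_near g' x"
    using g by (rule C2_nearE)
  show ?thesis
  proof (rule C2_nearI)
    show "\<forall>\<^sub>F y in nhds x. ((\<lambda>y. B (f y) (g y)) has_derivative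
        blinfun_apply ((prod_right (f y) o\<^sub>L g' y) + (prod_left (g y) o\<^sub>L f' y))) (at y)"
      using f'(1) g'(1) unfolding bilinear_deriv_blinfun[OF B] by eventually_elim (rule FDERIV)
    show "C1_near (\<lambda>y. (prod_right (f y) o\<^sub>L g' y) + (prod_left (g y) o\<^sub>L f' y)) x"
      by (intro C1_near_add C1_near_bilinear[OF bounded_bilinear_blinfun_compose]
          C1_near_linear_compose[OF bounded_linear_prod_right] C1_near_linear_compose[OF bounded_linear_prod_left]
          C2_near_imp_C1_near f g f' g')
  qed
qed

lemma C2_near_linear_compose:
  assumes L: "bounded_linear L" and f: "C2_near f x"
  shows "C2_near (\<lambda>y. L (f y)) x"
proof -
  obtain f' where f': "\<forall>\<^sub>F y in nhds x. (f has_derivative blinfun_apply (f' y)) (at y)" "C1_near f' x"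
    using f by (rule C2_nearE)
  have bl: "bounded_linear (\<lambda>F. Blinfun L o\<^sub>L F)"
    by (rule bounded_bilinear.bounded_linear_right[OF bounded_bilinear_blinfun_compose])
  show ?thesis
  proof (rule C2_nearI)
    show "\<forall>\<^sub>F y in nhds x. ((\<lambda>y. L (f y)) has_derivative blinfun_apply (Blinfun L o\<^sub>L f' y)) (at y)"
      using f'(1)
    proof eventually_elim
      case (elim y)
      have "blinfun_apply (Blinfun L o\<^sub>L f' y) = (\<lambda>h. L (f' y h))"
        by (simp add: fun_eq_iff bounded_linear_Blinfun_apply[OF L])
      then show ?case using bounded_linear.has_derivative[OF L elim] by simp
    qed
    show "C1_near (\<lambda>y. Blinfun L o\<^sub>L f' y) x" by (rule C1_near_linear_compose[OF bl f'(2)])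
  qed
qed

lemma C2_near_const: "C2_near (\<lambda>_. c) x"
  by (rule C2_nearI[where f' = "\<lambda>_. 0"]) (auto simp: zero_blinfun.rep_eq C1_near_const)

lemma C2_near_add:
  assumes f: "C2_near f x" and g: "C2_near g x"
  shows "C2_near (\<lambda>y. f y + g y) x"
proof -
  obtain f' where f': "\<forall>\<^sub>F y in nhds x. (f has_derivative blinfun_apply (f' y)) (at y)" "C1_near f' x"
    using f by (rule C2_nearE)
  obtain g' where g': "\<forall>\<^sub>F y in nhds x. (g has_derivative blinfun_apply (g' y)) (at y)" "C1_near g' x"
    using g by (rule C2_nearE)
  show ?thesis
  proof (rule C2_nearI)
    show "\<forall>\<^sub>F y in nhds x. ((\<lambda>y. f y + g y) has_derivative blinfun_apply (f' y + g' y)) (at y)"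
      using f'(1) g'(1)
    proof eventually_elim
      case (elim y)
      have "blinfun_apply (f' y + g' y) = (\<lambda>h. f' y h + g' y h)"
        by (simp add: fun_eq_iff blinfun.add_left)
      then show ?case using has_derivative_add[OF elim] by simp
    qed
    show "C1_near (\<lambda>y. f' y + g' y) x" by (rule C1_near_add[OF f'(2) g'(2)])
  qed
qed

lemma C2_near_sum: "(\<And>i. i \<in> I \<Longrightarrow> C2_near (f i) x) \<Longrightarrow> C2_near (\<lambda>y. \<Sum>i\<in>I. f i y) x"
  by (induction I rule: infinite_finite_induct) (auto intro: C2_near_const C2_near_add)

lemma C2_near_id: "C2_near (\<lambda>y. y) x"
  by (rule C2_nearI[where f' = "\<lambda>_. id_blinfun"]) (auto simp: C1_near_const id_blinfun.rep_eq)

text \<open>Functions of one real variable suffice as outer functions: the square root for lengths,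
  and the square root and the inverse for the scaling factors of the charts.\<close>

lemma C1_near_compose_real:
  fixes h :: "real \<Rightarrow> real"
  assumes g: "C1_near g x"
    and h: "\<forall>\<^sub>F r in nhds (g x). (h has_real_derivative h' r) (at r) \<and> isCont h' r"
  shows "C1_near (\<lambda>y. h (g y)) x"
proof -
  obtain g' where g': "\<forall>\<^sub>F y in nhds x. (g has_derivative blinfun_apply (g' y)) (at y) \<and> isCont g' y"
    using g by (auto simp: C1_near_def)
  have "isCont g x" using C1_near_imp_isCont[OF g] by (rule eventually_nhds_x_imp_x)
  then have "filterlim g (nhds (g x)) (nhds x)" by (simp add: continuous_at tendsto_at_iff_tendsto_nhds)
  then have ev: "\<forall>\<^sub>F y in nhds x. (h has_real_derivative h' (g y)) (at (g y)) \<and> isCont h' (g y)"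
    by (rule eventually_compose_filterlim[OF h])
  show ?thesis
    unfolding C1_near_def
  proof (intro exI[of _ "\<lambda>y. h' (g y) *\<^sub>R g' y"], use ev g' C1_near_imp_isCont[OF g] in eventually_elim)
    case (elim y)
    have "((\<lambda>y. h (g y)) has_derivative (\<lambda>v. h' (g y) * g' y v)) (at y)"
      using elim has_derivative_compose[of g "g' y" y UNIV h "(*) (h' (g y))"] by (simp add: has_field_derivative_def)
    moreover have "blinfun_apply (h' (g y) *\<^sub>R g' y) = (\<lambda>v. h' (g y) * g' y v)"
      by (simp add: fun_eq_iff blinfun.scaleR_left)
    moreover have "isCont (\<lambda>y. h' (g y)) y" using elim by (auto intro: isCont_o2)
    ultimately show ?case using elim by (auto intro!: continuous_intros)
  qed
qed

lemma C2_near_compose_real: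
  fixes h :: "real \<Rightarrow> real"
  assumes g: "C2_near g x"
    and h: "\<forall>\<^sub>F r in nhds (g x). (h has_real_derivative h' r) (at r) \<and> (h' has_real_derivative h'' r) (at r) \<and> isCont h'' r"
  shows "C2_near (\<lambda>y. h (g y)) x"
proof -
  obtain g' where g': "\<forall>\<^sub>F y in nhds x. (g has_derivative blinfun_apply (g' y)) (at y)" "C1_near g' x"
    using g by (rule C2_nearE)
  have C1: "C1_near g x" using g by (rule C2_near_imp_C1_near)
  have "isCont g x" using C1_near_imp_isCont[OF C1] by (rule eventually_nhds_x_imp_x)
  then have "filterlim g (nhds (g x)) (nhds x)" by (simp add: continuous_at tendsto_at_iff_tendsto_nhds)
  then have ev: "\<forall>\<^sub>F y in nhds x. (h has_real_derivative h' (g y)) (at (g y))"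
    by (rule eventually_compose_filterlim[rotated]) (use h in \<open>auto elim: eventually_mono\<close>)
  show ?thesis
  proof (rule C2_nearI)
    show "\<forall>\<^sub>F y in nhds x. ((\<lambda>y. h (g y)) has_derivative blinfun_apply (h' (g y) *\<^sub>R g' y)) (at y)"
      using ev g'(1)
    proof eventually_elim
      case (elim y)
      have "((\<lambda>y. h (g y)) has_derivative (\<lambda>v. h' (g y) * g' y v)) (at y)"
        using elim has_derivative_compose[of g "g' y" y UNIV h "(*) (h' (g y))"] by (simp add: has_field_derivative_def)
      moreover have "blinfun_apply (h' (g y) *\<^sub>R g' y) = (\<lambda>v. h' (g y) * g' y v)"
        by (simp add: fun_eq_iff blinfun.scaleR_left)
      ultimately show ?case by simp
    qed
    have "C1_near (\<lambda>y. h' (g y)) x"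
      by (rule C1_near_compose_real[OF C1, of h' h'']) (use h in \<open>auto elim: eventually_mono\<close>)
    then show "C1_near (\<lambda>y. h' (g y) *\<^sub>R g' y) x"
      by (rule C1_near_bilinear[OF bounded_bilinear_scaleR _ g'(2)])
  qed
qed

lemma C2_near_sqrt:
  assumes "C2_near g x" "g x > 0"
  shows "C2_near (\<lambda>y. sqrt (g y)) x"
proof (rule C2_near_compose_real[OF assms(1)])
  have "\<forall>\<^sub>F r in nhds (g x). r > 0" using assms(2) by (intro eventually_nhds_in_open[of "{0<..}", simplified]) auto
  then show "\<forall>\<^sub>F r in nhds (g x). (sqrt has_real_derivative inverse (sqrt r) / 2) (at r) \<and>
      ((\<lambda>r. inverse (sqrt r) / 2) has_real_derivative - ((inverse (sqrt r)) ^ 3) / 4) (at r) \<and>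
      isCont (\<lambda>r. - ((inverse (sqrt r)) ^ 3) / 4) r"
  proof eventually_elim
    case (elim r)
    have "((\<lambda>r. inverse (sqrt r) / 2) has_real_derivative - ((inverse (sqrt r)) ^ 3) / 4) (at r)"
      using elim by (auto intro!: derivative_eq_intros simp: field_simps power2_eq_square power3_eq_cube)
    moreover have "isCont (\<lambda>r. - ((inverse (sqrt r)) ^ 3) / 4) r"
      using elim by (intro continuous_intros) auto
    ultimately show ?case using DERIV_real_sqrt[OF elim] by simp
  qed
qed

lemma C2_near_inverse:
  assumes "C2_near g x" "g x \<noteq> (0 :: real)"
  shows "C2_near (\<lambda>y. inverse (g y)) x"
proof (rule C2_near_compose_real[OF assms(1)])
  have "\<forall>\<^sub>F r in nhds (g x). r \<noteq> 0" using assms(2) by (rule eventually_neq_at_within[of _ _ UNIV, simplified] t1_space_nhds)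
  then show "\<forall>\<^sub>F r in nhds (g x). (inverse has_real_derivative - ((inverse r)\<^sup>2)) (at r) \<and>
      ((\<lambda>r. - ((inverse r)\<^sup>2)) has_real_derivative 2 * (inverse r) ^ 3) (at r) \<and>
      isCont (\<lambda>r. 2 * (inverse r) ^ 3) r"
  proof eventually_elim
    case (elim r)
    have "(inverse has_real_derivative - ((inverse r)\<^sup>2)) (at r)"
      using elim DERIV_inverse[of r] by (simp add: power2_eq_square)
    moreover have "((\<lambda>r. - ((inverse r)\<^sup>2)) has_real_derivative 2 * (inverse r) ^ 3) (at r)"
      using elim by (auto intro!: derivative_eq_intros simp: field_simps power2_eq_square power3_eq_cube)
    moreover have "isCont (\<lambda>r. 2 * (inverse r) ^ 3) r"
      using elim by (intro continuous_intros) auto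
    ultimately show ?case by simp
  qed
qed

lemma C2_near_norm:
  fixes f :: "'a :: real_normed_vector \<Rightarrow> 'b :: real_inner"
  assumes "C2_near f x" "f x \<noteq> 0"
  shows "C2_near (\<lambda>y. norm (f y)) x"
  unfolding norm_eq_sqrt_inner
  by (intro C2_near_sqrt C2_near_bilinear[OF bounded_bilinear_inner] assms) (use assms(2) in simp)

section \<open>Gradient and Hessian in a chart of a hypersurface\<close>

definition riesz :: "('a :: euclidean_space \<Rightarrow> real) \<Rightarrow> 'a" where
  "riesz l = (\<Sum>b\<in>Basis. l b *\<^sub>R b)"

lemma inner_riesz:
  assumes "linear l"
  shows "riesz l \<bullet> w = l w"
proof -
  have "riesz l \<bullet> w = (\<Sum>b\<in>Basis. l ((w \<bullet> b) *\<^sub>R b))"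
    using assms by (simp add: riesz_def inner_sum_left linear_scale inner_commute[of w] mult.commute)
  also have "\<dots> = l w"
    using linear_sum[OF assms, of "\<lambda>b. (w \<bullet> b) *\<^sub>R b" Basis] by (simp add: euclidean_representation)
  finally show ?thesis .
qed

lemma C2_near_has_grad_hessian:
  fixes f :: "'a :: euclidean_space \<Rightarrow> real"
  assumes "C2_near f x"
  shows "\<exists>g0 H. has_grad_hessian f x g0 H"
proof -
  obtain f' where f': "\<forall>\<^sub>F y in nhds x. (f has_derivative blinfun_apply (f' y)) (at y)" "C1_near f' x"
    using assms by (rule C2_nearE)
  define g where "g y = riesz (blinfun_apply (f' y))" for y
  have "\<forall>\<^sub>F y in nhds x. GDERIV f y :> g y"
    using f'(1)
  proof eventually_elim
    case (elim y)
    have "blinfun_apply (f' y) = (\<lambda>h. h \<bullet> g y)"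
      using inner_riesz[OF bounded_linear.linear[OF blinfun.bounded_linear_right], of "f' y"]
      by (simp add: g_def fun_eq_iff inner_commute)
    then show ?case using elim by (simp add: gderiv_def)
  qed
  moreover obtain f'' where "\<forall>\<^sub>F y in nhds x. (f' has_derivative blinfun_apply (f'' y)) (at y) \<and> isCont f'' y"
    using f'(2) by (auto simp: C1_near_def)
  then have "(f' has_derivative blinfun_apply (f'' x)) (at x)"
    by (metis (mono_tags, lifting) eventually_nhds_x_imp_x)
  then have "(g has_derivative (\<lambda>h. riesz (blinfun_apply (f'' x h)))) (at x)"
    unfolding g_def riesz_def
    by (intro has_derivative_sum bounded_linear.has_derivative[OF bounded_linear_scaleR_left]
        bounded_linear.has_derivative[OF blinfun.bounded_linear_left])
  ultimately show ?thesis unfolding has_grad_hessian_def by blast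
qed

lemma tendsto_scaleR_nhds_0: "filterlim (\<lambda>t. t *\<^sub>R (v :: 'a :: real_normed_vector)) (nhds 0) (nhds 0)"
proof -
  have "((\<lambda>t. t *\<^sub>R v) \<longlongrightarrow> 0 *\<^sub>R v) (nhds 0)" by (intro tendsto_scaleR tendsto_const filterlim_ident)
  then show ?thesis by simp
qed

lemma has_derivative_cong_nhds:
  assumes "(f has_derivative f') (at x)" "\<forall>\<^sub>F y in nhds x. f y = g y"
  shows "(g has_derivative f') (at x)"
proof (rule has_derivative_transform_eventually[OF assms(1)])
  show "\<forall>\<^sub>F y in at x. f y = g y" using assms(2) by (auto simp: eventually_at_filter elim: eventually_mono)
  show "f x = g x" using assms(2) by (rule eventually_nhds_x_imp_x)
qed simp

text \<open>On V the chart stays in the level set of F, so f and the Lagrangian L pulled back by it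
  differ there by the constant \<open>c * F p\<close> and have the same derivatives along V. The
  identity is stated on the line through v so that it can be differentiated once more at t =
  0.\<close>

lemma chart_gradient:
  fixes \<phi> :: "complex ^ 'n :: finite \<Rightarrow> complex ^ 'n"
  assumes chart: "local_chart F p V \<phi>"
    and L: "\<forall>\<^sub>F y in nhds p. GDERIV L y :> gL y"
    and f: "\<And>y. f y = L y + c * F y"
    and g: "\<forall>\<^sub>F y in nhds 0. GDERIV (f \<circ> \<phi>) y :> g y"
    and \<phi>': "\<forall>\<^sub>F y in nhds 0. (\<phi> has_derivative blinfun_apply (\<phi>' y)) (at y)"
    and V: "v \<in> V" "w \<in> V"
  shows "\<forall>\<^sub>F t in nhds (0::real). g (t *\<^sub>R v) \<bullet> w = gL (\<phi> (t *\<^sub>R v)) \<bullet> \<phi>' (t *\<^sub>R v) w"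
proof -
  have sub: "subspace V" and \<phi>0: "\<phi> 0 = p" and level: "\<forall>\<^sub>F v in nhds 0. v \<in> V \<longrightarrow> F (\<phi> v) = F p"
    using chart by (auto simp: local_chart_def)
  have "(\<phi> has_derivative blinfun_apply (\<phi>' 0)) (at 0)" using \<phi>' by (rule eventually_nhds_x_imp_x)
  then have "isCont \<phi> 0" by (rule has_derivative_continuous)
  then have "filterlim \<phi> (nhds p) (nhds 0)"
    unfolding isCont_def tendsto_at_iff_tendsto_nhds by (simp only: \<phi>0)
  then have L\<phi>: "\<forall>\<^sub>F y in nhds 0. GDERIV L (\<phi> y) :> gL (\<phi> y)" by (rule eventually_compose_filterlim[OF L])
  \<comment> \<open>The derivative at y in direction w uses the level condition at y + s w for all
    small s, hence near y and not just at y.\<close>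
  have level2: "\<forall>\<^sub>F y in nhds 0. \<forall>\<^sub>F z in nhds y. z \<in> V \<longrightarrow> F (\<phi> z) = F p"
    using level by (simp add: eventually_eventually)
  have "\<forall>\<^sub>F y in nhds 0. y \<in> V \<longrightarrow> g y \<bullet> w = gL (\<phi> y) \<bullet> \<phi>' y w"
    using g \<phi>' L\<phi> level2
  proof eventually_elim
    case (elim y)
    show ?case
    proof
      assume y: "y \<in> V"
      have line: "((\<lambda>s. y + s *\<^sub>R w) has_derivative (\<lambda>s. s *\<^sub>R w)) (at (0::real))"
        by (auto intro!: derivative_eq_intros)
      have 1: "((\<lambda>s. (f \<circ> \<phi>) (y + s *\<^sub>R w)) has_derivative (\<lambda>s. (s *\<^sub>R w) \<bullet> g y)) (at 0)"
        using elim(1) by (intro has_derivative_compose[OF line, of "f \<circ> \<phi>"]) (simp add: gderiv_def)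
      have "((\<lambda>s. \<phi> (y + s *\<^sub>R w)) has_derivative (\<lambda>s. \<phi>' y (s *\<^sub>R w))) (at 0)"
        using elim(2) by (intro has_derivative_compose[OF line, of \<phi>]) simp
      from has_derivative_compose[OF this, of L "\<lambda>h. h \<bullet> gL (\<phi> y)"]
      have "((\<lambda>s. L (\<phi> (y + s *\<^sub>R w))) has_derivative (\<lambda>s. (\<phi>' y (s *\<^sub>R w)) \<bullet> gL (\<phi> y))) (at 0)"
        using elim(3) by (simp add: gderiv_def)
      then have "((\<lambda>s. L (\<phi> (y + s *\<^sub>R w)) + c * F p) has_derivative (\<lambda>s. (\<phi>' y (s *\<^sub>R w)) \<bullet> gL (\<phi> y))) (at 0)"
        by (auto intro!: derivative_eq_intros)
      moreover have lim: "filterlim (\<lambda>s. y + s *\<^sub>R w) (nhds y) (nhds 0)"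
        using tendsto_add[OF tendsto_const tendsto_scaleR_nhds_0, of y w] by simp
      then have "\<forall>\<^sub>F s in nhds 0. F (\<phi> (y + s *\<^sub>R w)) = F p"
        using eventually_compose_filterlim[OF elim(4) lim] y V sub
        by (auto elim!: eventually_mono simp: subspace_add subspace_scale)
      then have "\<forall>\<^sub>F s in nhds 0. L (\<phi> (y + s *\<^sub>R w)) + c * F p = (f \<circ> \<phi>) (y + s *\<^sub>R w)"
        by eventually_elim (simp add: f)
      ultimately have "((\<lambda>s. (f \<circ> \<phi>) (y + s *\<^sub>R w)) has_derivative (\<lambda>s. (\<phi>' y (s *\<^sub>R w)) \<bullet> gL (\<phi> y))) (at 0)"
        by (rule has_derivative_cong_nhds)
      then have "(\<lambda>s. (s *\<^sub>R w) \<bullet> g y) = (\<lambda>s. (\<phi>' y (s *\<^sub>R w)) \<bullet> gL (\<phi> y))"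
        by (rule has_derivative_unique[OF 1])
      from fun_cong[OF this, of 1] show "g y \<bullet> w = gL (\<phi> y) \<bullet> \<phi>' y w"
        by (simp add: inner_commute)
    qed
  qed
  from eventually_compose_filterlim[OF this tendsto_scaleR_nhds_0[of v]]
  show ?thesis using V(1) sub by (simp add: subspace_scale)
qed

text \<open>Differentiate \<open>chart_gradient\<close> at t = 0. By the product rule the second
  derivative of the chart is paired with \<open>gL p\<close>, which is zero; what remains is the
  pullback of the Hessian Q of the Lagrangian by the first derivative of the chart.\<close>

lemma hessian_pullback:
  fixes \<phi> :: "complex ^ 'n :: finite \<Rightarrow> complex ^ 'n"
  assumes chart: "local_chart F p V \<phi>"
    and L: "\<forall>\<^sub>F y in nhds p. GDERIV L y :> gL y" "gL p = 0" "(gL has_derivative Q) (at p)"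
    and f: "\<And>y. f y = L y + c * F y"
    and g: "has_grad_hessian (f \<circ> \<phi>) 0 g0 H"
    and V: "v \<in> V" "w \<in> V"
  shows "w \<bullet> H v = frechet_derivative \<phi> (at 0) w \<bullet> Q (frechet_derivative \<phi> (at 0) v)" and "g0 \<bullet> w = 0"
proof -
  have sub: "subspace V" and \<phi>0: "\<phi> 0 = p" and C2: "C2_near \<phi> 0"
    using chart by (auto simp: local_chart_def)
  obtain \<phi>' where \<phi>': "\<forall>\<^sub>F y in nhds 0. (\<phi> has_derivative blinfun_apply (\<phi>' y)) (at y)" "C1_near \<phi>' 0"
    using C2 by (rule C2_nearE)
  obtain g where g: "\<forall>\<^sub>F y in nhds 0. GDERIV (f \<circ> \<phi>) y :> g y" "g 0 = g0" "(g has_derivative H) (at 0)"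
    using g by (auto simp: has_grad_hessian_def)
  have D0: "(\<phi> has_derivative blinfun_apply (\<phi>' 0)) (at 0)" using \<phi>'(1) by (rule eventually_nhds_x_imp_x)
  have frechet: "frechet_derivative \<phi> (at 0) = blinfun_apply (\<phi>' 0)"
    using frechet_derivative_at[OF D0] by simp
  obtain \<phi>'' where "\<forall>\<^sub>F y in nhds 0. (\<phi>' has_derivative blinfun_apply (\<phi>'' y)) (at y) \<and> isCont \<phi>'' y"
    using \<phi>'(2) by (auto simp: C1_near_def)
  then have D1: "(\<phi>' has_derivative blinfun_apply (\<phi>'' 0)) (at 0)"
    by (metis (mono_tags, lifting) eventually_nhds_x_imp_x)
  note eq = chart_gradient[OF chart L(1) f g(1) \<phi>'(1) V]
  show "g0 \<bullet> w = 0"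
    using eventually_nhds_x_imp_x[OF eq] L(2) g(2) \<phi>0 by simp
  have line: "((\<lambda>t. t *\<^sub>R v) has_derivative (\<lambda>t. t *\<^sub>R v)) (at (0::real))"
    by (auto intro!: derivative_eq_intros)
  have "((\<lambda>t. g (t *\<^sub>R v)) has_derivative (\<lambda>t. H (t *\<^sub>R v))) (at 0)"
    using g(3) by (intro has_derivative_compose[OF line, of g]) simp
  then have left: "((\<lambda>t. g (t *\<^sub>R v) \<bullet> w) has_derivative (\<lambda>t. H (t *\<^sub>R v) \<bullet> w)) (at 0)"
    by (rule has_derivative_inner_left)
  have "((\<lambda>t. \<phi> (t *\<^sub>R v)) has_derivative (\<lambda>t. \<phi>' 0 (t *\<^sub>R v))) (at 0)"
    using D0 by (intro has_derivative_compose[OF line, of \<phi>]) simp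
  from has_derivative_compose[OF this, of gL Q]
  have a: "((\<lambda>t. gL (\<phi> (t *\<^sub>R v))) has_derivative (\<lambda>t. Q (\<phi>' 0 (t *\<^sub>R v)))) (at 0)"
    using L(3) \<phi>0 by simp
  have "((\<lambda>t. \<phi>' (t *\<^sub>R v)) has_derivative (\<lambda>t. \<phi>'' 0 (t *\<^sub>R v))) (at 0)"
    using D1 by (intro has_derivative_compose[OF line, of \<phi>']) simp
  then have b: "((\<lambda>t. \<phi>' (t *\<^sub>R v) w) has_derivative (\<lambda>t. \<phi>'' 0 (t *\<^sub>R v) w)) (at 0)"
    by (rule bounded_linear.has_derivative[OF blinfun.bounded_linear_left])
  from has_derivative_inner[OF a b]
  have "((\<lambda>t. gL (\<phi> (t *\<^sub>R v)) \<bullet> \<phi>' (t *\<^sub>R v) w) has_derivative (\<lambda>t. Q (\<phi>' 0 (t *\<^sub>R v)) \<bullet> \<phi>' 0 w)) (at 0)"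
    using \<phi>0 L(2) by simp
  then have "((\<lambda>t. g (t *\<^sub>R v) \<bullet> w) has_derivative (\<lambda>t. Q (\<phi>' 0 (t *\<^sub>R v)) \<bullet> \<phi>' 0 w)) (at 0)"
    by (rule has_derivative_cong_nhds) (use eq in \<open>auto elim: eventually_mono\<close>)
  then have "(\<lambda>t. H (t *\<^sub>R v) \<bullet> w) = (\<lambda>t. Q (\<phi>' 0 (t *\<^sub>R v)) \<bullet> \<phi>' 0 w)"
    by (rule has_derivative_unique[OF left])
  from fun_cong[OF this, of 1]
  show "w \<bullet> H v = frechet_derivative \<phi> (at 0) w \<bullet> Q (frechet_derivative \<phi> (at 0) v)"
    by (simp add: frechet inner_commute)
qed

lemma chart_tangent:
  fixes \<phi> :: "complex ^ 'n :: finite \<Rightarrow> complex ^ 'n"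
  assumes chart: "local_chart F p V \<phi>" and F: "GDERIV F p :> gF" and v: "v \<in> V"
  shows "gF \<bullet> frechet_derivative \<phi> (at 0) v = 0"
proof -
  have sub: "subspace V" and \<phi>0: "\<phi> 0 = p" and C2: "C2_near \<phi> 0" and level: "\<forall>\<^sub>F v in nhds 0. v \<in> V \<longrightarrow> F (\<phi> v) = F p"
    using chart by (auto simp: local_chart_def)
  obtain \<phi>' where \<phi>': "\<forall>\<^sub>F y in nhds 0. (\<phi> has_derivative blinfun_apply (\<phi>' y)) (at y)"
    using C2 by (rule C2_nearE)
  have D0: "(\<phi> has_derivative blinfun_apply (\<phi>' 0)) (at 0)" using \<phi>' by (rule eventually_nhds_x_imp_x)
  have frechet: "frechet_derivative \<phi> (at 0) = blinfun_apply (\<phi>' 0)"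
    using frechet_derivative_at[OF D0] by simp
  have line: "((\<lambda>t. t *\<^sub>R v) has_derivative (\<lambda>t. t *\<^sub>R v)) (at (0::real))"
    by (auto intro!: derivative_eq_intros)
  have "((\<lambda>t. \<phi> (t *\<^sub>R v)) has_derivative (\<lambda>t. \<phi>' 0 (t *\<^sub>R v))) (at 0)"
    using D0 by (intro has_derivative_compose[OF line, of \<phi>]) simp
  from has_derivative_compose[OF this, of F "\<lambda>h. h \<bullet> gF"]
  have 1: "((\<lambda>t. F (\<phi> (t *\<^sub>R v))) has_derivative (\<lambda>t. \<phi>' 0 (t *\<^sub>R v) \<bullet> gF)) (at 0)"
    using F \<phi>0 by (simp add: gderiv_def)
  have "\<forall>\<^sub>F t in nhds 0. F (\<phi> (t *\<^sub>R v)) = F p"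
    using eventually_compose_filterlim[OF level tendsto_scaleR_nhds_0[of v]] v sub by (simp add: subspace_scale)
  then have "((\<lambda>t. F (\<phi> (t *\<^sub>R v))) has_derivative (\<lambda>t. 0)) (at 0)"
    by (intro has_derivative_cong_nhds[OF has_derivative_const[of "F p"]]) (auto elim: eventually_mono)
  then have "(\<lambda>t. \<phi>' 0 (t *\<^sub>R v) \<bullet> gF) = (\<lambda>t. 0)" by (rule has_derivative_unique[OF 1])
  from fun_cong[OF this, of 1] show ?thesis by (simp add: frechet inner_commute)
qed

section \<open>Linear algebra of the index\<close>

lemma dim_le_disjoint:
  fixes A B T :: "'a :: euclidean_space set"
  assumes "subspace A" "subspace B" "subspace T" "A \<subseteq> T" "B \<subseteq> T" "A \<inter> B \<subseteq> {0}"
  shows "dim A + dim B \<le> dim T"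
proof -
  have "{x + y |x y. x \<in> A \<and> y \<in> B} \<subseteq> T" using assms by (auto intro: subspace_add)
  then have "dim {x + y |x y. x \<in> A \<and> y \<in> B} \<le> dim T" by (rule dim_subset)
  moreover have "dim (A \<inter> B) = 0" using assms(6) by (simp only: dim_eq_0)
  ultimately show ?thesis using dim_sums_Int[OF assms(1,2)] by linarith
qed

lemma dim_sum_disjoint:
  fixes A B :: "'a :: euclidean_space set"
  assumes "subspace A" "subspace B" "A \<inter> B \<subseteq> {0}"
  shows "dim {x + y |x y. x \<in> A \<and> y \<in> B} = dim A + dim B"
proof -
  have "dim (A \<inter> B) = 0" using assms(3) by (simp only: dim_eq_0)
  then show ?thesis using dim_sums_Int[OF assms(1,2)] by linarith
qed

lemma dim_Int_ge:
  fixes A B T :: "'a :: euclidean_space set"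
  assumes "subspace A" "subspace B" "subspace T" "A \<subseteq> T" "B \<subseteq> T"
  shows "dim A + dim B \<le> dim T + dim (A \<inter> B)"
proof -
  have "{x + y |x y. x \<in> A \<and> y \<in> B} \<subseteq> T" using assms by (auto intro: subspace_add)
  then have "dim {x + y |x y. x \<in> A \<and> y \<in> B} \<le> dim T" by (rule dim_subset)
  then show ?thesis using dim_sums_Int[OF assms(1,2)] by simp
qed

text \<open>By the dimension hypotheses D embeds V in T as a complement of R, so V with the pulled
  back form looks like T modulo R. Vectors of V with image in N + R form a negative subspace of
  dimension at least dim N, and a negative subspace of V has an image disjoint from M + R apart from
  0, hence has dimension at most dim N. A null vector of V is mapped into the radical of T, and this
  radical is R by another dimension count.\<close>

lemma pullback_index:
  fixes V T R N M :: "'a :: euclidean_space set" and D Q H :: "'a \<Rightarrow> 'a"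
  assumes sub: "subspace V" "subspace T" "subspace R" "subspace N" "subspace M"
    and lin: "linear D" "linear Q"
    and D: "\<And>v. v \<in> V \<Longrightarrow> D v \<in> T" and D0: "\<And>v. v \<in> V \<Longrightarrow> D v \<in> R \<Longrightarrow> v = 0"
    and RT: "R \<subseteq> T" and rad0: "\<And>r x. r \<in> R \<Longrightarrow> x \<in> T \<Longrightarrow> x \<bullet> Q r = 0"
    and sym: "\<And>x y. x \<bullet> Q y = y \<bullet> Q x"
    and NT: "N \<subseteq> T" and neg: "\<And>x. x \<in> N \<Longrightarrow> x \<noteq> 0 \<Longrightarrow> x \<bullet> Q x < 0"
    and MT: "M \<subseteq> T" and pos: "\<And>x. x \<in> M \<Longrightarrow> x \<noteq> 0 \<Longrightarrow> x \<bullet> Q x > 0"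
    and dims: "dim V + dim R = dim T" "dim N + dim M + dim R = dim T"
    and H: "\<And>v w. v \<in> V \<Longrightarrow> w \<in> V \<Longrightarrow> w \<bullet> H v = D w \<bullet> Q (D v)"
  shows "negative_index V H = dim N"
    and "\<And>v. v \<in> V \<Longrightarrow> (\<And>w. w \<in> V \<Longrightarrow> w \<bullet> H v = 0) \<Longrightarrow> v = 0"
proof -
  have rad: "x \<bullet> Q r = 0 \<and> r \<bullet> Q x = 0" if "r \<in> R" "x \<in> T" for x r
    using rad0[OF that] sym by metis
  have add_form: "(x + r) \<bullet> Q (x + r) = x \<bullet> Q x" if "x \<in> T" "r \<in> R" for x r
    using rad[OF that(2,1)] rad[OF that(2)] RT that(2)
    by (auto simp: linear_add[OF lin(2)] inner_add_left inner_add_right)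
  have NR: "N \<inter> R \<subseteq> {0}" and MR: "M \<inter> R \<subseteq> {0}"
    using neg pos rad RT by (force, force)
  have subDV: "subspace (D ` W)" if "subspace W" for W using linear_subspace_image[OF lin(1) that] .
  have injD: "inj_on D V"
    using D0 subspace_0[OF sub(3)] sub(1) by (subst linear_inj_on_iff_eq_0[OF lin(1) sub(1)]) auto
  have dimD: "dim (D ` W) = dim W" if "subspace W" "W \<subseteq> V" for W
    using that injD by (intro dim_image_eq[OF lin(1)]) (auto simp: span_eq_iff[THEN iffD2] intro: inj_on_subset)
  define A where "A = {x + y |x y. x \<in> N \<and> y \<in> R}"
  have A: "subspace A" "A \<subseteq> T" "dim A = dim N + dim R"
    unfolding A_def using sub NT RT NR by (auto intro: subspace_sums subspace_add dim_sum_disjoint)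
  \<comment> \<open>The negative subspace that realizes the index: the R component of the image does
    not affect the form.\<close>
  define W0 where "W0 = {v \<in> V. D v \<in> A}"
  have W0: "subspace W0" "W0 \<subseteq> V"
    using A(1) sub(1) unfolding W0_def subspace_def
    by (auto simp: linear_add[OF lin(1)] linear_scale[OF lin(1)] linear_0[OF lin(1)])
  have "D ` W0 = A \<inter> D ` V" by (auto simp: W0_def)
  moreover have "dim A + dim (D ` V) \<le> dim T + dim (A \<inter> D ` V)"
    by (rule dim_Int_ge) (use A sub D subDV in auto)
  ultimately have ge: "dim N \<le> dim W0"
    using dimD[OF W0] dimD[OF sub(1)] A(3) dims(1) by simp
  have neg0: "v \<bullet> H v < 0" if v: "v \<in> W0" "v \<noteq> 0" for v
  proof -
    obtain x r where x: "x \<in> N" "r \<in> R" "D v = x + r" using v by (auto simp: W0_def A_def)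
    have vV: "v \<in> V" using v W0 by auto
    have "x \<noteq> 0" using D0[OF vV] x v by auto
    moreover have "v \<bullet> H v = x \<bullet> Q x" using H[OF vV vV] add_form[of x r] x NT by auto
    ultimately show ?thesis using neg x by simp
  qed
  have le: "dim W \<le> dim N" if W: "subspace W" "W \<subseteq> V" "\<And>w. w \<in> W \<Longrightarrow> w \<noteq> 0 \<Longrightarrow> w \<bullet> H w < 0" for W
  proof -
    \<comment> \<open>The form is nonnegative on M + R, so the image of a negative subspace meets it
      only in 0.\<close>
    define C where "C = {x + y |x y. x \<in> M \<and> y \<in> R}"
    have C: "subspace C" "C \<subseteq> T" "dim C = dim M + dim R"
      unfolding C_def using sub MT RT MR by (auto intro: subspace_sums subspace_add dim_sum_disjoint)
    have "D ` W \<inter> C \<subseteq> {0}"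
    proof
      fix y assume y: "y \<in> D ` W \<inter> C"
      then obtain v x r where v: "v \<in> W" "y = D v" "x \<in> M" "r \<in> R" "y = x + r" by (auto simp: C_def)
      have vV: "v \<in> V" using v W by auto
      have "v \<bullet> H v = x \<bullet> Q x" using H[OF vV vV] add_form[of x r] v MT by auto
      moreover have "x \<bullet> Q x \<ge> 0" using pos[OF v(3)] by (cases "x = 0") (auto simp: less_imp_le)
      ultimately have "v = 0" using W(3)[OF v(1)] by auto
      then show "y \<in> {0}" using v linear_0[OF lin(1)] by simp
    qed
    then have "dim (D ` W) + dim C \<le> dim T"
      using W C sub D subDV by (intro dim_le_disjoint) auto
    then show ?thesis using dimD[OF W(1,2)] C(3) dims(2) by simp
  qed
  let ?S = "{dim W | W. subspace W \<and> W \<subseteq> V \<and> (\<forall>w\<in>W. w \<noteq> 0 \<longrightarrow> w \<bullet> H w < 0)}"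
  have "dim W0 = dim N" using ge le[OF W0] neg0 by (simp add: antisym)
  then have "dim N \<in> ?S" using W0 neg0 by (intro CollectI exI[of _ W0]) auto
  moreover have "k \<le> dim N" if "k \<in> ?S" for k using that le by blast
  ultimately show "negative_index V H = dim N"
    unfolding negative_index_def
    using finite_subset[of ?S "{..dim N}"] by (intro Max_eqI) (blast intro: le)+
  fix v assume v: "v \<in> V" "\<And>w. w \<in> V \<Longrightarrow> w \<bullet> H v = 0"
  define x where "x = D v"
  have xT: "x \<in> T" using D v by (simp add: x_def)
  have orth: "y \<bullet> Q x = 0" if y: "y \<in> T" for y
  proof -
    have "D ` V \<inter> R \<subseteq> {0}" using D0 linear_0[OF lin(1)] by auto
    then have "dim {a + b |a b. a \<in> D ` V \<and> b \<in> R} = dim T"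
      using dim_sum_disjoint[OF subDV[OF sub(1)] sub(3)] dimD[OF sub(1)] dims(1) by simp
    moreover have "{a + b |a b. a \<in> D ` V \<and> b \<in> R} \<subseteq> T" using D RT sub(2) by (auto intro: subspace_add)
    ultimately have "{a + b |a b. a \<in> D ` V \<and> b \<in> R} = T"
      using subspace_dim_equal[of "{a + b |a b. a \<in> D ` V \<and> b \<in> R}" T] sub subDV[OF sub(1)]
      by (simp add: subspace_sums)
    then obtain u r where u: "u \<in> V" "r \<in> R" "y = D u + r" using y by blast
    then have "y \<bullet> Q x = u \<bullet> H v + r \<bullet> Q x" using H[OF v(1) u(1)] by (simp add: x_def inner_add_left)
    then show ?thesis using v(2)[OF u(1)] rad[OF u(2) xT] by simp
  qed
  \<comment> \<open>The whole radical of the form on T. It contains R, and N + Z meets M only in 0;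
    as the dimensions of N, M and R already add up to that of T, it equals R.\<close>
  define Z where "Z = {y \<in> T. \<forall>u\<in>T. u \<bullet> Q y = 0}"
  have Z: "subspace Z" "Z \<subseteq> T"
    using sub(2) unfolding Z_def subspace_def
    by (auto simp: linear_add[OF lin(2)] linear_scale[OF lin(2)] linear_0[OF lin(2)] inner_add_right)
  have RZ: "R \<subseteq> Z" using RT rad by (auto simp: Z_def)
  have NZ: "N \<inter> Z \<subseteq> {0}" using neg NT by (force simp: Z_def)
  define A where "A = {a + b |a b. a \<in> N \<and> b \<in> Z}"
  have A: "subspace A" "A \<subseteq> T" "dim A = dim N + dim Z"
    unfolding A_def using sub NT Z NZ by (auto intro: subspace_sums subspace_add dim_sum_disjoint)
  have "A \<inter> M \<subseteq> {0}"
  proof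
    fix m assume m: "m \<in> A \<inter> M"
    then obtain a b where ab: "a \<in> N" "b \<in> Z" "m = a + b" by (auto simp: A_def)
    have aT: "a \<in> T" and mT: "m \<in> T" using ab m NT MT by auto
    have "b \<bullet> Q a = 0" "a \<bullet> Q b = 0" using ab aT sym[of b a] by (auto simp: Z_def)
    moreover have "m \<bullet> Q b = 0" using ab mT by (auto simp: Z_def)
    ultimately have "m \<bullet> Q m = a \<bullet> Q a"
      using ab by (simp add: linear_add[OF lin(2)] inner_add_left inner_add_right)
    also have "\<dots> \<le> 0" using neg[OF ab(1)] by (cases "a = 0") (auto simp: less_imp_le)
    finally show "m \<in> {0}" using pos[of m] m by force
  qed
  then have "dim A + dim M \<le> dim T" using A sub MT by (intro dim_le_disjoint) auto
  then have "dim Z \<le> dim R" using A(3) dims(2) by simp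
  then have "R = Z" using subspace_dim_equal[OF sub(3) Z(1) RZ] by simp
  moreover have "x \<in> Z" using xT orth by (simp add: Z_def)
  ultimately show "v = 0" using D0 v(1) by (simp add: x_def)
qed

text \<open>Indexed families fit the later use: independence of the mode vectors comes from the
  definiteness of the Hessian on their combinations, which are given by coefficients.\<close>

lemma dim_span_family:
  fixes f :: "'i \<Rightarrow> 'a :: euclidean_space"
  assumes "finite J" and indep: "\<And>a. (\<Sum>j\<in>J. a j *\<^sub>R f j) = 0 \<Longrightarrow> \<forall>j\<in>J. a j = 0"
  shows "dim (span (f ` J)) = card J"
proof -
  have inj: "inj_on f J"
  proof (rule inj_onI, rule ccontr)
    fix i j assume ij: "i \<in> J" "j \<in> J" "f i = f j" "i \<noteq> j"
    define a where "a k = (if k = i then 1 else if k = j then - 1 else (0::real))" for k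
    have "(\<Sum>k\<in>J. a k *\<^sub>R f k) = (\<Sum>k\<in>{i, j}. a k *\<^sub>R f k)"
      using ij \<open>finite J\<close> by (intro sum.mono_neutral_right) (auto simp: a_def)
    also have "\<dots> = 0" using ij by (simp add: a_def)
    finally have "a i = 0" using indep[of a] ij(1) by blast
    then show False by (simp add: a_def)
  qed
  have "independent (f ` J)"
  proof (rule independent_if_scalars_zero)
    show "finite (f ` J)" using \<open>finite J\<close> by simp
    fix g x assume "(\<Sum>x\<in>f ` J. g x *\<^sub>R x) = 0" "x \<in> f ` J"
    then show "g x = 0" using indep[of "\<lambda>j. g (f j)"] by (auto simp: sum.reindex[OF inj])
  qed
  then show ?thesis by (simp add: dim_eq_card_independent card_image inj)
qed

lemma span_familyE:
  fixes f :: "'i \<Rightarrow> 'a :: real_vector"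
  assumes "x \<in> span (f ` J)" "finite J"
  obtains a where "x = (\<Sum>j\<in>J. a j *\<^sub>R f j)"
proof -
  have "span (f ` J) \<subseteq> {x. \<exists>a. x = (\<Sum>j\<in>J. a j *\<^sub>R f j)}"
  proof (rule span_minimal)
    show "f ` J \<subseteq> {x. \<exists>a. x = (\<Sum>j\<in>J. a j *\<^sub>R f j)}"
    proof clarify
      fix i assume "i \<in> J"
      then have "f i = (\<Sum>j\<in>J. (if j = i then 1 else 0) *\<^sub>R f j)"
        using \<open>finite J\<close> by (simp add: if_distrib[of "\<lambda>c. c *\<^sub>R _"] cong: if_cong)
      then show "\<exists>a. f i = (\<Sum>j\<in>J. a j *\<^sub>R f j)" by (rule exI[of _ "\<lambda>j. if j = i then 1 else 0"])
    qed
    show "subspace {x. \<exists>a. x = (\<Sum>j\<in>J. a j *\<^sub>R f j)}"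
      unfolding subspace_def
    proof (intro conjI ballI allI)
      show "0 \<in> {x. \<exists>a. x = (\<Sum>j\<in>J. a j *\<^sub>R f j)}" by (auto intro!: exI[of _ "\<lambda>_. 0"])
      fix x y assume "x \<in> {x. \<exists>a. x = (\<Sum>j\<in>J. a j *\<^sub>R f j)}" "y \<in> {x. \<exists>a. x = (\<Sum>j\<in>J. a j *\<^sub>R f j)}"
      then obtain a b where "x = (\<Sum>j\<in>J. a j *\<^sub>R f j)" "y = (\<Sum>j\<in>J. b j *\<^sub>R f j)" by blast
      then have "x + y = (\<Sum>j\<in>J. (a j + b j) *\<^sub>R f j)" by (simp add: scaleR_add_left sum.distrib)
      then show "x + y \<in> {x. \<exists>a. x = (\<Sum>j\<in>J. a j *\<^sub>R f j)}" unfolding mem_Collect_eq by (rule exI[of _ "\<lambda>j. a j + b j"])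
    next
      fix c x assume "x \<in> {x. \<exists>a. x = (\<Sum>j\<in>J. a j *\<^sub>R f j)}"
      then obtain a where "x = (\<Sum>j\<in>J. a j *\<^sub>R f j)" by blast
      then have "c *\<^sub>R x = (\<Sum>j\<in>J. (c * a j) *\<^sub>R f j)" by (simp add: scaleR_sum_right)
      then show "c *\<^sub>R x \<in> {x. \<exists>a. x = (\<Sum>j\<in>J. a j *\<^sub>R f j)}" unfolding mem_Collect_eq by (rule exI[of _ "\<lambda>j. c * a j"])
    qed
  qed
  then show ?thesis using assms(1) that by blast
qed

section \<open>Orbit directions and charts by scaling\<close>

lemma orbit_tangent_image: "orbit_tangent p = range (\<lambda>(t, b). \<chi> i. \<i> * of_real t * p $ i + b)"
  by (auto simp: orbit_tangent_def)

lemma linear_orbit_tangent: "linear (\<lambda>(t, b). (\<chi> i. \<i> * of_real t * p $ i + b) :: complex ^ 'n :: finite)"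
  by (auto intro!: linearI simp: vec_eq_iff algebra_simps scaleR_conv_of_real[where 'a = complex])

lemma subspace_orbit_tangent: "subspace (orbit_tangent (p :: complex ^ 'n :: finite))"
  unfolding orbit_tangent_image by (intro linear_subspace_image linear_orbit_tangent subspace_UNIV)

lemma dim_orbit_tangent:
  fixes p :: "complex ^ 'n :: finite"
  assumes "p \<in> nonconst_tuples"
  shows "dim (orbit_tangent p) = 3"
proof -
  let ?f = "\<lambda>(t, b). (\<chi> i. \<i> * of_real t * p $ i + b) :: complex ^ 'n"
  obtain i j where ij: "p $ i \<noteq> p $ j" using assms by (auto simp: nonconst_tuples_def)
  have "inj ?f"
  proof (subst linear_injective_0[OF linear_orbit_tangent], clarify)
    fix t :: real and b assume 0: "(\<chi> i. \<i> * of_real t * p $ i + b) = (0 :: complex ^ 'n)"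
    then have "\<i> * of_real t * p $ i + b = 0" "\<i> * of_real t * p $ j + b = 0" by (simp_all add: vec_eq_iff)
    moreover have "\<i> * of_real t * (p $ i - p $ j) = (\<i> * of_real t * p $ i + b) - (\<i> * of_real t * p $ j + b)"
      by (simp add: algebra_simps)
    ultimately have "\<i> * of_real t * (p $ i - p $ j) = 0" by simp
    then have "t = 0" using ij by simp
    then show "(t, b) = 0" using 0 by (simp add: vec_eq_iff zero_prod_def)
  qed
  then have "dim (range ?f) = dim (UNIV :: (real \<times> complex) set)"
    by (intro dim_image_eq linear_orbit_tangent) (simp add: span_UNIV)
  then show ?thesis by (simp add: orbit_tangent_image)
qed

text \<open>On the difference of two distinct vertices infinitesimal isometries act as
  multiplication by an imaginary number, whereas infinitesimal scaling acts as multiplication by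
  1.\<close>

lemma notin_orbit_tangent:
  fixes p :: "complex ^ 'n :: finite"
  assumes "p \<in> nonconst_tuples"
  shows "p \<notin> orbit_tangent p"
proof
  obtain i j where ij: "p $ i \<noteq> p $ j" using assms by (auto simp: nonconst_tuples_def)
  assume "p \<in> orbit_tangent p"
  then obtain t b where p: "p = (\<chi> i. \<i> * of_real t * p $ i + b)" by (auto simp: orbit_tangent_def)
  have "p $ k = \<i> * of_real t * p $ k + b" for k using p by (metis vec_lambda_beta)
  then have b: "p $ k - \<i> * of_real t * p $ k = b" for k by (metis add_diff_cancel_left')
  have "(1 - \<i> * of_real t) * (p $ i - p $ j) = (p $ i - \<i> * of_real t * p $ i) - (p $ j - \<i> * of_real t * p $ j)"
    by (simp add: algebra_simps)
  also have "\<dots> = 0" unfolding b by simp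
  finally have "(1 - \<i> * of_real t) * (p $ i - p $ j) = 0" .
  then have "1 - \<i> * of_real t = 0" using ij by simp
  then show False by (simp add: complex_eq_iff)
qed

text \<open>A scaling moves \<open>p + v\<close> back to the hypersurface, so no implicit function theorem is needed.\<close>

lemma local_chart_scaling:
  fixes p :: "complex ^ 'n :: finite" and s :: "complex ^ 'n \<Rightarrow> real"
  assumes p: "p \<in> nonconst_tuples" and n: "CARD('n) \<ge> 2"
    and s: "C2_near s 0" "s 0 = 1" "\<forall>\<^sub>F v in nhds 0. F (s v *\<^sub>R (p + v)) = F p"
  shows "\<exists>V. local_chart F p V (\<lambda>v. s v *\<^sub>R (p + v))"
proof -
  \<comment> \<open>Four directions are lost in the chart: three along the orbit and the scaling
    direction p, which the function s corrects. The orthogonal complement therefore has the required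
    dimension 2 n - 4.\<close>
  define A where "A = span (insert p (orbit_tangent p))"
  define V where "V = {v \<in> UNIV. \<forall>x\<in>A. orthogonal x v}"
  have spR: "span (orbit_tangent p) = orbit_tangent p" using subspace_orbit_tangent by (simp add: span_eq_iff)
  have "dim A = 4"
    using notin_orbit_tangent[OF p] dim_orbit_tangent[OF p] by (simp add: A_def dim_insert spR)
  moreover have "dim V + dim A = dim (UNIV :: (complex ^ 'n) set)"
    unfolding V_def by (rule dim_subspace_orthogonal_to_vectors) (auto simp: A_def)
  ultimately have dimV: "dim V = 2 * CARD('n) - 4" by simp
  have subV: "subspace V"
    unfolding V_def subspace_def by (auto simp: orthogonal_def inner_add_right)
  let ?\<phi> = "\<lambda>v. s v *\<^sub>R (p + v)"
  have C2: "C2_near ?\<phi> 0"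
    by (intro C2_near_bilinear[OF bounded_bilinear_scaleR] s(1) C2_near_add C2_near_const C2_near_id)
  obtain s' where "\<forall>\<^sub>F y in nhds 0. (s has_derivative blinfun_apply (s' y)) (at y)" using s(1) by (rule C2_nearE)
  then have "(s has_derivative blinfun_apply (s' 0)) (at 0)" by (rule eventually_nhds_x_imp_x)
  then have "(?\<phi> has_derivative (\<lambda>v. s 0 *\<^sub>R v + s' 0 v *\<^sub>R (p + 0))) (at 0)"
    by (auto intro!: derivative_eq_intros)
  then have D: "frechet_derivative ?\<phi> (at 0) = (\<lambda>v. v + s' 0 v *\<^sub>R p)"
    using s(2) by (subst frechet_derivative_at[symmetric]) auto
  \<comment> \<open>The derivative adds to v only a multiple of p. If the result is tangent to the
    orbit, then v lies in A as well as orthogonal to A.\<close>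
  have "v = 0" if v: "v \<in> V" "frechet_derivative ?\<phi> (at 0) v \<in> orbit_tangent p" for v
  proof -
    have "(v + s' 0 v *\<^sub>R p) - s' 0 v *\<^sub>R p \<in> A"
      using v(2) unfolding D A_def by (intro span_diff span_scale span_base) auto
    then have "orthogonal v v" using v(1) by (auto simp: V_def)
    then show ?thesis by (simp add: orthogonal_self)
  qed
  then have "local_chart F p V ?\<phi>"
    unfolding local_chart_def using subV dimV C2 s(2,3) by (auto elim: eventually_mono)
  then show ?thesis ..
qed

section \<open>The Hessian at a regular star\<close>

lemma Re_mult_cnj_inner: "Re (cnj x * y) = x \<bullet> y"
  by (simp add: inner_complex_def)

text \<open>The second derivative of the length of an edge with direction u sees only the components
  of the variations normal to u; these are the imaginary parts once u is rotated to 1.\<close>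

lemma inner_minus_projection:
  assumes "norm u = 1"
  shows "a \<bullet> b - (u \<bullet> a) * (u \<bullet> b) = Im (cnj u * a) * Im (cnj u * b)"
proof -
  have "Re u * Re u + Im u * Im u = 1"
    using assms cmod_power2[of u] by (simp add: power2_eq_square)
  then have "(Re u * Re u + Im u * Im u) * (a \<bullet> b) = a \<bullet> b" by simp
  then show ?thesis by (simp add: inner_complex_def algebra_simps)
qed

lemma sgn_has_derivative:
  fixes x :: "'a :: real_inner"
  assumes "x \<noteq> 0"
  shows "(sgn has_derivative (\<lambda>d. (1 / norm x) *\<^sub>R (d - (sgn x \<bullet> d) *\<^sub>R sgn x))) (at x)"
proof -
  have n: "(norm has_derivative (\<lambda>d. d \<bullet> sgn x)) (at x)" using GDERIV_norm[OF assms] by (simp add: gderiv_def)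
  have "((\<lambda>x. inverse (norm x)) has_derivative (\<lambda>d. - (inverse (norm x) * (d \<bullet> sgn x) * inverse (norm x)))) (at x)"
    using assms by (intro Deriv.has_derivative_inverse[OF _ n]) auto
  then have "((\<lambda>x. inverse (norm x) *\<^sub>R x) has_derivative
      (\<lambda>d. inverse (norm x) *\<^sub>R d + (- (inverse (norm x) * (d \<bullet> sgn x) * inverse (norm x))) *\<^sub>R x)) (at x)"
    by (intro has_derivative_scaleR has_derivative_ident)
  moreover have "(\<lambda>x. inverse (norm x) *\<^sub>R x) = (sgn :: 'a \<Rightarrow> 'a)" by (simp add: fun_eq_iff sgn_div_norm)
  moreover have "(\<lambda>d. inverse (norm x) *\<^sub>R d + (- (inverse (norm x) * (d \<bullet> sgn x) * inverse (norm x))) *\<^sub>R x) =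
      (\<lambda>d. (1 / norm x) *\<^sub>R (d - (sgn x \<bullet> d) *\<^sub>R sgn x))"
    by (simp add: fun_eq_iff scaleR_diff_right sgn_div_norm divide_inverse inner_commute mult_ac)
  ultimately show ?thesis by simp
qed

lemma bounded_linear_edge: "bounded_linear (\<lambda>p :: complex ^ 'n :: finite. edge p k)"
  by (rule linear_conv_bounded_linear[THEN iffD1]) (auto intro!: linearI)

lemma has_derivative_edge [derivative_intros]:
  fixes f :: "_ \<Rightarrow> complex ^ 'n :: finite"
  shows "(f has_derivative f') F \<Longrightarrow> ((\<lambda>x. edge (f x) k) has_derivative (\<lambda>h. edge (f' h) k)) F"
  by (rule bounded_linear.has_derivative[OF bounded_linear_edge])

definition perimeter_grad :: "complex ^ 'n \<Rightarrow> complex ^ 'n :: finite" where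
  "perimeter_grad p = riesz (\<lambda>v. \<Sum>k<CARD('n). sgn (edge p k) \<bullet> edge v k)"

lemma inner_perimeter_grad:
  "perimeter_grad p \<bullet> v = (\<Sum>k<CARD('n). sgn (edge (p :: complex ^ 'n :: finite) k) \<bullet> edge v k)"
  unfolding perimeter_grad_def
  by (rule inner_riesz) (auto intro!: linearI simp: inner_add_right sum.distrib sum_distrib_left)

lemma edge_mod: "edge (p :: complex ^ 'n :: finite) (k mod CARD('n)) = edge p k"
  unfolding edge_def by (metis mod_add_left_eq vertex_mod)

lemma eventually_edges_nonzero:
  fixes p :: "complex ^ 'n :: finite"
  assumes "\<And>k. edge p k \<noteq> 0"
  shows "\<forall>\<^sub>F y in nhds p. \<forall>k. edge y k \<noteq> 0"
proof -
  have "\<forall>\<^sub>F y in nhds p. edge y k \<noteq> 0" for k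
  proof -
    have "((\<lambda>y. edge y k) \<longlongrightarrow> edge p k) (nhds p)" by (intro tendsto_edge filterlim_ident)
    then show ?thesis using assms[of k] by (rule tendsto_imp_eventually_ne)
  qed
  then have "\<forall>\<^sub>F y in nhds p. \<forall>k\<in>{..<CARD('n)}. edge y k \<noteq> 0" by (simp add: eventually_ball_finite)
  then show ?thesis
  proof (rule eventually_mono, intro allI)
    fix y :: "complex ^ 'n" and k
    assume "\<forall>k\<in>{..<CARD('n)}. edge y k \<noteq> 0"
    then have "edge y (k mod CARD('n)) \<noteq> 0" by simp
    then show "edge y k \<noteq> 0" by (simp add: edge_mod)
  qed
qed

lemma GDERIV_perimeter:
  fixes p :: "complex ^ 'n :: finite"
  assumes "\<And>k. edge p k \<noteq> 0"
  shows "GDERIV perimeter p :> perimeter_grad p"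
proof -
  have "((\<lambda>p :: complex ^ 'n. \<Sum>k<CARD('n). norm (edge p k)) has_derivative (\<lambda>h. \<Sum>k<CARD('n). edge h k \<bullet> sgn (edge p k))) (at p)"
  proof (intro has_derivative_sum)
    fix k
    have "(norm has_derivative (\<lambda>d. d \<bullet> sgn (edge p k))) (at (edge p k))"
      using GDERIV_norm[OF assms[of k]] by (simp add: gderiv_def)
    from has_derivative_compose[OF has_derivative_edge[OF has_derivative_ident] this]
    show "((\<lambda>p. norm (edge p k)) has_derivative (\<lambda>h. edge h k \<bullet> sgn (edge p k))) (at p)" .
  qed
  moreover have "perimeter = (\<lambda>p :: complex ^ 'n. \<Sum>k<CARD('n). norm (edge p k))" by (simp add: fun_eq_iff perimeter_edge)
  moreover have "(\<lambda>h. \<Sum>k<CARD('n). edge h k \<bullet> sgn (edge p k)) = (\<lambda>h. h \<bullet> perimeter_grad p)"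
    by (simp add: fun_eq_iff inner_commute[of _ "perimeter_grad p"] inner_perimeter_grad inner_commute[of "edge _ _"])
  ultimately show ?thesis by (simp add: gderiv_def)
qed

definition perimeter_hess :: "complex ^ 'n \<Rightarrow> complex ^ 'n \<Rightarrow> complex ^ 'n :: finite" where
  "perimeter_hess p v = riesz (\<lambda>w. \<Sum>k<CARD('n).
     ((1 / norm (edge p k)) *\<^sub>R (edge v k - (sgn (edge p k) \<bullet> edge v k) *\<^sub>R sgn (edge p k))) \<bullet> edge w k)"

lemma perimeter_grad_has_derivative:
  fixes p :: "complex ^ 'n :: finite"
  assumes "\<And>k. edge p k \<noteq> 0"
  shows "(perimeter_grad has_derivative perimeter_hess p) (at p)"
  unfolding perimeter_grad_def[abs_def] perimeter_hess_def[abs_def] riesz_def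
proof (intro has_derivative_sum bounded_linear.has_derivative[OF bounded_linear_scaleR_left]
    bounded_linear.has_derivative[OF bounded_linear_inner_left])
  fix k
  from has_derivative_compose[OF has_derivative_edge[OF has_derivative_ident] sgn_has_derivative[OF assms[of k]]]
  show "((\<lambda>p. sgn (edge p k)) has_derivative (\<lambda>h. (1 / norm (edge p k)) *\<^sub>R
      (edge h k - (sgn (edge p k) \<bullet> edge h k) *\<^sub>R sgn (edge p k)))) (at p)" .
qed

lemma inner_perimeter_hess:
  fixes p :: "complex ^ 'n :: finite"
  assumes "\<And>k. edge p k \<noteq> 0"
  shows "w \<bullet> perimeter_hess p v =
    (\<Sum>k<CARD('n). Im (cnj (sgn (edge p k)) * edge v k) * Im (cnj (sgn (edge p k)) * edge w k) / norm (edge p k))"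
proof -
  have "perimeter_hess p v \<bullet> w = (\<Sum>k<CARD('n).
     ((1 / norm (edge p k)) *\<^sub>R (edge v k - (sgn (edge p k) \<bullet> edge v k) *\<^sub>R sgn (edge p k))) \<bullet> edge w k)"
    unfolding perimeter_hess_def
    by (rule inner_riesz) (auto intro!: linearI simp: inner_add_right sum.distrib sum_distrib_left add_divide_distrib)
  also have "\<dots> = (\<Sum>k<CARD('n). (edge v k \<bullet> edge w k - (sgn (edge p k) \<bullet> edge v k) * (sgn (edge p k) \<bullet> edge w k)) / norm (edge p k))"
    by (simp add: inner_diff_left)
  also have "\<dots> = (\<Sum>k<CARD('n). Im (cnj (sgn (edge p k)) * edge v k) * Im (cnj (sgn (edge p k)) * edge w k) / norm (edge p k))"
    by (intro sum.cong refl, subst inner_minus_projection) (use assms in \<open>auto simp: norm_sgn\<close>)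
  finally show ?thesis by (simp add: inner_commute)
qed

lemma linear_perimeter_hess:
  fixes p :: "complex ^ 'n :: finite"
  assumes "\<And>k. edge p k \<noteq> 0"
  shows "linear (perimeter_hess p)"
  using has_derivative_linear[OF perimeter_grad_has_derivative[OF assms]] .

lemma perimeter_hess_sym:
  fixes p :: "complex ^ 'n :: finite"
  assumes "\<And>k. edge p k \<noteq> 0"
  shows "w \<bullet> perimeter_hess p v = v \<bullet> perimeter_hess p w"
  by (simp add: inner_perimeter_hess[OF assms] mult.commute)

text \<open>The contribution of one edge to the Hessian of the Lagrangian. Unprimed letters are
  rotating coordinates at a vertex, primed ones at the next vertex, and Greek letters belong to the
  second argument of the form. The last line has the shape G(k + 1) - G(k) and cancels in the cyclic
  sum.\<close>

lemma star_form_identity: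
  fixes x x' y y' \<xi> \<xi>' \<eta> \<eta>' s c :: real
  assumes c: "c \<noteq> 0" "s\<^sup>2 + c\<^sup>2 = 1"
  shows "(c * (x' - x) - s * (y' + y)) * (c * (\<xi>' - \<xi>) - s * (\<eta>' + \<eta>))
      - (s / c) * ((2 * s * c * (x * \<xi>' + y * \<eta>') + (c\<^sup>2 - s\<^sup>2) * (x * \<eta>' - y * \<xi>'))
        + (2 * s * c * (\<xi> * x' + \<eta> * y') + (c\<^sup>2 - s\<^sup>2) * (\<xi> * y' - \<eta> * x'))) =
    s\<^sup>2 * ((y' - y + s / c * (x + x')) * (\<eta>' - \<eta> + s / c * (\<xi> + \<xi>')))
      + ((x' - x) * (\<xi>' - \<xi>) - 4 * s\<^sup>2 * (x * \<xi>)) / c\<^sup>2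
      + (((c\<^sup>2 - (s ^ 4 + 1) / c\<^sup>2) * (x' * \<xi>') - s / c * (x' * \<eta>' + y' * \<xi>'))
        - ((c\<^sup>2 - (s ^ 4 + 1) / c\<^sup>2) * (x * \<xi>) - s / c * (x * \<eta> + y * \<xi>)))"
proof -
  \<comment> \<open>Writing s = k c turns both sides into polynomials in k and c, since 1 / c^2
    becomes 1 + k^2; their difference is an explicit multiple of s^2 + c^2 - 1.\<close>
  define k where "k = s / c"
  have s: "s = k * c" using c by (simp add: k_def)
  have rel: "k\<^sup>2 * c\<^sup>2 + c\<^sup>2 - 1 = 0" using c by (simp add: s power_mult_distrib)
  have "1 / c\<^sup>2 = 1 + k\<^sup>2" using c rel by (simp add: field_simps)
  then have d: "a / c\<^sup>2 = (1 + k\<^sup>2) * a" for a by (metis mult.commute mult_1 times_divide_eq_right)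
  have "(c * (x' - x) - s * (y' + y)) * (c * (\<xi>' - \<xi>) - s * (\<eta>' + \<eta>))
      - k * ((2 * s * c * (x * \<xi>' + y * \<eta>') + (c\<^sup>2 - s\<^sup>2) * (x * \<eta>' - y * \<xi>'))
        + (2 * s * c * (\<xi> * x' + \<eta> * y') + (c\<^sup>2 - s\<^sup>2) * (\<xi> * y' - \<eta> * x'))) -
    (s\<^sup>2 * ((y' - y + k * (x + x')) * (\<eta>' - \<eta> + k * (\<xi> + \<xi>')))
      + (1 + k\<^sup>2) * ((x' - x) * (\<xi>' - \<xi>) - 4 * s\<^sup>2 * (x * \<xi>))
      + (((c\<^sup>2 - (1 + k\<^sup>2) * (s ^ 4 + 1)) * (x' * \<xi>') - k * (x' * \<eta>' + y' * \<xi>'))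
        - ((c\<^sup>2 - (1 + k\<^sup>2) * (s ^ 4 + 1)) * (x * \<xi>) - k * (x * \<eta> + y * \<xi>)))) =
    (k ^ 4 * c\<^sup>2 * (x' * \<xi>') - (k\<^sup>2 + 1) * (x' * \<xi> + x * \<xi>') - k * (x' * \<eta>' + y' * \<xi>')
      + k * (x * \<eta> + y * \<xi>) + (2 * k\<^sup>2 + 2 - k ^ 4 * c\<^sup>2) * (x * \<xi>)) * (k\<^sup>2 * c\<^sup>2 + c\<^sup>2 - 1)"
    unfolding s by (simp add: power2_eq_square power4_eq_xxxx algebra_simps)
  then show ?thesis unfolding d k_def[symmetric] by (simp only: rel mult_zero_right right_minus_eq)
qed

text \<open>A regular star other than a complete fold, with the exponent in the range where it is
  the winding number.\<close>

locale winding_polygon =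
  fixes p :: "complex ^ 'n :: finite" and c z :: complex and w :: int
  assumes p: "p = star c z w" and z: "z \<noteq> 0" and w: "w \<noteq> 0" "2 * \<bar>w\<bar> < int CARD('n)"
begin

text \<open>\<open>qc v k\<close> is the \<open>k\<close>-th vertex of \<open>v\<close> in a frame that rotates along with the vertices of \<open>p\<close>.\<close>

definition "n = CARD('n)"
text \<open>Half the central angle of an edge. It is less than a quarter turn in absolute value, so
  its cosine \<open>\<rho>\<close> is positive.\<close>

definition "\<theta> = pi * of_int w / real n"
definition "\<sigma> = sin \<theta>"
definition "\<rho> = cos \<theta>"
definition "\<zeta> = sgn z"
definition "U k = unity n (w * int k)"
text \<open>The Lagrange multiplier: at each vertex the difference of the two unit edge directions
  is radial of size 2 |\<sigma>|, while the area gradient has the radial component 2 |z| \<sigma>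
  \<rho>; this is their ratio (\<open>sgn_edge_diff\<close>).\<close>

definition "\<mu> = sgn \<sigma> / (cmod z * \<rho>)"
definition "qc v k = cnj (\<zeta> * U k) * vertex (v :: complex ^ 'n) k"
abbreviation "xc v k \<equiv> Re (qc v k)"
abbreviation "yc v k \<equiv> Im (qc v k)"

lemma n_pos: "n > 0"
  by (simp add: n_def)

lemma n_ge_3: "n \<ge> 3"
  using w by (auto simp: n_def)

lemma theta_bounds: "\<bar>\<theta>\<bar> < pi / 2" "\<theta> \<noteq> 0"
proof -
  have "\<bar>real_of_int w\<bar> * 2 < real n"
    using w(2) unfolding n_def by linarith
  then have "pi * (\<bar>real_of_int w\<bar> * 2) < pi * real n" by simp
  then show "\<bar>\<theta>\<bar> < pi / 2" using n_pos by (simp add: \<theta>_def abs_mult field_simps)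
  show "\<theta> \<noteq> 0" using w(1) n_pos by (simp add: \<theta>_def)
qed

lemma rho_pos: "\<rho> > 0"
  unfolding \<rho>_def using theta_bounds by (intro cos_gt_zero_pi) (auto simp: abs_less_iff)

lemma sigma_sgn: "sgn \<sigma> = sgn (of_int w)" "\<sigma> \<noteq> 0"
proof -
  have "sgn \<sigma> = sgn \<theta>"
    using sin_gt_zero[of \<theta>] sin_gt_zero[of "- \<theta>"] theta_bounds
    by (cases "\<theta> > 0") (auto simp: \<sigma>_def sgn_if abs_less_iff)
  then show "sgn \<sigma> = sgn (of_int w)" using n_pos by (auto simp: \<theta>_def sgn_if zero_less_divide_iff zero_less_mult_iff)
  then show "\<sigma> \<noteq> 0" using w(1) by (auto simp: sgn_if split: if_splits)
qed

lemma sigma_rho: "\<sigma>\<^sup>2 + \<rho>\<^sup>2 = 1"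
  by (simp add: \<sigma>_def \<rho>_def)

lemma norm_zeta [simp]: "cmod \<zeta> = 1"
  using z by (simp add: \<zeta>_def norm_sgn)

lemma norm_U [simp]: "cmod (U k) = 1"
  by (simp add: U_def)

lemma zU_cnj: "(\<zeta> * U k) * cnj (\<zeta> * U k) = 1"
  using complex_norm_square[of "\<zeta> * U k"] by (simp add: norm_mult)

lemma vertex_qc: "vertex v k = \<zeta> * U k * qc v k"
  unfolding qc_def mult.assoc[symmetric] zU_cnj by simp

lemma U_Suc: "U (k + 1) = cis (2 * \<theta>) * U k"
proof -
  have "unity n w = cis (2 * \<theta>)" by (simp add: unity_def \<theta>_def mult.assoc)
  then show ?thesis by (simp add: U_def distrib_left unity_add)
qed

lemma U_periodic: "U (k + n) = U k"
  using n_pos by (simp add: U_def distrib_left unity_add)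

lemma qc_periodic: "qc v (k + n) = qc v k"
  unfolding qc_def U_periodic by (simp add: n_def)

lemma cis_double: "cis (2 * \<theta>) - 1 = 2 * \<i> * of_real \<sigma> * cis \<theta>"
  by (simp add: complex_eq_iff cos_double_sin sin_double \<sigma>_def power2_eq_square)

lemma edge_p: "edge p k = z * (2 * \<i> * of_real \<sigma> * cis \<theta>) * U k"
proof -
  have "unity CARD('n) w = cis (2 * \<theta>)" by (simp add: unity_def \<theta>_def n_def mult.assoc)
  then show ?thesis
    unfolding edge_def p edge_star by (simp only: cis_double U_def n_def)
qed

lemma norm_edge_p: "cmod (edge p k) = 2 * cmod z * \<bar>\<sigma>\<bar>"
  by (simp add: edge_p norm_mult)

lemma edge_p_nonzero: "edge p k \<noteq> 0"
  using norm_edge_p[of k] z sigma_sgn(2) by auto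

lemma sgn_edge_p: "sgn (edge p k) = \<zeta> * \<i> * of_real (sgn \<sigma>) * cis \<theta> * U k"
proof -
  have "sgn (U k) = U k" "sgn (cis \<theta>) = cis \<theta>" by (simp_all add: sgn_eq)
  moreover have "sgn (complex_of_real \<sigma>) = of_real (sgn \<sigma>)" by (rule sgn_of_real)
  moreover have "sgn (2 :: complex) = 1" "sgn \<i> = \<i>" by (simp_all add: sgn_eq)
  ultimately show ?thesis by (simp add: edge_p sgn_mult \<zeta>_def)
qed

lemma z_polar: "z = of_real (cmod z) * \<zeta>"
  using z by (simp add: \<zeta>_def sgn_eq)

lemma vertex_area_grad_p: "vertex (area_grad p) (k + 1) = of_real (2 * cmod z * \<sigma> * \<rho>) * \<zeta> * U (k + 1)"
proof -
  have "cis (2 * \<theta>) + 1 = 2 * of_real \<rho> * cis \<theta>"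
    by (simp add: complex_eq_iff cos_double_cos sin_double \<rho>_def power2_eq_square)
  moreover have "edge p (k + 1) + edge p k = z * (2 * \<i> * of_real \<sigma> * cis \<theta>) * (cis (2 * \<theta>) + 1) * U k"
    unfolding edge_p U_Suc by (simp add: algebra_simps)
  moreover have "cis \<theta> * cis \<theta> = cis (2 * \<theta>)" by (simp add: cis_mult)
  ultimately have "vertex (area_grad p) (k + 1) =
      z * (2 * of_real \<sigma> * of_real \<rho>) * (cis (2 * \<theta>) * U k)"
    unfolding vertex_area_grad by (simp add: field_simps)
  then show ?thesis unfolding U_Suc by (subst (asm) z_polar) (simp add: mult_ac)
qed

lemma sgn_edge_diff: "sgn (edge p k) - sgn (edge p (k + 1)) = of_real \<mu> * vertex (area_grad p) (k + 1)"
proof -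
  have s: "sgn \<sigma> * \<sigma> = \<bar>\<sigma>\<bar>" by (simp add: mult_sgn_abs abs_sgn mult.commute)
  have cc: "cis \<theta> * cis \<theta> = cis (2 * \<theta>)" by (simp add: cis_mult)
  have "sgn (edge p k) - sgn (edge p (k + 1)) = - (\<zeta> * \<i> * of_real (sgn \<sigma>) * cis \<theta> * (cis (2 * \<theta>) - 1) * U k)"
    unfolding sgn_edge_p U_Suc by (simp add: algebra_simps)
  also have "\<dots> = \<zeta> * of_real (2 * (sgn \<sigma> * \<sigma>)) * (cis \<theta> * cis \<theta>) * U k"
    unfolding cis_double by (simp add: algebra_simps)
  also have "\<dots> = of_real (2 * (sgn \<sigma> * \<sigma>)) * \<zeta> * U (k + 1)"
    unfolding cc U_Suc by (simp add: mult_ac)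
  also have "2 * (sgn \<sigma> * \<sigma>) = \<mu> * (2 * cmod z * \<sigma> * \<rho>)"
    using z rho_pos by (simp add: \<mu>_def)
  finally show ?thesis unfolding vertex_area_grad_p by (simp add: mult_ac)
qed

lemma perimeter_grad_p: "perimeter_grad p = \<mu> *\<^sub>R area_grad p"
proof -
  have per: "sgn (edge p (k + CARD('n))) = sgn (edge p k)" for k by simp
  have "perimeter_grad p \<bullet> v = \<mu> *\<^sub>R area_grad p \<bullet> v" for v
  proof -
    have "perimeter_grad p \<bullet> v = (\<Sum>k<CARD('n). (sgn (edge p k) - sgn (edge p (k + 1))) \<bullet> vertex v (k + 1))"
      unfolding inner_perimeter_grad by (rule sum_by_parts_cyclic[of "\<lambda>k. sgn (edge p k)", OF per])
    also have "\<dots> = \<mu> * (\<Sum>k<CARD('n). vertex (area_grad p) (k + 1) \<bullet> vertex v (k + 1))"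
      unfolding sgn_edge_diff sum_distrib_left
      by (intro sum.cong refl) (simp add: scaleR_conv_of_real[where 'a = complex, symmetric])
    also have "(\<Sum>k<CARD('n). vertex (area_grad p) (k + 1) \<bullet> vertex v (k + 1)) = area_grad p \<bullet> v"
      unfolding inner_tuple
      by (rule cyclic_sum_shift_add[of "\<lambda>k. vertex (area_grad p) k \<bullet> vertex v k"]) simp
    finally show ?thesis by simp
  qed
  then show ?thesis by (metis inner_commute vector_eq_ldot)
qed

text \<open>The gradient is radial with the same size at every vertex. So a variation is tangent to
  the hypersurface exactly when its radial coordinates sum to zero.\<close>

lemma inner_area_grad_p: "area_grad p \<bullet> v = 2 * cmod z * \<sigma> * \<rho> * (\<Sum>k<n. xc v k)"
proof -
  have "area_grad p \<bullet> v = (\<Sum>k<CARD('n). vertex (area_grad p) (k + 1) \<bullet> vertex v (k + 1))"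
    unfolding inner_tuple
    by (rule cyclic_sum_shift_add[of "\<lambda>k. vertex (area_grad p) k \<bullet> vertex v k", symmetric]) simp
  also have "\<dots> = (\<Sum>k<CARD('n). 2 * cmod z * \<sigma> * \<rho> * xc v (k + 1))"
  proof (intro sum.cong refl)
    fix k
    have "vertex (area_grad p) (k + 1) = (2 * cmod z * \<sigma> * \<rho>) *\<^sub>R (\<zeta> * U (k + 1))"
      unfolding vertex_area_grad_p by (simp add: scaleR_conv_of_real[where 'a = complex] mult.assoc)
    then show "vertex (area_grad p) (k + 1) \<bullet> vertex v (k + 1) = 2 * cmod z * \<sigma> * \<rho> * xc v (k + 1)"
      by (simp only: qc_def Re_mult_cnj_inner inner_scaleR_left)
  qed
  also have "\<dots> = 2 * cmod z * \<sigma> * \<rho> * (\<Sum>k<n. xc v (k + 1))"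
    by (simp add: sum_distrib_left n_def)
  also have "(\<Sum>k<n. xc v (k + 1)) = (\<Sum>k<n. xc v k)"
    using qc_periodic[of v 0] by (intro cyclic_sum_shift) simp
  finally show ?thesis .
qed

definition lagrangian_hess :: "complex ^ 'n \<Rightarrow> complex ^ 'n" where
  "lagrangian_hess v = perimeter_hess p v - \<mu> *\<^sub>R area_grad v"

definition star_form :: "complex ^ 'n \<Rightarrow> complex ^ 'n \<Rightarrow> real" where
  "star_form v u = (\<Sum>k<n.
     \<sigma>\<^sup>2 * ((yc v (k + 1) - yc v k + \<sigma> / \<rho> * (xc v k + xc v (k + 1))) *
       (yc u (k + 1) - yc u k + \<sigma> / \<rho> * (xc u k + xc u (k + 1))))
     + ((xc v (k + 1) - xc v k) * (xc u (k + 1) - xc u k) - 4 * \<sigma>\<^sup>2 * (xc v k * xc u k)) / \<rho>\<^sup>2)"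

lemma edge_qc: "edge v k = \<zeta> * U k * (cis (2 * \<theta>) * qc v (k + 1) - qc v k)"
  unfolding edge_def vertex_qc U_Suc by (simp add: algebra_simps)

lemma Im_sgn_edge: "Im (cnj (sgn (edge p k)) * edge v k) =
    - (sgn \<sigma> * (\<rho> * (xc v (k + 1) - xc v k) - \<sigma> * (yc v (k + 1) + yc v k)))"
proof -
  have "cnj (sgn (edge p k)) * edge v k = ((\<zeta> * U k) * cnj (\<zeta> * U k)) *
      (- \<i> * of_real (sgn \<sigma>) * (cnj (cis \<theta>) * (cis (2 * \<theta>) * qc v (k + 1) - qc v k)))"
    unfolding sgn_edge_p edge_qc[of v] by simp
  also have "\<dots> = - \<i> * of_real (sgn \<sigma>) * (cis \<theta> * qc v (k + 1) - cnj (cis \<theta>) * qc v k)"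
  proof -
    have "cnj (cis \<theta>) * cis (2 * \<theta>) = cis \<theta>" by (simp add: cis_cnj cis_mult)
    then show ?thesis unfolding zU_cnj by (simp add: right_diff_distrib mult.assoc[symmetric])
  qed
  finally have eq: "cnj (sgn (edge p k)) * edge v k =
    - \<i> * of_real (sgn \<sigma>) * (cis \<theta> * qc v (k + 1) - cnj (cis \<theta>) * qc v k)" .
  show ?thesis unfolding eq by (simp add: \<sigma>_def[symmetric] \<rho>_def[symmetric] algebra_simps)
qed

lemma Im_cnj_vertex: "Im (cnj (vertex v k) * vertex u (k + 1)) =
    2 * \<sigma> * \<rho> * (xc v k * xc u (k + 1) + yc v k * yc u (k + 1))
      + (\<rho>\<^sup>2 - \<sigma>\<^sup>2) * (xc v k * yc u (k + 1) - yc v k * xc u (k + 1))"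
proof -
  have "cnj (vertex v k) * vertex u (k + 1) =
      ((\<zeta> * U k) * cnj (\<zeta> * U k)) * (cnj (qc v k) * (cis (2 * \<theta>) * qc u (k + 1)))"
    unfolding vertex_qc U_Suc by simp
  also have "\<dots> = cnj (qc v k) * (cis (2 * \<theta>) * qc u (k + 1))" unfolding zU_cnj by simp
  finally have eq: "cnj (vertex v k) * vertex u (k + 1) = cnj (qc v k) * (cis (2 * \<theta>) * qc u (k + 1))" .
  have "Im (cnj x * (t * y)) = Im t * (Re x * Re y + Im x * Im y) + Re t * (Re x * Im y - Im x * Re y)" for x y t
    by (simp add: algebra_simps)
  moreover have "Im (cis (2 * \<theta>)) = 2 * \<sigma> * \<rho>" "Re (cis (2 * \<theta>)) = \<rho>\<^sup>2 - \<sigma>\<^sup>2"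
    by (simp_all add: sin_double cos_double \<sigma>_def \<rho>_def)
  ultimately show ?thesis unfolding eq by (simp only:)
qed

text \<open>The factor is the common edge length, which clears the denominators of the perimeter
  Hessian. Edge by edge the two sides differ by G(k + 1) - G(k), and these differences sum to zero
  around the polygon.\<close>

lemma inner_lagrangian_hess: "2 * cmod z * \<bar>\<sigma>\<bar> * (u \<bullet> lagrangian_hess v) = star_form v u"
proof -
  let ?l = "2 * cmod z * \<bar>\<sigma>\<bar>"
  define A where "A v k = \<rho> * (xc v (k + 1) - xc v k) - \<sigma> * (yc v (k + 1) + yc v k)" for v k
  define E where "E v u k = 2 * \<sigma> * \<rho> * (xc v k * xc u (k + 1) + yc v k * yc u (k + 1))
      + (\<rho>\<^sup>2 - \<sigma>\<^sup>2) * (xc v k * yc u (k + 1) - yc v k * xc u (k + 1))" for v u k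
  define G where "G k = (\<rho>\<^sup>2 - (\<sigma> ^ 4 + 1) / \<rho>\<^sup>2) * (xc v k * xc u k) - \<sigma> / \<rho> * (xc v k * yc u k + yc v k * xc u k)" for k
  have l: "?l \<noteq> 0" using z sigma_sgn(2) by simp
  have sgn2: "- (sgn \<sigma> * a) * - (sgn \<sigma> * b) = a * b" for a b
    using sigma_sgn(2) by (simp add: sgn_if)
  have "u \<bullet> perimeter_hess p v = (\<Sum>k<n. A v k * A u k / ?l)"
    unfolding inner_perimeter_hess[OF edge_p_nonzero] Im_sgn_edge norm_edge_p A_def[symmetric] n_def
    by (simp only: sgn2)
  then have 1: "?l * (u \<bullet> perimeter_hess p v) = (\<Sum>k<n. A v k * A u k)"
    using l by (simp add: sum_distrib_left)
  have 2: "u \<bullet> area_grad v = (\<Sum>k<n. E v u k + E u v k) / 2"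
    unfolding inner_commute[of u] inner_area_grad Im_cnj_vertex E_def n_def ..
  have "sgn \<sigma> * \<bar>\<sigma>\<bar> = \<sigma>" by (simp add: sgn_mult_abs)
  then have mu: "?l * \<mu> = 2 * (\<sigma> / \<rho>)" using z rho_pos by (simp add: \<mu>_def field_simps)
  have "?l * (u \<bullet> lagrangian_hess v) = ?l * (u \<bullet> perimeter_hess p v) - (?l * \<mu>) * (u \<bullet> area_grad v)"
    by (simp add: lagrangian_hess_def inner_diff_right algebra_simps)
  also have "\<dots> = (\<Sum>k<n. A v k * A u k - \<sigma> / \<rho> * (E v u k + E u v k))"
    unfolding 1 2 mu by (simp add: sum_subtractf sum_distrib_left sum_divide_distrib)
  also have "\<dots> = star_form v u + (\<Sum>k<n. G (k + 1) - G k)"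
    unfolding star_form_def sum.distrib[symmetric] A_def E_def G_def
    using rho_pos sigma_rho by (intro sum.cong refl star_form_identity) auto
  also have "(\<Sum>k<n. G (k + 1) - G k) = 0"
    using cyclic_sum_shift[of G n] qc_periodic[of v 0] qc_periodic[of u 0] by (simp add: sum_subtractf G_def)
  finally show ?thesis by simp
qed

lemma linear_lagrangian_hess: "linear lagrangian_hess"
  unfolding lagrangian_hess_def
  by (intro linear_compose_sub linear_perimeter_hess[OF edge_p_nonzero] linear_compose_scale_right
      bounded_linear.linear[OF bounded_linear_area_grad])

lemma lagrangian_hess_sym: "v \<bullet> lagrangian_hess u = u \<bullet> lagrangian_hess v"
  unfolding lagrangian_hess_def inner_diff_right inner_scaleR_right
  using perimeter_hess_sym[OF edge_p_nonzero] area_grad_sym by (metis inner_commute)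

text \<open>Summation by parts. The assumption on x says that it is an eigenvector of the negative
  cyclic second difference, with eigenvalue l.\<close>

lemma sum_second_difference:
  fixes x \<xi> :: "nat \<Rightarrow> real"
  assumes x: "\<And>k. x (k + m) = x k" and \<xi>: "\<And>k. \<xi> (k + m) = \<xi> k"
    and eig: "\<And>k. x (k + 2) + x k = (2 - l) * x (k + 1)"
  shows "(\<Sum>k<m. (x (k + 1) - x k) * (\<xi> (k + 1) - \<xi> k)) = l * (\<Sum>k<m. x k * \<xi> k)"
proof -
  have "(\<Sum>k<m. (x (k + 1) - x k) * \<xi> k) = (\<Sum>k<m. (x (k + 2) - x (k + 1)) * \<xi> (k + 1))"
    using cyclic_sum_shift[of "\<lambda>k. (x (k + 1) - x k) * \<xi> k" m] x[of 0] x[of 1] \<xi>[of 0] by (simp add: add.commute)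
  then have "(\<Sum>k<m. (x (k + 1) - x k) * (\<xi> (k + 1) - \<xi> k)) =
      (\<Sum>k<m. (x (k + 1) - x k) * \<xi> (k + 1) - (x (k + 2) - x (k + 1)) * \<xi> (k + 1))"
    by (simp add: right_diff_distrib sum_subtractf)
  also have "\<dots> = (\<Sum>k<m. l * (x (k + 1) * \<xi> (k + 1)))"
  proof (intro sum.cong refl)
    fix k
    have "(x (k + 1) - x k) * \<xi> (k + 1) - (x (k + 2) - x (k + 1)) * \<xi> (k + 1) =
        (2 * x (k + 1) - (x (k + 2) + x k)) * \<xi> (k + 1)" by (simp add: algebra_simps)
    then show "(x (k + 1) - x k) * \<xi> (k + 1) - (x (k + 2) - x (k + 1)) * \<xi> (k + 1) = l * (x (k + 1) * \<xi> (k + 1))"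
      unfolding eig by (simp add: algebra_simps)
  qed
  also have "\<dots> = l * (\<Sum>k<m. x k * \<xi> k)"
    using cyclic_sum_shift[of "\<lambda>k. x k * \<xi> k" m] x[of 0] \<xi>[of 0] by (simp add: sum_distrib_left[symmetric])
  finally show ?thesis .
qed

lemma star_form_split: "star_form v u =
    \<sigma>\<^sup>2 * (\<Sum>k<n. (yc v (k + 1) - yc v k + \<sigma> / \<rho> * (xc v k + xc v (k + 1))) *
       (yc u (k + 1) - yc u k + \<sigma> / \<rho> * (xc u k + xc u (k + 1))))
     + ((\<Sum>k<n. (xc v (k + 1) - xc v k) * (xc u (k + 1) - xc u k)) - 4 * \<sigma>\<^sup>2 * (\<Sum>k<n. xc v k * xc u k)) / \<rho>\<^sup>2"
  unfolding star_form_def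
  by (simp add: sum.distrib sum_distrib_left[symmetric] sum_divide_distrib[symmetric] sum_subtractf)

text \<open>In the rotating frame an infinitesimal rotation about the center is a constant
  y-coordinate, and a translation is a fixed vector turning backwards. Both annihilate the first
  factor of \<open>star_form\<close>, and their x-coordinates have eigenvalue 4 \<sigma>^2, so the
  second part cancels as well.\<close>

lemma orbit_tangent_radical:
  assumes r: "r \<in> orbit_tangent p"
  shows "u \<bullet> lagrangian_hess r = 0" and "area_grad p \<bullet> r = 0"
proof -
  obtain t b where "r = (\<chi> i. \<i> * of_real t * p $ i + b)" using r by (auto simp: orbit_tangent_def)
  then have v: "vertex r k = \<i> * of_real t * vertex p k + b" for k by (simp add: vertex_def)
  \<comment> \<open>Rotation about the origin is rotation about c plus the translation
    \<open>\<i> * t * c\<close>, which joins b here.\<close>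
  define \<beta> where "\<beta> = cnj \<zeta> * (b + \<i> * of_real t * c)"
  have q: "qc r k = \<i> * of_real (t * cmod z) + \<beta> * cnj (U k)" for k
  proof -
    have "vertex r k = (\<i> * of_real (t * cmod z)) * (\<zeta> * U k) + (b + \<i> * of_real t * c)"
      unfolding v p vertex_star U_def[symmetric] n_def[symmetric] by (subst z_polar) (simp add: algebra_simps)
    then have "qc r k = (\<i> * of_real (t * cmod z)) * ((\<zeta> * U k) * cnj (\<zeta> * U k)) + \<beta> * cnj (U k)"
      by (simp add: qc_def \<beta>_def algebra_simps)
    then show ?thesis unfolding zU_cnj by simp
  qed
  define g where "g k = \<beta> * cnj (U k)" for k
  have g1: "g (k + 1) = cnj (cis (2 * \<theta>)) * g k" for k
    unfolding g_def U_Suc by (simp add: mult_ac)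
  have cd: "cos (2 * \<theta>) = 1 - 2 * \<sigma>\<^sup>2" "sin (2 * \<theta>) = 2 * \<sigma> * \<rho>"
    by (simp_all add: cos_double_sin sin_double \<sigma>_def \<rho>_def)
  have x1: "Re (g (k + 1)) = (1 - 2 * \<sigma>\<^sup>2) * Re (g k) + 2 * \<sigma> * \<rho> * Im (g k)"
    and y1: "Im (g (k + 1)) = (1 - 2 * \<sigma>\<^sup>2) * Im (g k) - 2 * \<sigma> * \<rho> * Re (g k)" for k
    unfolding g1 by (simp_all add: cd)
  have rho2: "\<rho>\<^sup>2 = 1 - \<sigma>\<^sup>2" using sigma_rho by simp
  have first: "yc r (k + 1) - yc r k + \<sigma> / \<rho> * (xc r k + xc r (k + 1)) = 0" for k
  proof -
    have "\<rho> * (Im (g (k + 1)) - Im (g k)) + \<sigma> * (Re (g k) + Re (g (k + 1))) =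
        2 * \<sigma> * Re (g k) * (1 - \<sigma>\<^sup>2 - \<rho>\<^sup>2)"
      unfolding x1 y1 by (simp add: algebra_simps power2_eq_square)
    also have "\<dots> = 0" unfolding rho2 by simp
    finally have "\<rho> * (Im (g (k + 1)) - Im (g k) + \<sigma> / \<rho> * (Re (g k) + Re (g (k + 1)))) = 0"
      using rho_pos by (simp add: distrib_left)
    then show ?thesis using rho_pos unfolding q g_def[symmetric] by simp
  qed
  have eig: "xc r (k + 2) + xc r k = (2 - 4 * \<sigma>\<^sup>2) * xc r (k + 1)" for k
  proof -
    have "Re (g (k + 2)) + Re (g k) = (2 - 4 * \<sigma>\<^sup>2) * Re (g (k + 1)) +
        4 * \<sigma>\<^sup>2 * Re (g k) * (1 - \<sigma>\<^sup>2 - \<rho>\<^sup>2)"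
      using x1[of "k + 1"] unfolding x1[of k] y1[of k] by (simp add: algebra_simps power2_eq_square)
    then show ?thesis unfolding q g_def[symmetric] rho2 by simp
  qed
  have "star_form r u = 0"
    unfolding star_form_split first
    using sum_second_difference[of "xc r" n "xc u", OF _ _ eig] qc_periodic by simp
  then have "2 * cmod z * \<bar>\<sigma>\<bar> * (u \<bullet> lagrangian_hess r) = 0" by (simp add: inner_lagrangian_hess)
  then show "u \<bullet> lagrangian_hess r = 0" using z sigma_sgn(2) by simp
  \<comment> \<open>Paired with the constant 1, whose differences vanish, the eigenvalue equation
    leaves 4 \<sigma>^2 times the sum.\<close>
  have "(\<Sum>k<n. xc r k) = 0"
    using sum_second_difference[of "xc r" n "\<lambda>_. 1", OF _ _ eig] qc_periodic sigma_sgn(2) by simp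
  then show "area_grad p \<bullet> r = 0" by (simp add: inner_area_grad_p)
qed

text \<open>
  Eigenvectors of the cyclic second difference. Unlike the separate sines and cosines, the sums
  are indexed uniformly by the \<open>n\<close> modes, whatever the parity of \<open>n\<close>.
\<close>

definition hart :: "nat \<Rightarrow> nat \<Rightarrow> real" where
  "hart j k = Re (unity n (int j * int k)) + Im (unity n (int j * int k))"

lemma hart_periodic: "hart j (k + n) = hart j k"
  using n_pos by (simp add: hart_def distrib_left unity_add)

text \<open>For a unit number v one has v^2 y + y = 2 Re v (v y), and 2 Re v is 2 - 4 times the
  squared sine of half the angle of v.\<close>

lemma hart_eigen: "hart j (k + 2) + hart j k = (2 - 4 * (sin (pi * real j / real n))\<^sup>2) * hart j (k + 1)"
proof -
  define v where "v = unity n (int j)"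
  define y where "y = unity n (int j * int k)"
  have u: "unity n (int j * int (k + 1)) = v * y" "unity n (int j * int (k + 2)) = v * (v * y)"
    by (simp_all add: v_def y_def unity_add[symmetric] algebra_simps)
  have cv: "v * cnj v = 1" by (simp add: v_def)
  have Rev: "2 * Re v = 2 - 4 * (sin (pi * real j / real n))\<^sup>2"
    using cos_double_sin[of "pi * real j / real n"] by (simp add: v_def unity_def mult.assoc)
  have "v * (v * y) + y = v * (v * y) + (v * cnj v) * y" unfolding cv by simp
  also have "\<dots> = (v + cnj v) * (v * y)" by (simp add: algebra_simps)
  also have "v + cnj v = of_real (2 * Re v)" by (simp add: complex_eq_iff)
  finally have e: "v * (v * y) + y = of_real (2 * Re v) * (v * y)" .
  then have "Re (v * (v * y)) + Re y = 2 * Re v * Re (v * y)" "Im (v * (v * y)) + Im y = 2 * Re v * Im (v * y)"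
  proof -
    have R: "Re (of_real r * x) = r * Re x" "Im (of_real r * x) = r * Im x" for r x by simp_all
    have "Re (v * (v * y)) + Re y = Re (v * (v * y) + y)" "Im (v * (v * y)) + Im y = Im (v * (v * y) + y)"
      by (simp_all only: plus_complex.sel)
    then show "Re (v * (v * y)) + Re y = 2 * Re v * Re (v * y)" "Im (v * (v * y)) + Im y = 2 * Re v * Im (v * y)"
      by (simp_all only: e R)
  qed
  then show ?thesis unfolding hart_def u y_def[symmetric] Rev[symmetric] by (simp add: algebra_simps)
qed

text \<open>A product of two such functions is the real part at the difference of the frequencies
  plus the imaginary part at their sum. The full sums of roots of unity are real, so only the real
  part survives, and only for equal frequencies.\<close>

lemma hart_orthogonal:
  assumes "j < n" "l < n"
  shows "(\<Sum>k<n. hart j k * hart l k) = (if j = l then real n else 0)"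
proof -
  have "hart j k * hart l k = Re (unity n ((int j - int l) * int k)) + Im (unity n ((int j + int l) * int k))" for k
  proof -
    have "unity n ((int j - int l) * int k) = unity n (int j * int k) * cnj (unity n (int l * int k))"
      "unity n ((int j + int l) * int k) = unity n (int j * int k) * unity n (int l * int k)"
      by (simp_all add: unity_add[symmetric] unity_uminus[symmetric] algebra_simps)
    then show ?thesis by (simp add: hart_def algebra_simps)
  qed
  then have "(\<Sum>k<n. hart j k * hart l k) =
      Re (\<Sum>k<n. unity n ((int j - int l) * int k)) + Im (\<Sum>k<n. unity n ((int j + int l) * int k))"
    by (simp add: sum.distrib)
  also have "\<dots> = (if j = l then real n else 0)"
    unfolding sum_unity[OF n_pos] dvd_diff_less_iff[OF assms] by simp
  finally show ?thesis .
qed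

definition m :: nat where "m = nat \<bar>w\<bar>"

lemma m_bounds: "0 < m" "2 * m < n"
  using w by (auto simp: m_def n_def)

definition synth :: "(nat \<Rightarrow> real) \<Rightarrow> (nat \<Rightarrow> real) \<Rightarrow> complex ^ 'n" where
  "synth x y = tuple (\<lambda>k. \<zeta> * U k * Complex (x k) (y k))"

lemma qc_synth:
  assumes "\<And>k. x (k + n) = x k" "\<And>k. y (k + n) = y k"
  shows "xc (synth x y) k = x k" "yc (synth x y) k = y k"
proof -
  have "vertex (synth x y) k = \<zeta> * U k * Complex (x k) (y k)"
    unfolding synth_def
    by (rule vertex_tuple_periodic) (use assms U_periodic in \<open>simp add: n_def\<close>)
  then have "qc (synth x y) k = ((\<zeta> * U k) * cnj (\<zeta> * U k)) * Complex (x k) (y k)"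
    by (simp add: qc_def mult_ac)
  then have "qc (synth x y) k = Complex (x k) (y k)" unfolding zU_cnj by simp
  then show "xc (synth x y) k = x k" "yc (synth x y) k = y k" by simp_all
qed

lemma qc_sum: "qc (\<Sum>j\<in>J. a j *\<^sub>R f j) k = (\<Sum>j\<in>J. a j *\<^sub>R qc (f j) k)"
proof -
  have "vertex (\<Sum>j\<in>J. a j *\<^sub>R f j) k = (\<Sum>j\<in>J. a j *\<^sub>R vertex (f j) k)"
    by (simp add: vertex_def)
  then show ?thesis by (simp add: qc_def sum_distrib_left)
qed

text \<open>Both sums are diagonal in the modes by orthogonality; on mode j the second difference
  has the eigenvalue 4 sin (pi j / n)^2.\<close>

lemma hart_energy:
  fixes a :: "nat \<Rightarrow> real"
  assumes J: "J \<subseteq> {..<n}"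
  defines "X \<equiv> \<lambda>k. \<Sum>j\<in>J. a j * hart j k"
  shows "(\<Sum>k<n. (X (k + 1) - X k) * (X (k + 1) - X k)) - 4 * \<sigma>\<^sup>2 * (\<Sum>k<n. X k * X k) =
    (\<Sum>j\<in>J. (a j)\<^sup>2 * (4 * real n * ((sin (pi * real j / real n))\<^sup>2 - \<sigma>\<^sup>2)))"
proof -
  have fin: "finite J" using J by (rule finite_subset) simp
  have Xper: "X (k + n) = X k" for k by (simp add: X_def hart_periodic)
  have hX: "(\<Sum>k<n. hart j k * X k) = real n * a j" if "j \<in> J" for j
  proof -
    have "(\<Sum>k<n. hart j k * X k) = (\<Sum>l\<in>J. a l * (\<Sum>k<n. hart j k * hart l k))"
      unfolding X_def sum_distrib_left by (subst sum.swap) (simp add: mult_ac)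
    also have "\<dots> = (\<Sum>l\<in>J. if l = j then real n * a j else 0)"
      using J that by (intro sum.cong) (auto simp: hart_orthogonal subset_iff)
    finally show ?thesis using fin that by simp
  qed
  have "(\<Sum>k<n. (X (k + 1) - X k) * (X (k + 1) - X k)) =
      (\<Sum>j\<in>J. a j * (\<Sum>k<n. (hart j (k + 1) - hart j k) * (X (k + 1) - X k)))"
  proof -
    have eq: "X (k + 1) - X k = (\<Sum>j\<in>J. a j * (hart j (k + 1) - hart j k))" for k
      by (simp add: X_def sum_subtractf right_diff_distrib)
    have "(X (k + 1) - X k) * d = (\<Sum>j\<in>J. a j * ((hart j (k + 1) - hart j k) * d))" for k d
      unfolding eq sum_distrib_right mult.assoc ..
    then have "(X (k + 1) - X k) * (X (k + 1) - X k) = (\<Sum>j\<in>J. a j * ((hart j (k + 1) - hart j k) * (X (k + 1) - X k)))" for k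
      by blast
    then show ?thesis by (simp only: sum_distrib_left) (subst sum.swap, simp)
  qed
  also have "\<dots> = (\<Sum>j\<in>J. a j * (4 * (sin (pi * real j / real n))\<^sup>2 * (real n * a j)))"
  proof (intro sum.cong refl)
    fix j assume "j \<in> J"
    have "(\<Sum>k<n. (hart j (k + 1) - hart j k) * (X (k + 1) - X k)) =
        4 * (sin (pi * real j / real n))\<^sup>2 * (\<Sum>k<n. hart j k * X k)"
      by (rule sum_second_difference[of "hart j" n X, OF hart_periodic Xper hart_eigen])
    then show "a j * (\<Sum>k<n. (hart j (k + 1) - hart j k) * (X (k + 1) - X k)) =
        a j * (4 * (sin (pi * real j / real n))\<^sup>2 * (real n * a j))"
      using hX[OF \<open>j \<in> J\<close>] by simp
  qed
  finally have 1: "(\<Sum>k<n. (X (k + 1) - X k) * (X (k + 1) - X k)) =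
      (\<Sum>j\<in>J. a j * (4 * (sin (pi * real j / real n))\<^sup>2 * (real n * a j)))" .
  have "(\<Sum>k<n. X k * X k) = (\<Sum>j\<in>J. a j * (\<Sum>k<n. hart j k * X k))"
  proof -
    have "X k * X k = (\<Sum>j\<in>J. a j * (hart j k * X k))" for k
      by (subst (1) X_def) (simp add: sum_distrib_right mult.assoc)
    then show ?thesis by (simp only: sum_distrib_left) (subst sum.swap, simp)
  qed
  also have "\<dots> = (\<Sum>j\<in>J. a j * (real n * a j))" using hX by simp
  finally have 2: "(\<Sum>k<n. X k * X k) = (\<Sum>j\<in>J. a j * (real n * a j))" .
  show ?thesis
    unfolding 1 2 sum_distrib_left sum_subtractf[symmetric]
    by (intro sum.cong refl) (simp add: algebra_simps power2_eq_square)
qed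

section \<open>Negative and positive modes\<close>

lemma sigma_m: "\<bar>\<sigma>\<bar> = sin (pi * real m / real n)"
proof -
  have "\<bar>\<sigma>\<bar> = sin \<bar>\<theta>\<bar>"
    using theta_bounds sin_gt_zero[of \<theta>] sin_gt_zero[of "- \<theta>"] by (auto simp: \<sigma>_def abs_if)
  moreover have "\<bar>\<theta>\<bar> = pi * real m / real n" using n_pos by (simp add: \<theta>_def m_def abs_mult)
  ultimately show ?thesis by simp
qed

lemma sin_mode_less:
  assumes "i < j" "2 * j \<le> n"
  shows "sin (pi * real i / real n) < sin (pi * real j / real n)"
proof (rule sin_monotone_2pi)
  have "2 * real j \<le> real n" using assms(2) by linarith
  then have "pi * (2 * real j) \<le> pi * real n" by simp
  then show "pi * real j / real n \<le> pi / 2" using n_pos by (simp add: field_simps)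
  show "pi * real i / real n < pi * real j / real n" using assms(1) n_pos by (simp add: field_simps)
  have "0 \<le> pi * real i / real n" by simp
  then show "- (pi / 2) \<le> pi * real i / real n" using pi_gt_zero by linarith
qed

lemma sin_mode_reflect: "j \<le> n \<Longrightarrow> sin (pi * real (n - j) / real n) = sin (pi * real j / real n)"
proof -
  assume "j \<le> n"
  then have "pi * real (n - j) / real n = pi - pi * real j / real n"
    using n_pos by (simp add: of_nat_diff field_simps)
  then show ?thesis by simp
qed

lemma sin_mode_nonneg: "j \<le> n \<Longrightarrow> 0 \<le> sin (pi * real j / real n)"
  using n_pos by (intro sin_ge_zero) (auto simp: field_simps)

text \<open>The sine of pi j / n increases up to j = n / 2 and is symmetric about it, so larger j
  are reflected to n - j.\<close>

lemma mode_below: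
  assumes "j < m \<or> n - m < j" "0 < j" "j < n"
  shows "(sin (pi * real j / real n))\<^sup>2 < \<sigma>\<^sup>2"
proof -
  have "sin (pi * real j / real n) < \<bar>\<sigma>\<bar>"
  proof (cases "j < m")
    case True
    then show ?thesis unfolding sigma_m using m_bounds by (intro sin_mode_less) auto
  next
    case False
    then have "sin (pi * real (n - j) / real n) < \<bar>\<sigma>\<bar>"
      unfolding sigma_m using m_bounds assms by (intro sin_mode_less) auto
    then show ?thesis using sin_mode_reflect[of j] assms by simp
  qed
  then show ?thesis using power_strict_mono[of "sin (pi * real j / real n)" "\<bar>\<sigma>\<bar>" 2] sin_mode_nonneg[of j] assms by simp
qed

lemma mode_above:
  assumes "m < j" "j < n - m"
  shows "\<sigma>\<^sup>2 < (sin (pi * real j / real n))\<^sup>2"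
proof -
  have "\<bar>\<sigma>\<bar> < sin (pi * real j / real n)"
  proof (cases "2 * j \<le> n")
    case True
    then show ?thesis unfolding sigma_m using assms by (intro sin_mode_less) auto
  next
    case False
    then have "\<bar>\<sigma>\<bar> < sin (pi * real (n - j) / real n)"
      unfolding sigma_m using assms by (intro sin_mode_less) auto
    then show ?thesis using sin_mode_reflect[of j] assms by simp
  qed
  then show ?thesis using power_strict_mono[of "\<bar>\<sigma>\<bar>" "sin (pi * real j / real n)" 2] by simp
qed

lemma hart_0: "hart 0 k = 1"
  by (simp add: hart_def)

lemma sum_hart: "0 < j \<Longrightarrow> j < n \<Longrightarrow> (\<Sum>k<n. hart j k) = 0"
  using hart_orthogonal[of j 0] n_pos by (simp add: hart_0)

text \<open>The \<open>y\<close>-coordinates that annihilate the first square of \<open>star_form\<close> when \<open>x = hart j\<close>.\<close>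

definition comp :: "nat \<Rightarrow> nat \<Rightarrow> real" where
  "comp j k = - (\<sigma> / \<rho>) * (\<Sum>i<k. hart j i + hart j (i + 1))"

lemma comp_step: "comp j (k + 1) - comp j k + \<sigma> / \<rho> * (hart j k + hart j (k + 1)) = 0"
  by (simp add: comp_def algebra_simps)

text \<open>The partial sums close up because a mode other than 0 has zero total.\<close>

lemma comp_periodic:
  assumes "0 < j" "j < n"
  shows "comp j (k + n) = comp j k"
proof (induction k)
  case 0
  have "(\<Sum>i<n. hart j (i + 1)) = (\<Sum>i<n. hart j i)"
    using hart_periodic[of j 0] by (intro cyclic_sum_shift) simp
  then have "(\<Sum>i<n. hart j i + hart j (i + 1)) = 0" using sum_hart[OF assms] by (simp add: sum.distrib)
  then show ?case by (simp add: comp_def)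
next
  case (Suc k)
  have "comp j (k + n + 1) - comp j (k + n) = comp j (k + 1) - comp j k"
    using comp_step[of j k] comp_step[of j "k + n"] hart_periodic[of j k] hart_periodic[of j "k + 1"]
    by (simp add: add_ac)
  then show ?case using Suc by (simp add: add_ac)
qed

text \<open>Left out are mode 0, which violates the area constraint, and the modes m and n - m with
  eigenvalue exactly 4 \<sigma>^2, which belong to translations.\<close>

definition "neg_modes = {j. 0 < j \<and> j < n \<and> (j < m \<or> n - m < j)}"
text \<open>Two kinds under one index: j below n stands for a mode in x with eigenvalue above 4
  \<sigma>^2, and j above n for a unit variation of the y-coordinate at vertex j - n. Vertex 0 is
  skipped because a constant y-coordinate is a rotation.\<close>

definition "pos_modes = {j. m < j \<and> j < n - m} \<union> {n + 1..<2 * n}"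
definition "neg_vec j = synth (hart j) (comp j)"
definition "pos_vec j = (if j < n then synth (hart j) (\<lambda>_. 0) else synth (\<lambda>_. 0) (\<lambda>k. if k mod n = j - n then 1 else 0))"
definition "neg_space = span (neg_vec ` neg_modes)"
definition "pos_space = span (pos_vec ` pos_modes)"

lemma finite_modes: "finite neg_modes" "finite pos_modes"
  unfolding neg_modes_def pos_modes_def by auto

lemma card_neg_modes: "card neg_modes = 2 * m - 2"
proof -
  have "neg_modes = {1..<m} \<union> {n - m + 1..<n}"
    using m_bounds by (auto simp: neg_modes_def)
  moreover have "{1..<m} \<inter> {n - m + 1..<n} = {}" using m_bounds by auto
  ultimately show ?thesis using m_bounds by (simp add: card_Un_disjoint)
qed

lemma card_pos_modes: "card pos_modes = 2 * n - 2 - 2 * m"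
proof -
  have "pos_modes = {m + 1..<n - m} \<union> {n + 1..<2 * n}" by (auto simp: pos_modes_def)
  moreover have "{m + 1..<n - m} \<inter> {n + 1..<2 * n} = {}" by auto
  ultimately show ?thesis using m_bounds by (simp add: card_Un_disjoint)
qed

lemma xc_neg_vec: "j \<in> neg_modes \<Longrightarrow> xc (neg_vec j) k = hart j k" "j \<in> neg_modes \<Longrightarrow> yc (neg_vec j) k = comp j k"
  unfolding neg_vec_def by (auto simp: qc_synth hart_periodic comp_periodic neg_modes_def)

lemma xc_pos_vec: "xc (pos_vec j) k = (if j < n then hart j k else 0)"
    "yc (pos_vec j) k = (if j < n then 0 else if k mod n = j - n then 1 else 0)"
  unfolding pos_vec_def by (auto simp: qc_synth hart_periodic)

text \<open>By linearity the accompanying y-coordinates annihilate the first square for every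
  combination of modes; only the diagonal energy of x remains.\<close>

lemma star_form_neg:
  assumes v: "v = (\<Sum>j\<in>neg_modes. a j *\<^sub>R neg_vec j)"
  shows "star_form v v = (\<Sum>j\<in>neg_modes. (a j)\<^sup>2 * (4 * real n * ((sin (pi * real j / real n))\<^sup>2 - \<sigma>\<^sup>2))) / \<rho>\<^sup>2"
    and "(\<Sum>k<n. xc v k) = 0"
proof -
  have x: "xc v k = (\<Sum>j\<in>neg_modes. a j * hart j k)" and y: "yc v k = (\<Sum>j\<in>neg_modes. a j * comp j k)" for k
    unfolding v qc_sum by (simp_all add: xc_neg_vec)
  have "yc v (k + 1) - yc v k + \<sigma> / \<rho> * (xc v k + xc v (k + 1)) =
      (\<Sum>j\<in>neg_modes. a j * (comp j (k + 1) - comp j k + \<sigma> / \<rho> * (hart j k + hart j (k + 1))))" for k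
    unfolding x y by (simp add: sum.distrib[symmetric] sum_subtractf[symmetric] sum_distrib_left algebra_simps)
  then have 0: "yc v (k + 1) - yc v k + \<sigma> / \<rho> * (xc v k + xc v (k + 1)) = 0" for k
    unfolding comp_step by simp
  have sub: "neg_modes \<subseteq> {..<n}" by (auto simp: neg_modes_def)
  show "star_form v v = (\<Sum>j\<in>neg_modes. (a j)\<^sup>2 * (4 * real n * ((sin (pi * real j / real n))\<^sup>2 - \<sigma>\<^sup>2))) / \<rho>\<^sup>2"
    unfolding star_form_split 0 unfolding x hart_energy[OF sub] by simp
  show "(\<Sum>k<n. xc v k) = 0"
    unfolding x by (subst sum.swap) (auto simp: sum_distrib_left[symmetric] sum_hart neg_modes_def intro!: sum.neutral)
qed

lemma star_form_neg_less:
  assumes v: "v = (\<Sum>j\<in>neg_modes. a j *\<^sub>R neg_vec j)" and a: "\<exists>j\<in>neg_modes. a j \<noteq> 0"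
  shows "star_form v v < 0"
proof -
  have neg: "4 * real n * ((sin (pi * real j / real n))\<^sup>2 - \<sigma>\<^sup>2) < 0" if "j \<in> neg_modes" for j
    using that mode_below[of j] n_pos by (auto simp: neg_modes_def mult_less_0_iff)
  obtain j0 where j0: "j0 \<in> neg_modes" "a j0 \<noteq> 0" using a by blast
  have "(\<Sum>j\<in>neg_modes. (a j)\<^sup>2 * (4 * real n * ((sin (pi * real j / real n))\<^sup>2 - \<sigma>\<^sup>2))) < (\<Sum>j\<in>neg_modes. 0)"
  proof (rule sum_strict_mono_ex1[OF finite_modes(1)])
    show "\<forall>j\<in>neg_modes. (a j)\<^sup>2 * (4 * real n * ((sin (pi * real j / real n))\<^sup>2 - \<sigma>\<^sup>2)) \<le> 0"
      using neg by (blast intro: mult_nonneg_nonpos zero_le_power2 less_imp_le)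
    show "\<exists>j\<in>neg_modes. (a j)\<^sup>2 * (4 * real n * ((sin (pi * real j / real n))\<^sup>2 - \<sigma>\<^sup>2)) < 0"
      using j0 neg[OF j0(1)] by (blast intro: mult_pos_neg zero_less_power2[THEN iffD2])
  qed
  then show ?thesis using rho_pos by (simp add: star_form_neg(1)[OF v] divide_less_0_iff)
qed

text \<open>Both parts of the form are nonnegative. If the form vanishes, the strict eigenvalue gap
  removes all modes in x; the remaining squares then make y constant, and its value at vertex 0 is
  zero.\<close>

lemma star_form_pos_greater:
  assumes v: "v = (\<Sum>j\<in>pos_modes. a j *\<^sub>R pos_vec j)" and a: "\<exists>j\<in>pos_modes. a j \<noteq> 0"
  shows "star_form v v > 0"
proof -
  define J where "J = {j. m < j \<and> j < n - m}"
  have J: "J \<subseteq> {..<n}" "finite J" "J = {j \<in> pos_modes. j < n}"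
    by (auto simp: J_def pos_modes_def)
  have x: "xc v k = (\<Sum>j\<in>J. a j * hart j k)" for k
  proof -
    have "xc v k = (\<Sum>j\<in>pos_modes. if j < n then a j * hart j k else 0)"
      unfolding v qc_sum Re_sum by (intro sum.cong) (simp_all add: xc_pos_vec)
    also have "\<dots> = (\<Sum>j\<in>J. a j * hart j k)"
      unfolding J(3) by (rule sum.inter_filter[symmetric, OF finite_modes(2)])
    finally show ?thesis .
  qed
  have y: "yc v k = (\<Sum>j\<in>pos_modes. if j = n + k then a j else 0)" if "k < n" for k
    unfolding v qc_sum Im_sum
    by (intro sum.cong refl) (use that in \<open>auto simp: xc_pos_vec pos_modes_def\<close>)
  have y0: "yc v 0 = 0" using n_pos by (subst y) (auto simp: pos_modes_def intro!: sum.neutral)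
  define S1 where "S1 = (\<Sum>k<n. (yc v (k + 1) - yc v k + \<sigma> / \<rho> * (xc v k + xc v (k + 1))) *
       (yc v (k + 1) - yc v k + \<sigma> / \<rho> * (xc v k + xc v (k + 1))))"
  define S2 where "S2 = (\<Sum>j\<in>J. (a j)\<^sup>2 * (4 * real n * ((sin (pi * real j / real n))\<^sup>2 - \<sigma>\<^sup>2)))"
  have form: "star_form v v = \<sigma>\<^sup>2 * S1 + S2 / \<rho>\<^sup>2"
    unfolding star_form_split S1_def[symmetric] S2_def using hart_energy[OF J(1), of a] by (simp add: x)
  have S1: "S1 \<ge> 0" unfolding S1_def by (intro sum_nonneg) simp
  have pos: "4 * real n * ((sin (pi * real j / real n))\<^sup>2 - \<sigma>\<^sup>2) > 0" if "j \<in> J" for j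
    using that mode_above[of j] n_pos by (auto simp: J_def)
  have S2t: "(a j)\<^sup>2 * (4 * real n * ((sin (pi * real j / real n))\<^sup>2 - \<sigma>\<^sup>2)) \<ge> 0" if "j \<in> J" for j
    by (intro mult_nonneg_nonneg zero_le_power2 less_imp_le[OF pos[OF that]])
  then have S2: "S2 \<ge> 0" unfolding S2_def by (rule sum_nonneg)
  have "star_form v v \<ge> 0" unfolding form using S1 S2 by simp
  moreover have "star_form v v \<noteq> 0"
  proof
    assume 0: "star_form v v = 0"
    have z1: "\<sigma>\<^sup>2 * S1 \<ge> 0" and z2: "S2 / \<rho>\<^sup>2 \<ge> 0" using S1 S2 by simp_all
    have "\<sigma>\<^sup>2 * S1 = 0" "S2 / \<rho>\<^sup>2 = 0" using z1 z2 0 unfolding form by linarith+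
    then have "S1 = 0" "S2 = 0" using sigma_sgn(2) rho_pos by simp_all
    have aJ: "a j = 0" if "j \<in> J" for j
    proof -
      have "S2 = 0 \<longleftrightarrow> (\<forall>j\<in>J. (a j)\<^sup>2 * (4 * real n * ((sin (pi * real j / real n))\<^sup>2 - \<sigma>\<^sup>2)) = 0)"
        unfolding S2_def by (rule sum_nonneg_eq_0_iff[OF J(2)]) (rule S2t)
      then have "(a j)\<^sup>2 * (4 * real n * ((sin (pi * real j / real n))\<^sup>2 - \<sigma>\<^sup>2)) = 0"
        using \<open>S2 = 0\<close> that by blast
      then show ?thesis using pos[OF that] by (simp only: mult_eq_0_iff power2_eq_square) auto
    qed
    then have x0: "xc v k = 0" for k by (simp add: x)
    have "\<forall>k\<in>{..<n}. (yc v (k + 1) - yc v k) * (yc v (k + 1) - yc v k) = 0"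
      using \<open>S1 = 0\<close> unfolding S1_def x0 by (subst (asm) sum_nonneg_eq_0_iff) auto
    then have "yc v (k + 1) = yc v k" if "k < n" for k using that by simp
    then have ycz: "yc v k = 0" if "k < n" for k using that
    proof (induction k)
      case (Suc k)
      then show ?case using Suc.prems by simp
    qed (rule y0)
    have "a j = 0" if "j \<in> pos_modes" for j
    proof (cases "j < n")
      case True
      then show ?thesis using aJ that J(3) by auto
    next
      case False
      then have j: "n + (j - n) = j" "j - n < n" using that by (auto simp: pos_modes_def)
      have "yc v (j - n) = a j" using y[OF j(2)] that finite_modes(2) unfolding j(1) by simp
      then show ?thesis using ycz[OF j(2)] by simp
    qed
    then show False using a by blast
  qed
  ultimately show ?thesis by simp
qed

lemma star_form_0: "star_form 0 0 = 0"
  by (simp add: star_form_def qc_def)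

lemma dim_neg_space: "dim neg_space = 2 * m - 2"
  unfolding neg_space_def card_neg_modes[symmetric]
proof (rule dim_span_family[OF finite_modes(1)], rule ccontr)
  fix a assume "(\<Sum>j\<in>neg_modes. a j *\<^sub>R neg_vec j) = 0" "\<not> (\<forall>j\<in>neg_modes. a j = 0)"
  then show False using star_form_neg_less[of 0 a] star_form_0 by auto
qed

lemma dim_pos_space: "dim pos_space = 2 * n - 2 - 2 * m"
  unfolding pos_space_def card_pos_modes[symmetric]
proof (rule dim_span_family[OF finite_modes(2)], rule ccontr)
  fix a assume "(\<Sum>j\<in>pos_modes. a j *\<^sub>R pos_vec j) = 0" "\<not> (\<forall>j\<in>pos_modes. a j = 0)"
  then show False using star_form_pos_greater[of 0 a] star_form_0 by auto
qed

definition "tangent = {v. area_grad p \<bullet> v = 0}"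

lemma sign_from_form: "star_form v v < 0 \<Longrightarrow> v \<bullet> lagrangian_hess v < 0" "star_form v v > 0 \<Longrightarrow> v \<bullet> lagrangian_hess v > 0"
proof -
  have "2 * cmod z * \<bar>\<sigma>\<bar> > 0" using z sigma_sgn(2) by simp
  then show "star_form v v < 0 \<Longrightarrow> v \<bullet> lagrangian_hess v < 0" "star_form v v > 0 \<Longrightarrow> v \<bullet> lagrangian_hess v > 0"
    unfolding inner_lagrangian_hess[symmetric] by (simp_all only: mult_less_0_iff zero_less_mult_iff) auto
qed

lemma neg_space_negative: "v \<in> neg_space \<Longrightarrow> v \<noteq> 0 \<Longrightarrow> v \<bullet> lagrangian_hess v < 0"
proof -
  assume "v \<in> neg_space" "v \<noteq> 0"
  then obtain a where a: "v = (\<Sum>j\<in>neg_modes. a j *\<^sub>R neg_vec j)"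
    unfolding neg_space_def using span_familyE finite_modes(1) by metis
  then have "\<exists>j\<in>neg_modes. a j \<noteq> 0" using \<open>v \<noteq> 0\<close> by (metis (no_types, lifting) scaleR_zero_left sum.neutral)
  then show ?thesis using star_form_neg_less[OF a] sign_from_form by blast
qed

lemma pos_space_positive: "v \<in> pos_space \<Longrightarrow> v \<noteq> 0 \<Longrightarrow> v \<bullet> lagrangian_hess v > 0"
proof -
  assume "v \<in> pos_space" "v \<noteq> 0"
  then obtain a where a: "v = (\<Sum>j\<in>pos_modes. a j *\<^sub>R pos_vec j)"
    unfolding pos_space_def using span_familyE finite_modes(2) by metis
  then have "\<exists>j\<in>pos_modes. a j \<noteq> 0" using \<open>v \<noteq> 0\<close> by (metis (no_types, lifting) scaleR_zero_left sum.neutral)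
  then show ?thesis using star_form_pos_greater[OF a] sign_from_form by blast
qed

lemma subspace_tangent: "subspace tangent"
  by (auto simp: tangent_def subspace_def inner_add_right)

lemma neg_space_tangent: "neg_space \<subseteq> tangent"
  unfolding neg_space_def
proof (rule span_minimal[OF _ subspace_tangent], clarify)
  fix j assume "j \<in> neg_modes"
  then have "(\<Sum>k<n. xc (neg_vec j) k) = 0" by (simp add: xc_neg_vec sum_hart neg_modes_def)
  then show "neg_vec j \<in> tangent" by (simp add: tangent_def inner_area_grad_p)
qed

lemma pos_space_tangent: "pos_space \<subseteq> tangent"
  unfolding pos_space_def
proof (rule span_minimal[OF _ subspace_tangent], clarify)
  fix j assume "j \<in> pos_modes"
  then have "(\<Sum>k<n. xc (pos_vec j) k) = 0"
    by (cases "j < n") (auto simp: xc_pos_vec sum_hart pos_modes_def)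
  then show "pos_vec j \<in> tangent" by (simp add: tangent_def inner_area_grad_p)
qed

lemma area_p: "area p \<noteq> 0" "sgn (area p) = sgn (of_int w)"
proof -
  have "area p = real n * (cmod z)\<^sup>2 * \<rho> * \<sigma>"
  proof -
    have "2 * pi * of_int w / real CARD('n) = 2 * \<theta>" by (simp add: \<theta>_def n_def)
    then have sd: "sin (2 * pi * of_int w / real CARD('n)) = 2 * \<sigma> * \<rho>"
      by (simp only: sin_double \<sigma>_def \<rho>_def)
    show ?thesis
      unfolding p area_star[OF not_dvd_small[OF w]] sd by (simp add: n_def)
  qed
  moreover have "sgn (real n * (cmod z)\<^sup>2 * \<rho>) = 1" using n_pos z rho_pos by simp
  ultimately show "sgn (area p) = sgn (of_int w)" by (simp add: sgn_mult sigma_sgn(1))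
  moreover have "sgn (real_of_int w) \<noteq> 0" using w(1) by (simp add: sgn_zero_iff)
  ultimately show "area p \<noteq> 0" by auto
qed

lemma area_grad_p_nonzero: "area_grad p \<noteq> 0"
  using area_grad_self[of p] area_p(1) by auto

lemma dim_tangent: "dim tangent = 2 * n - 1"
  using dim_hyperplane[OF area_grad_p_nonzero] by (simp add: tangent_def n_def)

lemma p_nonconst: "p \<in> nonconst_tuples"
  unfolding p using star_nonconst_iff z not_dvd_small[OF w] by blast

text \<open>Serves both variational problems: s = 1 for the perimeter at fixed area, and s = - 1 /
  \<mu> for the area at fixed perimeter. A negative s exchanges the roles of
  \<open>neg_space\<close> and \<open>pos_space\<close>. The dimensions 2 m - 2, 2 n - 2 - 2 m and 3
  add up to 2 n - 1, as \<open>pullback_index\<close> requires.\<close>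

lemma index_of_restriction:
  assumes hess: "restricted_hessian F f p V H"
    and F: "GDERIV F p :> gF" "gF = b *\<^sub>R area_grad p" "b \<noteq> 0"
    and L: "\<forall>\<^sub>F y in nhds p. GDERIV L y :> gL y" "gL p = 0"
      "(gL has_derivative (\<lambda>v. s *\<^sub>R lagrangian_hess v)) (at p)"
    and f: "\<And>y. f y = L y + d * F y" and s: "s \<noteq> 0"
  shows "negative_index V H = (if s > 0 then 2 * m - 2 else 2 * n - 2 - 2 * m)"
    and "\<And>v. v \<in> V \<Longrightarrow> (\<And>u. u \<in> V \<Longrightarrow> u \<bullet> H v = 0) \<Longrightarrow> v = 0"
proof -
  obtain \<phi> g0 where chart: "local_chart F p V \<phi>" and g: "has_grad_hessian (f \<circ> \<phi>) 0 g0 H"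
    using hess by (auto simp: restricted_hessian_def)
  define D where "D = frechet_derivative \<phi> (at 0)"
  have V: "subspace V" "dim V = 2 * n - 4" "\<And>v. v \<in> V \<Longrightarrow> D v \<in> orbit_tangent p \<Longrightarrow> v = 0" "C2_near \<phi> 0"
    using chart unfolding D_def n_def by (auto simp: local_chart_def)
  obtain \<phi>' where "\<forall>\<^sub>F y in nhds 0. (\<phi> has_derivative blinfun_apply (\<phi>' y)) (at y)" using V(4) by (rule C2_nearE)
  then have "(\<phi> has_derivative blinfun_apply (\<phi>' 0)) (at 0)" by (rule eventually_nhds_x_imp_x)
  then have linD: "linear D" unfolding D_def
    using frechet_derivative_at has_derivative_linear by metis
  have linQ: "linear (\<lambda>v. s *\<^sub>R lagrangian_hess v)"
    by (rule linear_compose_scale_right[OF linear_lagrangian_hess])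
  have DT: "D v \<in> tangent" if "v \<in> V" for v
    using chart_tangent[OF chart F(1) that] F(2,3) by (simp add: tangent_def D_def)
  have rad: "x \<bullet> (s *\<^sub>R lagrangian_hess r) = 0" if "r \<in> orbit_tangent p" for x r
    using orbit_tangent_radical(1)[OF that] by simp
  have RT: "orbit_tangent p \<subseteq> tangent" using orbit_tangent_radical(2) by (auto simp: tangent_def)
  have sym: "x \<bullet> (s *\<^sub>R lagrangian_hess y) = y \<bullet> (s *\<^sub>R lagrangian_hess x)" for x y
    using lagrangian_hess_sym[of x y] by simp
  have dims: "dim V + dim (orbit_tangent p) = dim tangent"
    using V(2) dim_orbit_tangent[OF p_nonconst] dim_tangent n_ge_3 by simp
  have dims2: "dim neg_space + dim pos_space + dim (orbit_tangent p) = dim tangent"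
    using dim_neg_space dim_pos_space dim_orbit_tangent[OF p_nonconst] dim_tangent m_bounds by simp
  have HD: "u \<bullet> H v = D u \<bullet> (s *\<^sub>R lagrangian_hess (D v))" if "v \<in> V" "u \<in> V" for v u
    unfolding D_def by (rule hessian_pullback(1)[OF chart L f g that])
  have sub: "subspace neg_space" "subspace pos_space" by (auto simp: neg_space_def pos_space_def)
  show "negative_index V H = (if s > 0 then 2 * m - 2 else 2 * n - 2 - 2 * m)"
    and "\<And>v. v \<in> V \<Longrightarrow> (\<And>u. u \<in> V \<Longrightarrow> u \<bullet> H v = 0) \<Longrightarrow> v = 0"
  proof (atomize (full), cases "s > 0")
    case True
    have neg: "x \<bullet> (s *\<^sub>R lagrangian_hess x) < 0" if "x \<in> neg_space" "x \<noteq> 0" for x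
      using neg_space_negative[OF that] True by (simp add: mult_pos_neg)
    have pos: "x \<bullet> (s *\<^sub>R lagrangian_hess x) > 0" if "x \<in> pos_space" "x \<noteq> 0" for x
      using pos_space_positive[OF that] True by simp
    note * = pullback_index[OF V(1) subspace_tangent subspace_orbit_tangent sub(1,2) linD linQ DT V(3) RT rad sym
      neg_space_tangent neg pos_space_tangent pos dims dims2 HD]
    show "negative_index V H = (if s > 0 then 2 * m - 2 else 2 * n - 2 - 2 * m) \<and>
      (\<forall>v. v \<in> V \<longrightarrow> (\<forall>u. u \<in> V \<longrightarrow> u \<bullet> H v = 0) \<longrightarrow> v = 0)"
    proof (intro conjI allI impI)
      show "negative_index V H = (if s > 0 then 2 * m - 2 else 2 * n - 2 - 2 * m)" using *(1) True dim_neg_space by simp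
      show "v = 0" if "v \<in> V" "\<forall>u. u \<in> V \<longrightarrow> u \<bullet> H v = 0" for v using *(2)[of v] that by blast
    qed
  next
    case False
    then have s0: "s < 0" using s by simp
    have neg: "x \<bullet> (s *\<^sub>R lagrangian_hess x) < 0" if "x \<in> pos_space" "x \<noteq> 0" for x
      using pos_space_positive[OF that] s0 by (simp add: mult_neg_pos)
    have pos: "x \<bullet> (s *\<^sub>R lagrangian_hess x) > 0" if "x \<in> neg_space" "x \<noteq> 0" for x
      using neg_space_negative[OF that] s0 by (simp add: mult_neg_neg)
    have dims3: "dim pos_space + dim neg_space + dim (orbit_tangent p) = dim tangent" using dims2 by simp
    note * = pullback_index[OF V(1) subspace_tangent subspace_orbit_tangent sub(2,1) linD linQ DT V(3) RT rad sym
      pos_space_tangent neg neg_space_tangent pos dims dims3 HD]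
    show "negative_index V H = (if s > 0 then 2 * m - 2 else 2 * n - 2 - 2 * m) \<and>
      (\<forall>v. v \<in> V \<longrightarrow> (\<forall>u. u \<in> V \<longrightarrow> u \<bullet> H v = 0) \<longrightarrow> v = 0)"
    proof (intro conjI allI impI)
      show "negative_index V H = (if s > 0 then 2 * m - 2 else 2 * n - 2 - 2 * m)" using *(1) False dim_pos_space by simp
      show "v = 0" if "v \<in> V" "\<forall>u. u \<in> V \<longrightarrow> u \<bullet> H v = 0" for v using *(2)[of v] that by blast
    qed
  qed
qed

end

section \<open>Charts, indices and criticality at a star\<close>

lemma area_scaleR: "area (r *\<^sub>R (x :: complex ^ 'n :: finite)) = r\<^sup>2 * area x"
  unfolding area_eq_Im by (simp add: sum_distrib_left power2_eq_square algebra_simps)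

lemma perimeter_scaleR: "perimeter (r *\<^sub>R (x :: complex ^ 'n :: finite)) = \<bar>r\<bar> * perimeter x"
  by (simp add: perimeter_edge sum_distrib_left)

lemma C2_near_area:
  fixes f :: "'a :: real_normed_vector \<Rightarrow> complex ^ 'n :: finite"
  assumes "C2_near f x"
  shows "C2_near (\<lambda>v. area (f v)) x"
proof -
  have "C2_near (\<lambda>v. (area_grad (f v) \<bullet> f v) / 2) x"
    by (rule C2_near_linear_compose[OF bounded_linear_divide])
       (intro C2_near_bilinear[OF bounded_bilinear_inner] C2_near_linear_compose[OF bounded_linear_area_grad] assms)
  then show ?thesis by (simp add: area_grad_self)
qed

lemma C2_near_perimeter:
  fixes f :: "'a :: real_normed_vector \<Rightarrow> complex ^ 'n :: finite"
  assumes "C2_near f x" "\<And>k. edge (f x) k \<noteq> 0"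
  shows "C2_near (\<lambda>v. perimeter (f v)) x"
  unfolding perimeter_edge
  by (intro C2_near_sum C2_near_norm C2_near_linear_compose[OF bounded_linear_edge] assms)

lemma C2_near_eventually_pos:
  fixes g :: "'a :: real_normed_vector \<Rightarrow> real"
  assumes "C2_near g x" "g x > 0"
  shows "\<forall>\<^sub>F y in nhds x. g y > 0"
proof -
  have "isCont g x"
    using C1_near_imp_isCont[OF C2_near_imp_C1_near[OF assms(1)]] by (rule eventually_nhds_x_imp_x)
  then have "(g \<longlongrightarrow> g x) (nhds x)" by (simp add: continuous_at tendsto_at_iff_tendsto_nhds)
  then show ?thesis using assms(2) by (rule order_tendstoD(1))
qed

lemma GDERIV_diff_scale:
  assumes "GDERIV f x :> a" "GDERIV g x :> b"
  shows "GDERIV (\<lambda>y. f y - r * g y) x :> a - r *\<^sub>R b"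
  using assms unfolding gderiv_def
  by (auto intro!: derivative_eq_intros simp: inner_diff_right)

context winding_polygon
begin

text \<open>The area is homogeneous of degree two, so the scaling factor is the square root of the
  ratio of areas; for the perimeter, of degree one, it will be the ratio itself.\<close>

lemma ex_area_chart: "\<exists>V \<phi>. local_chart area p V \<phi>"
proof -
  have pv: "C2_near (\<lambda>v. p + v) 0" by (intro C2_near_add C2_near_const C2_near_id)
  define g where "g v = area p * inverse (area (p + v))" for v
  have g: "C2_near g 0" unfolding g_def
    by (rule C2_near_linear_compose[OF bounded_linear_mult_right])
       (intro C2_near_inverse C2_near_area pv, simp add: area_p)
  have g0: "g 0 = 1" using area_p(1) by (simp add: g_def)
  have "\<forall>\<^sub>F v in nhds 0. g v > 0" by (rule C2_near_eventually_pos[OF g]) (simp add: g0)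
  then have "\<forall>\<^sub>F v in nhds 0. area (sqrt (g v) *\<^sub>R (p + v)) = area p"
  proof eventually_elim
    case (elim v)
    then have "area (p + v) \<noteq> 0" by (auto simp: g_def)
    then show ?case using elim by (simp add: area_scaleR) (simp add: g_def)
  qed
  then show ?thesis
    using local_chart_scaling[OF p_nonconst _ C2_near_sqrt[OF g], of area] g0 n_ge_3 by (auto simp: n_def)
qed

lemma perimeter_pos: "perimeter p > 0"
  unfolding perimeter_edge norm_edge_p using z sigma_sgn(2) by simp

lemma ex_perimeter_chart: "\<exists>V \<phi>. local_chart perimeter p V \<phi>"
proof -
  have pv: "C2_near (\<lambda>v. p + v) 0" by (intro C2_near_add C2_near_const C2_near_id)
  define g where "g v = perimeter p * inverse (perimeter (p + v))" for v
  have g: "C2_near g 0" unfolding g_def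
    by (rule C2_near_linear_compose[OF bounded_linear_mult_right])
       (intro C2_near_inverse C2_near_perimeter pv, use perimeter_pos edge_p_nonzero in simp_all)
  have g0: "g 0 = 1" using perimeter_pos by (simp add: g_def)
  have "\<forall>\<^sub>F v in nhds 0. g v > 0" by (rule C2_near_eventually_pos[OF g]) (simp add: g0)
  then have "\<forall>\<^sub>F v in nhds 0. perimeter (g v *\<^sub>R (p + v)) = perimeter p"
  proof eventually_elim
    case (elim v)
    then have "perimeter (p + v) \<noteq> 0" by (auto simp: g_def)
    then show ?case using elim by (simp add: perimeter_scaleR) (simp add: g_def)
  qed
  then show ?thesis
    using local_chart_scaling[OF p_nonconst _ g g0, of perimeter] n_ge_3 by (auto simp: n_def)
qed

lemma mu_sgn: "sgn \<mu> = sgn (of_int w)" "\<mu> \<noteq> 0"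
proof -
  show "sgn \<mu> = sgn (of_int w)"
    using z rho_pos by (simp add: \<mu>_def sigma_sgn(1)[symmetric] sgn_divide sgn_mult)
  show "\<mu> \<noteq> 0" using z rho_pos sigma_sgn(2) by (simp add: \<mu>_def sgn_zero_iff)
qed

lemma area_lagrangian:
  defines "gL \<equiv> \<lambda>y. perimeter_grad y - \<mu> *\<^sub>R area_grad y"
  shows "\<forall>\<^sub>F y in nhds p. GDERIV (\<lambda>y. perimeter y - \<mu> * area y) y :> gL y" "gL p = 0"
    "(gL has_derivative (\<lambda>v. 1 *\<^sub>R lagrangian_hess v)) (at p)"
proof -
  show "\<forall>\<^sub>F y in nhds p. GDERIV (\<lambda>y. perimeter y - \<mu> * area y) y :> gL y"
    using eventually_edges_nonzero[OF edge_p_nonzero] unfolding gL_def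
    by eventually_elim (intro GDERIV_diff_scale GDERIV_perimeter GDERIV_area, simp)
  show "gL p = 0" by (simp add: gL_def perimeter_grad_p)
  show "(gL has_derivative (\<lambda>v. 1 *\<^sub>R lagrangian_hess v)) (at p)"
    unfolding gL_def lagrangian_hess_def scaleR_one
    by (intro has_derivative_diff perimeter_grad_has_derivative edge_p_nonzero has_derivative_scaleR_right
        bounded_linear.has_derivative[OF bounded_linear_area_grad] has_derivative_ident)
qed

text \<open>This Lagrangian is - 1 / \<mu> times the one for fixed area, whence the factor in the
  Hessian.\<close>

lemma perimeter_lagrangian:
  defines "gL \<equiv> \<lambda>y. area_grad y - (1 / \<mu>) *\<^sub>R perimeter_grad y"
  shows "\<forall>\<^sub>F y in nhds p. GDERIV (\<lambda>y. area y - 1 / \<mu> * perimeter y) y :> gL y" "gL p = 0"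
    "(gL has_derivative (\<lambda>v. (- 1 / \<mu>) *\<^sub>R lagrangian_hess v)) (at p)"
proof -
  show "\<forall>\<^sub>F y in nhds p. GDERIV (\<lambda>y. area y - 1 / \<mu> * perimeter y) y :> gL y"
    using eventually_edges_nonzero[OF edge_p_nonzero] unfolding gL_def
    by eventually_elim (intro GDERIV_diff_scale GDERIV_perimeter GDERIV_area, simp)
  show "gL p = 0" using mu_sgn(2) by (simp add: gL_def perimeter_grad_p)
  have "(gL has_derivative (\<lambda>v. area_grad v - (1 / \<mu>) *\<^sub>R perimeter_hess p v)) (at p)"
    unfolding gL_def
    by (intro has_derivative_diff perimeter_grad_has_derivative edge_p_nonzero has_derivative_scaleR_right
        bounded_linear.has_derivative[OF bounded_linear_area_grad] has_derivative_ident)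
  moreover have "area_grad v - (1 / \<mu>) *\<^sub>R perimeter_hess p v = (- 1 / \<mu>) *\<^sub>R lagrangian_hess v" for v
    using mu_sgn(2) by (simp add: lagrangian_hess_def scaleR_diff_right)
  ultimately show "(gL has_derivative (\<lambda>v. (- 1 / \<mu>) *\<^sub>R lagrangian_hess v)) (at p)" by simp
qed

text \<open>The Morse index is a definite description over all charts, so at least one Hessian has
  to exist before its uniqueness can determine a value.\<close>

lemma ex_restricted_hessian:
  assumes chart: "\<exists>V \<phi>. local_chart F p V \<phi>"
    and L: "\<forall>\<^sub>F y in nhds p. GDERIV L y :> gL y" "gL p = 0" "(gL has_derivative Q) (at p)"
    and f: "\<And>y. f y = L y + d * F y"
    and C2: "\<And>\<phi>. C2_near \<phi> 0 \<Longrightarrow> \<phi> 0 = p \<Longrightarrow> C2_near (\<lambda>v :: complex ^ 'n. f (\<phi> v)) 0"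
  shows "\<exists>V H. restricted_hessian F f p V H"
proof -
  obtain V \<phi> where \<phi>: "local_chart F p V \<phi>" using chart by blast
  then have "C2_near (f \<circ> \<phi>) 0" using C2 by (simp add: local_chart_def o_def)
  then obtain g0 H where g: "has_grad_hessian (f \<circ> \<phi>) 0 g0 H" using C2_near_has_grad_hessian by blast
  have "g0 \<bullet> v = 0" if "v \<in> V" for v by (rule hessian_pullback(2)[OF \<phi> L f g that that])
  then show ?thesis using \<phi> g unfolding restricted_hessian_def by blast
qed

lemma perimeter_index:
  assumes rep: "rep P = p"
  shows "morse_index area perimeter P = 2 * m - 2" "nondegenerate_critical area perimeter P"
proof -
  have f: "perimeter y = (perimeter y - \<mu> * area y) + \<mu> * area y" for y :: "complex ^ 'n" by simp
  have ex: "\<exists>V H. restricted_hessian area perimeter p V H"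
    by (rule ex_restricted_hessian[OF ex_area_chart area_lagrangian f])
       (intro C2_near_perimeter, simp_all add: edge_p_nonzero)
  have ag: "area_grad p = 1 *\<^sub>R area_grad p" by simp
  have one: "(1::real) \<noteq> 0" by simp
  note idx = index_of_restriction[OF _ GDERIV_area ag one area_lagrangian f one]
  show "morse_index area perimeter P = 2 * m - 2"
    unfolding morse_index_def rep
  proof (rule the_equality)
    show "\<exists>V H. restricted_hessian area perimeter p V H \<and> 2 * m - 2 = negative_index V H"
      using ex idx(1) by fastforce
  qed (use idx(1) in auto)
  show "nondegenerate_critical area perimeter P"
    unfolding nondegenerate_critical_def rep using ex idx(2) by metis
qed

text \<open>The multiplier has the sign of w. For positive w the factor - 1 / \<mu> is negative, and
  the index counts the positive directions of the Lagrangian Hessian.\<close>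

lemma area_index:
  assumes rep: "rep P = p"
  shows "morse_index perimeter area P = (if w > 0 then 2 * n - 2 - 2 * m else 2 * m - 2)"
proof -
  have f: "area y = (area y - 1 / \<mu> * perimeter y) + 1 / \<mu> * perimeter y" for y :: "complex ^ 'n" by simp
  have ex: "\<exists>V H. restricted_hessian perimeter area p V H"
    by (rule ex_restricted_hessian[OF ex_perimeter_chart perimeter_lagrangian f]) (rule C2_near_area)
  have s: "- 1 / \<mu> \<noteq> 0" using mu_sgn(2) by simp
  note idx = index_of_restriction[OF _ GDERIV_perimeter[OF edge_p_nonzero] perimeter_grad_p mu_sgn(2)
    perimeter_lagrangian f s]
  have "(- 1 / \<mu> > 0) = (\<not> w > 0)"
    using mu_sgn w(1) by (auto simp: sgn_if zero_less_divide_iff split: if_splits)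
  then have index: "negative_index V H = (if w > 0 then 2 * n - 2 - 2 * m else 2 * m - 2)"
    if "restricted_hessian perimeter area p V H" for V H
    using idx(1)[OF that] by simp
  show ?thesis
    unfolding morse_index_def rep
  proof (rule the_equality)
    obtain V H where "restricted_hessian perimeter area p V H" using ex by blast
    then show "\<exists>V H. restricted_hessian perimeter area p V H \<and>
        (if w > 0 then 2 * n - 2 - 2 * m else 2 * m - 2) = negative_index V H"
      using index by metis
  qed (use index in auto)
qed

text \<open>No edge vanishes, so the Clarke derivative is bounded below by the linear directional
  derivative, which by the Lagrange equation is \<mu> times that of the area.\<close>

lemma critical_p:
  assumes rep: "rep P = p"
  shows "critical P"
  unfolding critical_iff rep
proof (intro exI[of _ \<mu>] allI)
  fix v
  have "\<mu> * (area_grad p \<bullet> v) = perimeter_dir p v"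
    using perimeter_grad_p inner_perimeter_grad[of p v] edge_p_nonzero
    by (simp add: perimeter_dir_def)
  then show "ereal (\<mu> * (area_grad p \<bullet> v)) \<le> clarke_derivative perimeter p v"
    using clarke_derivative_perimeter_ge[OF edge_p_nonzero] by simp
qed

end

section \<open>Critical polygons of given area\<close>

lemma critical_imp_regular_star:
  fixes P :: "(complex ^ 'n :: finite) set"
  assumes n: "CARD('n) \<ge> 3" and P: "P \<in> polygons" and crit: "critical P"
  shows "regular_star P"
proof -
  obtain \<mu> where mu: "\<And>v. ereal (\<mu> * (area_grad (rep P) \<bullet> v)) \<le> clarke_derivative perimeter (rep P) v"
    using crit by (auto simp: critical_iff)
  have dir: "\<mu> * (area_grad (rep P) \<bullet> v) \<le> perimeter_dir (rep P) v" for v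
    using order_trans[OF mu clarke_derivative_perimeter_le] by simp
  have "CARD('n) \<ge> 2" using n by simp
  then obtain u b where "\<And>k. vertex (rep P) (k + 1) = u * vertex (rep P) k + b"
    using critical_imp_shift_similar[OF _ rep_nonconst[OF P] dir] by blast
  then obtain c z w where "rep P = star c z w"
    using similar_shift_imp_star[OF rep_nonconst[OF P]] by metis
  then show ?thesis using regular_star_rep_star P by blast
qed

text \<open>Each edge is traversed back by the next one, so consecutive terms of the area are
  opposite, while a cyclic shift does not change their sum.\<close>

lemma complete_fold_area:
  fixes P :: "(complex ^ 'n :: finite) set"
  assumes "complete_fold P"
  shows "area (rep P) = 0"
proof -
  let ?p = "rep P"
  have v: "vertex ?p (k + 2) = vertex ?p k" for k using assms by (auto simp: complete_fold_def)
  let ?f = "\<lambda>k. Im (cnj (vertex ?p k) * vertex ?p (k + 1))"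
  have "?f (k + 1) = - ?f k" for k
    using v[of k] by (simp add: numeral_2_eq_2)
  then have "(\<Sum>k<CARD('n). ?f (k + 1)) = - (\<Sum>k<CARD('n). ?f k)" by (simp only: sum_negf)
  moreover have "(\<Sum>k<CARD('n). ?f (k + 1)) = (\<Sum>k<CARD('n). ?f k)"
    using vertex_add_card(2)[of ?p 1] vertex_add_card(2)[of ?p 0] by (intro cyclic_sum_shift) simp
  ultimately show ?thesis unfolding area_eq_Im by simp
qed

lemma star_polygon:
  fixes P :: "(complex ^ 'n :: finite) set"
  assumes "regular_star P" "\<not> complete_fold P"
  obtains c z where "winding_polygon (rep P) c z (winding P)"
proof -
  obtain c z w where "rep P = star c z w" "z \<noteq> 0" "w \<noteq> 0" "2 * \<bar>w\<bar> < int CARD('n)"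
    using regular_star_imp_star[OF assms] .
  then have "winding_polygon (rep P) c z (winding P)"
    using winding_star[of P c z w] by (simp add: winding_polygon_def)
  then show ?thesis by (rule that)
qed

text \<open>A complete fold is excluded by its zero area, and the area of any other regular star has
  the sign of its winding number.\<close>

lemma critical_polygons_eq:
  assumes "CARD('n :: finite) \<ge> 3" "a \<noteq> 0"
  shows "(critical_polygons a :: (complex ^ 'n) set set) =
    {P \<in> level_polygons a. regular_star P \<and> \<not> complete_fold P \<and> sgn (of_int (winding P)) = sgn a}"
proof (intro equalityI subsetI)
  fix P :: "(complex ^ 'n) set"
  assume "P \<in> critical_polygons a"
  then have P: "P \<in> level_polygons a" "P \<in> polygons" "critical P" "area (rep P) = a"
    by (auto simp: critical_polygons_def level_polygons_def)
  have star: "regular_star P" by (rule critical_imp_regular_star[OF assms(1) P(2,3)])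
  have fold: "\<not> complete_fold P" using complete_fold_area P(4) assms(2) by blast
  obtain c z where "winding_polygon (rep P) c z (winding P)" using star_polygon[OF star fold] .
  then have "sgn a = sgn (of_int (winding P))" using winding_polygon.area_p(2) P(4) by metis
  then show "P \<in> {P \<in> level_polygons a. regular_star P \<and> \<not> complete_fold P \<and> sgn (of_int (winding P)) = sgn a}"
    using P star fold by simp
next
  fix P :: "(complex ^ 'n) set"
  assume P: "P \<in> {P \<in> level_polygons a. regular_star P \<and> \<not> complete_fold P \<and> sgn (of_int (winding P)) = sgn a}"
  then obtain c z where "winding_polygon (rep P) c z (winding P)" using star_polygon[of P] by auto
  then have "critical P" using winding_polygon.critical_p by blast
  then show "P \<in> critical_polygons a" using P by (simp add: critical_polygons_def)
qed

lemma star_orbit_unique: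
  assumes "cmod z = cmod z'" "z' \<noteq> 0"
  shows "orbit (star c z w :: complex ^ 'n :: finite) = orbit (star c' z' w)"
proof -
  have "(star c z w :: complex ^ 'n) = move (z / z') (c - z / z' * c') (star c' z' w)"
    by (rule tuple_eqI) (use assms in \<open>simp add: vertex_star field_simps\<close>)
  moreover have "norm (z / z') = 1" using assms by (simp add: norm_divide)
  ultimately show ?thesis using orbit_move by metis
qed

text \<open>The area is the squared radius times a nonzero factor that depends only on the winding
  number, so a fixes the radius; an isometry absorbs the center and the phase.\<close>

lemma critical_winding_inj:
  assumes "CARD('n :: finite) \<ge> 3" "a \<noteq> 0"
    and P: "P \<in> (critical_polygons a :: (complex ^ 'n) set set)" "Q \<in> (critical_polygons a :: (complex ^ 'n) set set)"
    and eq: "winding P = winding Q"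
  shows "P = Q"
proof -
  have *: "\<exists>c z. rep P = star c z (winding P) \<and> z \<noteq> 0 \<and> (cmod z)\<^sup>2 * s = a \<and> winding_polygon (rep P) c z (winding P)"
    if "P \<in> (critical_polygons a :: (complex ^ 'n) set set)"
      "s = real CARD('n) / 2 * sin (2 * pi * of_int (winding P) / real CARD('n))" for P s
  proof -
    have P: "regular_star P" "\<not> complete_fold P" "area (rep P) = a"
      using that(1) unfolding critical_polygons_eq[OF assms(1,2)] by (auto simp: level_polygons_def)
    obtain c z where wp: "winding_polygon (rep P) c z (winding P)" using star_polygon[OF P(1,2)] .
    note star = wp[unfolded winding_polygon_def]
    have "\<not> int CARD('n) dvd winding P" using star not_dvd_small by blast
    then have "area (rep P) = real CARD('n) / 2 * (cmod z)\<^sup>2 * sin (2 * pi * of_int (winding P) / real CARD('n))"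
      using star area_star by metis
    then have "(cmod z)\<^sup>2 * s = a" by (simp only: P(3) that(2) mult_ac)
    then show ?thesis using star wp by blast
  qed
  obtain c z where p: "rep P = star c z (winding P)" "z \<noteq> 0"
      "(cmod z)\<^sup>2 * (real CARD('n) / 2 * sin (2 * pi * of_int (winding P) / real CARD('n))) = a"
    using *[OF P(1) refl] by blast
  obtain c' z' where q: "rep Q = star c' z' (winding Q)" "z' \<noteq> 0"
      "(cmod z')\<^sup>2 * (real CARD('n) / 2 * sin (2 * pi * of_int (winding Q) / real CARD('n))) = a"
    using *[OF P(2) refl] by blast
  define s where "s = real CARD('n) / 2 * sin (2 * pi * of_int (winding Q) / real CARD('n))"
  have "(cmod z)\<^sup>2 * s = (cmod z')\<^sup>2 * s" using p(3) q(3) eq by (simp add: s_def)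
  moreover have "s \<noteq> 0" using q(3) assms(2) by (auto simp: s_def)
  ultimately have "cmod z = cmod z'" by simp
  then have "orbit (rep P) = orbit (rep Q)" unfolding p(1) q(1) eq using q(2) by (rule star_orbit_unique)
  moreover have "P \<in> polygons" "Q \<in> polygons" using P by (auto simp: critical_polygons_def level_polygons_def)
  ultimately show ?thesis using orbit_rep by metis
qed

text \<open>A star of radius 1 with winding number w has area A of the sign of w, hence of a; radius
  \<open>sqrt (a / A)\<close> then gives area a.\<close>

lemma ex_critical_winding:
  fixes w :: int
  assumes n: "CARD('n :: finite) \<ge> 3" and "a \<noteq> 0" and w: "sgn (of_int w) = sgn a" "2 * \<bar>w\<bar> < int CARD('n)"
  shows "\<exists>P \<in> (critical_polygons a :: (complex ^ 'n) set set). winding P = w"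
proof -
  have w0: "w \<noteq> 0" using w(1) \<open>a \<noteq> 0\<close> by (auto simp: sgn_zero_iff)
  define A where "A = area (star 0 1 w :: complex ^ 'n)"
  have "winding_polygon (star 0 1 w :: complex ^ 'n) 0 1 w" using w w0 by (simp add: winding_polygon_def)
  then have "sgn A = sgn a" "A \<noteq> 0" using winding_polygon.area_p w(1) unfolding A_def by metis+
  then have pos: "a / A > 0" by (auto simp: sgn_if zero_less_divide_iff split: if_splits)
  define z where "z = complex_of_real (sqrt (a / A))"
  have z: "z \<noteq> 0" "(cmod z)\<^sup>2 = a / A" using pos \<open>a \<noteq> 0\<close> \<open>A \<noteq> 0\<close> by (simp_all add: z_def)
  define p where "p = (star 0 z w :: complex ^ 'n)"
  have wp: "winding_polygon p 0 z w" using w w0 z by (simp add: winding_polygon_def p_def)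
  have "area p = (cmod z)\<^sup>2 * A"
    unfolding p_def A_def area_star[OF not_dvd_small[OF w0 w(2)]] by simp
  then have area: "area p = a" using z(2) \<open>A \<noteq> 0\<close> by simp
  have nc: "p \<in> nonconst_tuples" by (rule winding_polygon.p_nonconst[OF wp])
  define P where "P = orbit p"
  have P: "P \<in> polygons" using nc by (auto simp: P_def polygons_def)
  obtain u b where u: "norm u = 1" "rep P = move u b p" unfolding P_def by (rule rep_orbit[OF nc])
  have rep: "rep P = star b (u * z) w"
    by (rule tuple_eqI) (simp add: u(2) p_def vertex_star)
  have uz: "u * z \<noteq> 0" using u(1) z(1) by auto
  have wP: "winding_polygon (rep P) b (u * z) w" using rep uz w w0 by (simp add: winding_polygon_def)
  have wind: "winding P = w" by (rule winding_star[OF rep uz w0 w(2)])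
  have "area (rep P) = area p"
    unfolding rep p_def area_star[OF not_dvd_small[OF w0 w(2)]] using u(1) by (simp add: norm_mult)
  then have "P \<in> level_polygons a" using P area by (simp add: level_polygons_def)
  then have "P \<in> critical_polygons a" using winding_polygon.critical_p[OF wP] by (simp add: critical_polygons_def)
  then show ?thesis using wind by blast
qed

lemma critical_polygon_indices:
  assumes n: "CARD('n :: finite) \<ge> 3" "a \<noteq> 0" and P: "P \<in> (critical_polygons a :: (complex ^ 'n) set set)"
  shows "sgn (of_int (winding P)) = sgn a" "2 * nat \<bar>winding P\<bar> < CARD('n)"
    "morse_index area perimeter P = 2 * nat \<bar>winding P\<bar> - 2"
    "nondegenerate_critical area perimeter P"
    "morse_index perimeter area P = (if winding P > 0 then 2 * CARD('n) - 2 - 2 * nat \<bar>winding P\<bar> else 2 * nat \<bar>winding P\<bar> - 2)"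
proof -
  have S: "regular_star P" "\<not> complete_fold P" "sgn (of_int (winding P)) = sgn a"
    using P unfolding critical_polygons_eq[OF n] by auto
  show "sgn (of_int (winding P)) = sgn a" by (rule S(3))
  obtain c z where "winding_polygon (rep P) c z (winding P)" using star_polygon[OF S(1,2)] .
  then interpret winding_polygon "rep P" c z "winding P" .
  show "2 * nat \<bar>winding P\<bar> < CARD('n)" using m_bounds(2) by (simp add: m_def n_def)
  show "morse_index area perimeter P = 2 * nat \<bar>winding P\<bar> - 2" "nondegenerate_critical area perimeter P"
    using perimeter_index[OF refl] by (simp_all add: m_def)
  show "morse_index perimeter area P = (if winding P > 0 then 2 * CARD('n) - 2 - 2 * nat \<bar>winding P\<bar> else 2 * nat \<bar>winding P\<bar> - 2)"
    using area_index[OF refl] by (simp add: m_def n_def)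
qed

text \<open>Solving 2 |w| - 2 = k gives |w| = k / 2 + 1, which requires k even and satisfies 2 |w| <
  n exactly when k + 2 < n; the sign of w is that of a.\<close>

lemma index_polygons_card:
  assumes n: "CARD('n :: finite) \<ge> 3" "a \<noteq> 0"
  shows "finite (index_polygons a k :: (complex ^ 'n) set set)"
    and "card (index_polygons a k :: (complex ^ 'n) set set) = (if even k \<and> k + 2 < CARD('n) then 1 else 0)"
proof -
  let ?I = "index_polygons a k :: (complex ^ 'n) set set"
  define sg :: int where "sg = (if a > 0 then 1 else - 1)"
  have ind: "P \<in> critical_polygons a" "winding P = sg * (int k div 2 + 1)" "even k" "k + 2 < CARD('n)"
    if "P \<in> ?I" for P
  proof -
    show P: "P \<in> critical_polygons a" using that by (simp add: index_polygons_def)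
    have k: "2 * nat \<bar>winding P\<bar> - 2 = k"
      using that critical_polygon_indices(3)[OF n P] by (simp add: index_polygons_def)
    have sgn: "sgn (real_of_int (winding P)) = sgn a" by (rule critical_polygon_indices(1)[OF n P])
    then have "winding P \<noteq> 0" using n(2) by (auto simp: sgn_zero_iff)
    then have "nat \<bar>winding P\<bar> \<ge> 1" by linarith
    then have k2: "2 * nat \<bar>winding P\<bar> = k + 2" using k by linarith
    have "even (k + 2)" using k2 by (metis dvd_triv_left)
    then show "even k" by simp
    show "k + 2 < CARD('n)" using critical_polygon_indices(2)[OF n P] k2 by simp
    have "\<bar>winding P\<bar> = int k div 2 + 1" using k2 by linarith
    moreover have "winding P = sg * \<bar>winding P\<bar>"
      using sgn n(2) by (auto simp: sg_def sgn_if split: if_splits)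
    ultimately show "winding P = sg * (int k div 2 + 1)" by simp
  qed
  have sub: "P = Q" if "P \<in> ?I" "Q \<in> ?I" for P Q
    using critical_winding_inj[OF n ind(1)[OF that(1)] ind(1)[OF that(2)]] ind(2)[OF that(1)] ind(2)[OF that(2)] by simp
  then have "?I = {} \<or> (\<exists>P. ?I = {P})" by blast
  then show fin: "finite ?I" by (metis finite.emptyI finite.insertI)
  show "card ?I = (if even k \<and> k + 2 < CARD('n) then 1 else 0)"
  proof (cases "even k \<and> k + 2 < CARD('n)")
    case True
    define w where "w = sg * (int k div 2 + 1)"
    have "\<bar>w\<bar> = int k div 2 + 1" by (simp add: w_def sg_def abs_mult)
    then have w2: "2 * \<bar>w\<bar> = int k + 2" using True by presburger
    have "sgn (real_of_int w) = sgn a"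
    proof -
      have "w = sg * \<bar>w\<bar>" "\<bar>w\<bar> > 0" using \<open>\<bar>w\<bar> = int k div 2 + 1\<close> by (auto simp: w_def)
      then show ?thesis using n(2) by (auto simp: sg_def sgn_if split: if_splits)
    qed
    moreover have "2 * \<bar>w\<bar> < int CARD('n)" using w2 True by linarith
    ultimately obtain P where P: "P \<in> (critical_polygons a :: (complex ^ 'n) set set)" "winding P = w"
      using ex_critical_winding[OF n] by blast
    have "morse_index area perimeter P = k"
      using critical_polygon_indices(3)[OF n P(1)] P(2) w2 by linarith
    then have "P \<in> ?I" using P by (simp add: index_polygons_def)
    then have "?I = {P}" using sub by blast
    then show ?thesis using True by simp
  next
    case False
    then have "?I = {}" using ind by blast
    then show ?thesis using False by auto
  qed
qed

thm_deps index_polygons_card even_homology_level_space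

theorem theorem4:
  fixes a :: real
  assumes "CARD('n :: finite) \<ge> 3" and "a \<noteq> 0"
  shows "perimeter_perfect_Morse TYPE('n) a
    \<and> (a > 0 \<longrightarrow>
        (critical_polygons a :: (complex ^ 'n) set set) =
          {P \<in> level_polygons a. regular_star P \<and> \<not> complete_fold P \<and> winding P > 0}
      \<and> (\<forall>P \<in> (critical_polygons a :: (complex ^ 'n) set set).
          morse_index area perimeter P + morse_index perimeter area P = 2 * CARD('n) - 4))
    \<and> (a < 0 \<longrightarrow>
        (critical_polygons a :: (complex ^ 'n) set set) =
          {P \<in> level_polygons a. regular_star P \<and> \<not> complete_fold P \<and> winding P < 0}
      \<and> (\<forall>P \<in> (critical_polygons a :: (complex ^ 'n) set set).
          morse_index area perimeter P = morse_index perimeter area P))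
    \<and> (\<forall>P \<in> (critical_polygons a :: (complex ^ 'n) set set).
          (winding P < 0 \<longrightarrow> int (morse_index perimeter area P) = - 2 * winding P - 2)
        \<and> (winding P > 0 \<longrightarrow>
            int (morse_index perimeter area P) = 2 * int CARD('n) - 2 * winding P - 2))"
proof (intro conjI impI ballI)
  note idx = critical_polygon_indices[OF assms]
  show "perimeter_perfect_Morse TYPE('n) a"
    unfolding perimeter_perfect_Morse_def
  proof (intro conjI ballI allI)
    show "nondegenerate_critical area perimeter P" if "P \<in> critical_polygons a" for P :: "(complex ^ 'n) set"
      by (rule idx(4)[OF that])
    fix k
    show "finite (index_polygons a k :: (complex ^ 'n) set set)" by (rule index_polygons_card(1)[OF assms])
    \<comment> \<open>The highest even degree with nonzero homology matches the index for the
      largest |w| with 2 |w| < n.\<close>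
    have "even k \<and> k < 2 * ((CARD('n) - 1) div 2) \<longleftrightarrow> even k \<and> k + 2 < CARD('n)" by presburger
    then show "enat (card (index_polygons a k :: (complex ^ 'n) set set)) =
        group_rank (homology_group (int k) (level_space a :: (complex ^ 'n) set topology))"
      unfolding index_polygons_card(2)[OF assms] group_rank_even_homology[OF even_homology_level_space[OF assms]]
      by (simp add: enat_0 one_enat_def)
  qed
  show "(critical_polygons a :: (complex ^ 'n) set set) =
      {P \<in> level_polygons a. regular_star P \<and> \<not> complete_fold P \<and> winding P > 0}" if "a > 0"
    unfolding critical_polygons_eq[OF assms] using that by (auto simp: sgn_if split: if_splits)
  show "(critical_polygons a :: (complex ^ 'n) set set) =
      {P \<in> level_polygons a. regular_star P \<and> \<not> complete_fold P \<and> winding P < 0}" if "a < 0"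
    unfolding critical_polygons_eq[OF assms] using that by (auto simp: sgn_if split: if_splits)
  fix P :: "(complex ^ 'n) set" assume P: "P \<in> critical_polygons a"
  have w0: "winding P \<noteq> 0" using idx(1)[OF P] assms(2) by (auto simp: sgn_zero_iff)
  then have w1: "nat \<bar>winding P\<bar> \<ge> 1" by linarith
  show "morse_index area perimeter P + morse_index perimeter area P = 2 * CARD('n) - 4" if "a > 0"
  proof -
    have "winding P > 0" using idx(1)[OF P] that by (auto simp: sgn_if split: if_splits)
    then show ?thesis using idx(2,3,5)[OF P] w1 by simp
  qed
  show "morse_index area perimeter P = morse_index perimeter area P" if "a < 0"
  proof -
    have "\<not> winding P > 0" using idx(1)[OF P] that by (auto simp: sgn_if split: if_splits)
    then show ?thesis using idx(3,5)[OF P] by simp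
  qed
  show "int (morse_index perimeter area P) = - 2 * winding P - 2" if "winding P < 0"
    using idx(5)[OF P] w1 that by simp
  show "int (morse_index perimeter area P) = 2 * int CARD('n) - 2 * winding P - 2" if "winding P > 0"
    using idx(2,5)[OF P] w1 that by simp
qed

end
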